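(* Let $\mu$ be a non-degenerate probability measure supported on $[0,1]$ with cumulant generating function $K(\theta)=\log\int e^{\theta x}\mu(dx)$, let $H_1$ be a single edge, and let $H_2$ be a finite simple graph with $p\ge 2$ edges such that the equation $K'''(\theta)K'(\theta)=-(p-2)\left(K''(\theta)\right)^2$ has exactly one solution $\theta\in\mathbb{R}$. Let $\psi_\infty^\beta$ be the limiting normalization constant of the $2$-parameter edge-weighted exponential random graph model with edge-weight distribution $\mu$, for $\beta=(\beta_1,\beta_2)$ with $\beta_2\ge 0$. Then there exist a point $(\beta_1^c,\beta_2^c)$ in the upper half-plane and a decreasing curve $\beta_2=r(\beta_1)$, $\beta_1\le\beta_1^c$, with endpoint $r(\beta_1^c)=\beta_2^c$ included in the curve, such that $\psi_\infty^\beta$ is analytic at all $(\beta_1,\beta_2)$ in the upper half-plane $\{\beta_2\ge 0\}$ except on this curve. The derivatives $\frac{\partial}{\partial\beta_1}\psi_\infty^\beta$ and $\frac{\partial}{\partial\beta_2}\psi_\infty^\beta$ have (jump) discontinuities across the curve, except at the endpoint $(\beta_1^c,\beta_2^c)$, where all the second derivatives $\frac{\partial^2}{\partial\beta_1^2}\psi_\infty^\beta$, $\frac{\partial^2}{\partial\beta_1\partial\beta_2}\psi_\infty^\beta$ and $\frac{\partial^2}{\partial\beta_2^2}\psi_\infty^\beta$ diverge.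
   Context: Model: $\mathcal{G}_n$ is the set of edge-weighted complete labeled graphs $G_n$ on $n$ vertices (undirected, no loops or multiple edges), where the edge weights $x_{ij}=x_{ji}$, $i<j$, are iid with distribution $\mu$ (and $x_{ii}=0$); this gives a probability measure $\mathbb{P}_n$ on $\mathcal{G}_n$ with expectation $\mathbb{E}_n$. The graphon of $G_n$ is $h^{G_n}:[0,1]^2\to[0,1]$, $h^{G_n}(x,y)=x_{\lceil nx\rceil\lceil ny\rceil}$. For a finite simple graph $H$ with vertex set $\{1,\dots,k\}$ and edge set $E(H)$, the homomorphism density is $t(H,G_n)=\int_{[0,1]^k}\prod_{\{i,j\}\in E(H)}h^{G_n}(x_i,x_j)\,dx_1\cdots dx_k$. The $2$-parameter exponential random graph model is the probability measure $\mathbb{P}_n^\beta$ on $\mathcal{G}_n$ with density $\exp\left(n^2\left(\beta_1t(H_1,G_n)+\beta_2t(H_2,G_n)-\psi_n^\beta\right)\right)$ with respect to $\mathbb{P}_n$, where $\psi_n^\beta=\frac{1}{n^2}\log\mathbb{E}_n\left(\exp\left(n^2(\beta_1t(H_1,G_n)+\beta_2t(H_2,G_n))\right)\right)$. The limiting normalization constant is $\psi_\infty^\beta=\lim_{n\to\infty}\psi_n^\beta$. It is known that for $\beta_2\ge 0$ this limit exists and $\psi_\infty^\beta=\sup_u\left(\beta_1u+\beta_2u^p-\frac12 I(u)\right)$, where $I(u)=\sup_{\theta\in\mathbb{R}}\{\theta u-K(\theta)\}$ and the supremum is over all $u$ with $I(u)<\infty$. *)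

theory Defs
  imports "HOL-Probability.Probability"
begin

text \<open>
  An undirected edge between distinct vertices \<open>i\<close>, \<open>j\<close> is represented by the
  pair with the smaller vertex first.
\<close>

definition vertex_pairs :: "nat \<Rightarrow> (nat \<times> nat) set" where
  "vertex_pairs n = {(i, j). 1 \<le> i \<and> i < j \<and> j \<le> n}"

text \<open>\<open>(k, E)\<close>: vertex set \<open>{1..k}\<close>, edge set \<open>E\<close>.\<close>

type_synonym graph = "nat \<times> (nat \<times> nat) set"

definition simple_graph :: "graph \<Rightarrow> bool" where
  "simple_graph H \<longleftrightarrow> snd H \<subseteq> vertex_pairs (fst H)"

definition single_edge :: graph where
  "single_edge = (2, {(1, 2)})"

definition weighted_graph_measure :: "real measure \<Rightarrow> nat \<Rightarrow> ((nat \<times> nat) \<Rightarrow> real) measure" where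
  "weighted_graph_measure \<mu> n = PiM (vertex_pairs n) (\<lambda>_. \<mu>)"

definition edge_weight :: "nat \<Rightarrow> ((nat \<times> nat) \<Rightarrow> real) \<Rightarrow> nat \<Rightarrow> nat \<Rightarrow> real" where
  "edge_weight n w i j =
     (if (i, j) \<in> vertex_pairs n then w (i, j)
      else if (j, i) \<in> vertex_pairs n then w (j, i) else 0)"

text \<open>
  At \<open>x = 0\<close> the ceiling is \<open>0\<close>, which is not a vertex; the value of the graphon
  there is \<open>0\<close>, on a null set.
\<close>

definition graphon :: "nat \<Rightarrow> ((nat \<times> nat) \<Rightarrow> real) \<Rightarrow> real \<Rightarrow> real \<Rightarrow> real" where
  "graphon n w x y = edge_weight n w (nat \<lceil>real n * x\<rceil>) (nat \<lceil>real n * y\<rceil>)"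

definition hom_density :: "graph \<Rightarrow> nat \<Rightarrow> ((nat \<times> nat) \<Rightarrow> real) \<Rightarrow> real" where
  "hom_density H n w =
     (\<integral>x. (\<Prod>(i, j)\<in>snd H. graphon n w (x i) (x j))
        \<partial>(PiM {1..fst H} (\<lambda>_. restrict_space lborel {0..1})))"

definition psi_n :: "real measure \<Rightarrow> graph \<Rightarrow> graph \<Rightarrow> nat \<Rightarrow> real \<times> real \<Rightarrow> real" where
  "psi_n \<mu> H1 H2 n \<beta> =
     1 / (real n)\<^sup>2 *
     ln (\<integral>w. exp ((real n)\<^sup>2 * (fst \<beta> * hom_density H1 n w + snd \<beta> * hom_density H2 n w))
          \<partial>(weighted_graph_measure \<mu> n))"

definition psi_inf :: "real measure \<Rightarrow> graph \<Rightarrow> graph \<Rightarrow> real \<times> real \<Rightarrow> real" where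
  "psi_inf \<mu> H1 H2 \<beta> = lim (\<lambda>n. psi_n \<mu> H1 H2 n \<beta>)"

definition cgf :: "real measure \<Rightarrow> real \<Rightarrow> real" where
  "cgf \<mu> \<theta> = ln (\<integral>x. exp (\<theta> * x) \<partial>\<mu>)"

definition nondegenerate :: "real measure \<Rightarrow> bool" where
  "nondegenerate \<mu> \<longleftrightarrow> \<not> (\<exists>c. AE x in \<mu>. x = c)"

definition upper_half_plane :: "(real \<times> real) set" where
  "upper_half_plane = {(x, y). 0 \<le> y}"

text \<open>
  Real analyticity at \<open>z\<close> of a function with domain \<open>S\<close>: near \<open>z\<close>, on \<open>S\<close>, it
  is the sum of a double power series centred at \<open>z\<close>. At an interior point of \<open>S\<close> this is the
  usual notion; at a boundary point it means having an analytic extension to a neighbourhood.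
\<close>

definition real_analytic_at_within ::
  "(real \<times> real \<Rightarrow> real) \<Rightarrow> real \<times> real \<Rightarrow> (real \<times> real) set \<Rightarrow> bool" where
  "real_analytic_at_within f z S \<longleftrightarrow>
     (\<exists>(a :: nat \<Rightarrow> nat \<Rightarrow> real) e. 0 < e \<and>
        (\<forall>x y. (x, y) \<in> S \<and> \<bar>x - fst z\<bar> < e \<and> \<bar>y - snd z\<bar> < e \<longrightarrow>
           ((\<lambda>(j, k). a j k * (x - fst z) ^ j * (y - snd z) ^ k) has_sum f (x, y)) UNIV))"

definition partial1 :: "(real \<times> real \<Rightarrow> real) \<Rightarrow> real \<times> real \<Rightarrow> real" where
  "partial1 f z = deriv (\<lambda>x. f (x, snd z)) (fst z)"

definition partial2 :: "(real \<times> real \<Rightarrow> real) \<Rightarrow> real \<times> real \<Rightarrow> real" where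
  "partial2 f z = deriv (\<lambda>y. f (fst z, y)) (snd z)"

definition jump_between ::
  "(real \<times> real \<Rightarrow> real) \<Rightarrow> (real \<times> real) set \<Rightarrow> (real \<times> real) set \<Rightarrow> real \<times> real \<Rightarrow> bool" where
  "jump_between f A B z \<longleftrightarrow>
     (\<exists>a b. a \<noteq> b \<and> (f \<longlongrightarrow> a) (at z within A) \<and> (f \<longlongrightarrow> b) (at z within B))"

definition curve_of :: "(real \<Rightarrow> real) \<Rightarrow> real \<Rightarrow> (real \<times> real) set" where
  "curve_of r c = {(x, y). x \<le> c \<and> y = r x}"

definition above_curve :: "(real \<Rightarrow> real) \<Rightarrow> real \<Rightarrow> (real \<times> real) set" where
  "above_curve r c = {(x, y). x \<le> c \<and> r x < y}"

definition below_curve :: "(real \<Rightarrow> real) \<Rightarrow> real \<Rightarrow> (real \<times> real) set" where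
  "below_curve r c = {(x, y). x \<le> c \<and> 0 \<le> y \<and> y < r x}"

end

theory Submission
  imports Defs "HOL-Complex_Analysis.Complex_Analysis" "HOL-Real_Asymp.Real_Asymp"
begin

text \<open>
  Write \<open>K\<close> for the cumulant generating function of \<open>\<mu>\<close> and parametrise an edge density \<open>u\<close> by its tilt
  \<open>\<theta>\<close>, so \<open>u = K' \<theta>\<close>. For \<open>\<beta>\<^sub>2 \<ge> 0\<close> the limiting normalization constant is a one-dimensional
  maximum: the largest value \<open>\<Psi> \<beta>\<close> over \<open>\<theta>\<close> of \<open>L \<beta> \<theta> = \<beta>\<^sub>1 u + \<beta>\<^sub>2 u ^ p - (\<theta> u - K \<theta>) / 2\<close>.

  The lower bound (\<open>psi_n_lower\<close>) is Jensen's inequality for the law in which the edges are independent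
  with tilt \<open>\<theta>\<close>; only injective vertex maps are kept, since they use distinct, hence independent, edges.
  The upper bound (\<open>psi_n_upper\<close>) dominates the homomorphism density, up to \<open>\<epsilon>\<close>, by a maximum of only
  \<open>exp (O(n))\<close> linear functions of the \<open>n (n - 1) / 2\<close> weights, so that a union bound costs
  \<open>O(1 / n)\<close> after normalization, and the exponential moment of a linear function is a product of values of
  \<open>exp \<circ> K\<close>. The linear functions come from a greedy form of the weak regularity lemma
  (\<open>approximant_exists\<close>): after boundedly many steps, each with at most \<open>4 ^ n + 2\<close> choices, one reaches a matrix
  \<open>V\<close> close to the weights in the one-sided cut norm. Then a counting lemma (\<open>hom_sum_cut_le\<close>), the
  inequality of arithmetic and geometric means (\<open>hom_sum_le_power\<close>) and the tangent of \<open>u ^ p\<close> at the entries of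
  \<open>V\<close> give the bound.

  The derivative of \<open>L \<beta>\<close> is \<open>K'' \<theta>\<close> times a slope whose own derivative is
  \<open>p (p - 1) \<beta>\<^sub>2 g \<theta> - 1 / 2\<close> with \<open>g = K' ^ (p - 2) * K''\<close>. The condition on \<open>K'''\<close> says that \<open>g\<close> has one
  critical point \<open>\<theta>0\<close>; as \<open>g\<close> is positive with a bounded primitive, it is a strict peak. Hence
  \<open>L \<beta>\<close> has at most one maximizer on either side of \<open>\<theta>0\<close>, and a degenerate one only at \<open>\<theta>0\<close> for a single
  parameter, the end of the curve. Maximizers increase with both parameters (\<open>maximizers_compare\<close>); therefore the
  parameters with two maximizers form the graph of a strictly decreasing function, and connectedness of a vertical
  half-line puts a point of it over every \<open>\<beta>\<^sub>1 < b1c\<close> (\<open>coexist_exists\<close>).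

  Off the curve the maximizer is a simple zero of the slope, which extends holomorphically. Cauchy's formula writes
  \<open>\<Psi>\<close> as a contour integral whose integrand expands into a double geometric series in \<open>\<beta>\<close>; this is
  analyticity (\<open>implicit_double_series\<close>, \<open>Psi_analytic_off_curve\<close>). The first partial derivatives are \<open>K' t\<close> and
  \<open>(K' t) ^ p\<close> at the maximizer \<open>t\<close>, so they jump where \<open>t\<close> jumps. The second ones carry the derivative of the
  slope at \<open>t\<close> in the denominator, and it vanishes in the limit at the end of the curve.
\<close>

section \<open>Moments and cumulants of a law on the unit interval\<close>

locale unit_law = prob_space \<mu> for \<mu> :: "real measure" +
  assumes sets_mu: "sets \<mu> = sets borel"
    and in_unit: "AE x in \<mu>. x \<in> {0..1}"
    and nondeg: "nondegenerate \<mu>"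
begin

lemma measurable_mu: "f \<in> borel_measurable borel \<Longrightarrow> f \<in> borel_measurable \<mu>"
  using measurable_cong_sets[OF sets_mu refl] by blast

lemma integrable_mu:
  fixes f :: "real \<Rightarrow> real"
  assumes "f \<in> borel_measurable borel" "\<And>x. x \<in> {0..1} \<Longrightarrow> \<bar>f x\<bar> \<le> B"
  shows "integrable \<mu> f"
proof (rule integrable_const_bound[of _ B])
  show "AE x in \<mu>. norm (f x) \<le> B" using in_unit by eventually_elim (use assms(2) in auto)
qed (rule measurable_mu[OF assms(1)])

definition moment :: "nat \<Rightarrow> real" where "moment k = (\<integral>x. x ^ k \<partial>\<mu>)"

lemma integrable_power: "integrable \<mu> (\<lambda>x. x ^ k)"
  by (rule integrable_mu[of _ 1]) (auto simp: power_le_one power_abs)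

lemma moment_bounds: "0 \<le> moment k" "moment k \<le> 1"
proof -
  show "0 \<le> moment k" unfolding moment_def
    by (rule integral_nonneg_AE) (use in_unit in \<open>eventually_elim, auto\<close>)
  have "moment k \<le> (\<integral>x. 1 \<partial>\<mu>)" unfolding moment_def
    by (rule integral_mono_AE[OF integrable_power]) (use in_unit in \<open>simp, eventually_elim, auto simp: power_le_one\<close>)
  then show "moment k \<le> 1" by (simp add: prob_space)
qed

text \<open>
  The \<open>k\<close>-th derivative of the moment generating function, as a power series whose coefficients are moments.
  Being polymorphic, it yields the real function and its entire extension at once.
\<close>

definition mgf :: "nat \<Rightarrow> 'a \<Rightarrow> 'a :: {real_normed_field, banach}" where
  "mgf k z = (\<Sum>n. of_real (moment (n + k) / fact n) * z ^ n)"

lemma mgf_summable: 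
  fixes z :: "'a :: {real_normed_field, banach}"
  shows "summable (\<lambda>n. of_real (moment (n + k) / fact n) * z ^ n)"
proof (rule summable_comparison_test')
  show "summable (\<lambda>n. norm z ^ n /\<^sub>R fact n)" by (rule summable_exp_generic)
  show "norm (of_real (moment (n + k) / fact n) * z ^ n) \<le> norm z ^ n /\<^sub>R fact n" if "0 \<le> n" for n
    using moment_bounds[of "n + k"]
    by (auto simp: norm_mult norm_power norm_divide field_simps intro!: mult_left_le)
qed

lemma mgf_deriv:
  fixes z :: "'a :: {real_normed_field, banach}"
  shows "(mgf k has_field_derivative mgf (Suc k) z) (at z)"
proof -
  have *: "diffs (\<lambda>n. of_real (moment (n + k) / fact n)) n = (of_real (moment (n + Suc k) / fact n) :: 'a)" for n
  proof -
    have "real (Suc n) * (moment (n + Suc k) / fact (Suc n)) = moment (n + Suc k) / fact n"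
      by (simp add: fact_Suc del: of_nat_Suc)
    then have "of_real (real (Suc n) * (moment (n + Suc k) / fact (Suc n))) = (of_real (moment (n + Suc k) / fact n) :: 'a)"
      by (simp only:)
    then show ?thesis by (simp only: diffs_def of_real_mult of_real_of_nat_eq add_Suc add_Suc_right)
  qed
  have "((\<lambda>z. \<Sum>n. of_real (moment (n + k) / fact n) * z ^ n) has_field_derivative
      (\<Sum>n. diffs (\<lambda>n. of_real (moment (n + k) / fact n)) n * z ^ n)) (at z)"
    by (rule termdiffs_strong_converges_everywhere[OF mgf_summable])
  then show ?thesis unfolding * mgf_def[abs_def] .
qed

lemma mgf_of_real: "mgf k (of_real x :: complex) = of_real (mgf k x)"
proof -
  have "of_real (mgf k x) = (\<Sum>n. of_real (of_real (moment (n + k) / fact n) * x ^ n) :: complex)"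
    unfolding mgf_def by (rule suminf_of_real[OF mgf_summable])
  then show ?thesis by (simp add: mgf_def)
qed

text \<open>
  Expand the exponential and integrate termwise; on the unit interval the terms are dominated by those of
  \<open>exp \<bar>\<theta>\<bar>\<close>.
\<close>

lemma mgf_integral: "mgf k (\<theta> :: real) = (\<integral>x. x ^ k * exp (\<theta> * x) \<partial>\<mu>)"
proof -
  define f where "f n x = x ^ k * ((\<theta> * x) ^ n / fact n)" for n x
  have int: "integrable \<mu> (f n)" for n
    unfolding f_def power_mult_distrib
    using integrable_mult_right[OF integrable_power[of "n + k"], of "\<theta> ^ n / fact n"]
    by (simp add: power_add mult_ac)
  have bd: "\<bar>f n x\<bar> \<le> \<bar>\<theta>\<bar> ^ n /\<^sub>R fact n" if "x \<in> {0..1}" for n x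
  proof -
    have "\<bar>x ^ k\<bar> * \<bar>\<theta> * x\<bar> ^ n \<le> 1 * \<bar>\<theta>\<bar> ^ n"
      using that by (intro mult_mono power_mono) (auto simp: power_le_one abs_mult mult_left_le)
    then show ?thesis by (simp add: f_def abs_mult power_abs field_simps)
  qed
  have summ: "summable (\<lambda>n. \<bar>\<theta>\<bar> ^ n /\<^sub>R fact n)" by (rule summable_exp_generic)
  have "(\<integral>x. (\<Sum>n. f n x) \<partial>\<mu>) = (\<Sum>n. integral\<^sup>L \<mu> (f n))"
  proof (rule integral_suminf[OF int])
    show "AE x in \<mu>. summable (\<lambda>n. norm (f n x))"
      using in_unit
    proof eventually_elim
      fix x :: real assume "x \<in> {0..1}"
      then show "summable (\<lambda>n. norm (f n x))"
        by (intro summable_comparison_test'[OF summ, of 0]) (use bd in auto)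
    qed
    show "summable (\<lambda>n. \<integral>x. norm (f n x) \<partial>\<mu>)"
    proof (rule summable_comparison_test'[OF summ])
      fix n :: nat
      have "(\<integral>x. norm (f n x) \<partial>\<mu>) \<le> (\<integral>x. \<bar>\<theta>\<bar> ^ n /\<^sub>R fact n \<partial>\<mu>)"
      proof (rule integral_mono_AE)
        show "AE x in \<mu>. norm (f n x) \<le> \<bar>\<theta>\<bar> ^ n /\<^sub>R fact n"
          using in_unit by eventually_elim (use bd in simp)
      qed (use int in auto)
      then show "norm (\<integral>x. norm (f n x) \<partial>\<mu>) \<le> \<bar>\<theta>\<bar> ^ n /\<^sub>R fact n"
        by (simp add: prob_space)
    qed
  qed
  moreover have "(\<Sum>n. f n x) = x ^ k * exp (\<theta> * x)" for x
  proof -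
    have "(\<lambda>n. x ^ k * ((\<theta> * x) ^ n /\<^sub>R fact n)) sums (x ^ k * exp (\<theta> * x))"
      by (intro sums_mult exp_converges)
    then show ?thesis by (simp add: f_def sums_iff divide_inverse mult_ac)
  qed
  moreover have "integral\<^sup>L \<mu> (f n) = moment (n + k) / fact n * \<theta> ^ n" for n
  proof -
    have "f n = (\<lambda>x. (\<theta> ^ n / fact n) * x ^ (n + k))" by (auto simp: f_def power_add power_mult_distrib)
    then show ?thesis by (simp add: moment_def)
  qed
  ultimately show ?thesis by (simp add: mgf_def)
qed

lemma integrable_tilted: 
  assumes "g \<in> borel_measurable borel" "\<And>x. x \<in> {0..1} \<Longrightarrow> \<bar>g x\<bar> \<le> B"
  shows "integrable \<mu> (\<lambda>x. g x * exp (\<theta> * x))"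
proof (rule integrable_mu[of _ "B * exp \<bar>\<theta>\<bar>"])
  fix x :: real assume x: "x \<in> {0..1}"
  have "\<theta> * x \<le> \<bar>\<theta>\<bar> * 1" using x by (intro mult_mono) auto
  then show "\<bar>g x * exp (\<theta> * x)\<bar> \<le> B * exp \<bar>\<theta>\<bar>"
    unfolding abs_mult using assms(2)[OF x] by (intro mult_mono) auto
qed (use assms(1) in measurable)

text \<open>
  A nonnegative function with at most one zero has positive tilted integral, because a vanishing integral would
  concentrate \<open>\<mu>\<close> at that zero. Applied to \<open>x\<close> and to \<open>(x - u)\<^sup>2\<close> this gives positivity of the tilted
  mean and of the tilted variance.
\<close>

lemma tilted_positive:
  assumes g: "g \<in> borel_measurable borel" "\<And>x. x \<in> {0..1} \<Longrightarrow> 0 \<le> g x" "\<And>x. x \<in> {0..1} \<Longrightarrow> \<bar>g x\<bar> \<le> B"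
    and z: "\<And>x. g x = 0 \<Longrightarrow> x = c"
  shows "0 < (\<integral>x. g x * exp (\<theta> * x) \<partial>\<mu>)"
proof -
  have nn: "AE x in \<mu>. 0 \<le> g x * exp (\<theta> * x)" using in_unit by eventually_elim (use g in auto)
  have "(\<integral>x. g x * exp (\<theta> * x) \<partial>\<mu>) \<noteq> 0"
  proof
    assume "(\<integral>x. g x * exp (\<theta> * x) \<partial>\<mu>) = 0"
    then have "AE x in \<mu>. g x * exp (\<theta> * x) = 0"
      using integral_nonneg_eq_0_iff_AE[OF integrable_tilted[OF g(1,3)] nn] by simp
    then have "AE x in \<mu>. x = c" by eventually_elim (use z in auto)
    then show False using nondeg by (auto simp: nondegenerate_def)
  qed
  then show ?thesis using integral_nonneg_AE[OF nn] by linarith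
qed

lemma mgf0_pos: "0 < mgf 0 (\<theta> :: real)"
  unfolding mgf_integral using tilted_positive[of "\<lambda>x. x ^ 0" 1] by simp

lemma mgf1_pos: "0 < mgf 1 (\<theta> :: real)"
  unfolding mgf_integral by (rule tilted_positive[of _ 1 0]) auto

lemma mgf1_le: "mgf 1 (\<theta> :: real) \<le> mgf 0 \<theta>"
  unfolding mgf_integral
proof (rule integral_mono_AE)
  show "AE x in \<mu>. x ^ 1 * exp (\<theta> * x) \<le> x ^ 0 * exp (\<theta> * x)"
    using in_unit by eventually_elim (auto intro!: mult_right_mono)
qed (rule integrable_tilted[of _ 1]; auto)+

text \<open>
  The first three derivatives of \<open>cgf \<mu>\<close>, by the quotient rule (\<open>cgf_derivs\<close>). \<open>K1\<close> and
  \<open>K2\<close> are also needed at complex arguments.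
\<close>

definition K1 :: "'a \<Rightarrow> 'a :: {real_normed_field, banach}" where "K1 z = mgf 1 z / mgf 0 z"
definition K2 :: "'a \<Rightarrow> 'a :: {real_normed_field, banach}" where "K2 z = mgf 2 z / mgf 0 z - (K1 z)\<^sup>2"
definition K3 :: "real \<Rightarrow> real" where
  "K3 \<theta> = (mgf 3 \<theta> * mgf 0 \<theta> - mgf 2 \<theta> * mgf 1 \<theta>) / (mgf 0 \<theta>)\<^sup>2 - 2 * K1 \<theta> * K2 \<theta>"

lemma K1_of_real: "K1 (of_real x :: complex) = of_real (K1 x)"
  by (simp add: K1_def mgf_of_real)
lemma K2_of_real: "K2 (of_real x :: complex) = of_real (K2 x)"
  by (simp add: K2_def mgf_of_real K1_of_real)

lemma K1_field_deriv: "mgf 0 z \<noteq> 0 \<Longrightarrow> (K1 has_field_derivative K2 z) (at z)"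
proof -
  assume nz: "mgf 0 z \<noteq> 0"
  have "((\<lambda>z. mgf 1 z / mgf 0 z) has_field_derivative (mgf 2 z * mgf 0 z - mgf 1 z * mgf 1 z) / (mgf 0 z * mgf 0 z)) (at z)"
    using DERIV_divide[OF mgf_deriv[of 1] mgf_deriv[of 0] nz] by (simp add: numeral_2_eq_2)
  also have "(mgf 2 z * mgf 0 z - mgf 1 z * mgf 1 z) / (mgf 0 z * mgf 0 z) = K2 z"
    using nz by (simp add: K2_def K1_def field_simps power2_eq_square)
  finally show ?thesis unfolding K1_def[abs_def] .
qed

lemma cgf_eq: "cgf \<mu> \<theta> = ln (mgf 0 \<theta>)"
  by (simp add: cgf_def mgf_integral)

lemma cgf_deriv: "(cgf \<mu> has_real_derivative K1 \<theta>) (at \<theta>)"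
proof -
  have "((\<lambda>\<theta>. ln (mgf 0 \<theta>)) has_real_derivative inverse (mgf 0 \<theta>) * mgf 1 \<theta>) (at \<theta>)"
    using DERIV_chain2[OF DERIV_ln[OF mgf0_pos] mgf_deriv[of 0 \<theta>]] by simp
  moreover have "cgf \<mu> = (\<lambda>\<theta>. ln (mgf 0 \<theta>))" using cgf_eq by blast
  ultimately show ?thesis by (simp add: K1_def divide_inverse mult.commute)
qed

lemma K2_deriv: "(K2 has_real_derivative K3 \<theta>) (at \<theta>)"
proof -
  have nz: "mgf 0 \<theta> \<noteq> 0" using mgf0_pos[of \<theta>] by simp
  have "((\<lambda>z. mgf 2 z / mgf 0 z) has_real_derivative (mgf 3 \<theta> * mgf 0 \<theta> - mgf 2 \<theta> * mgf 1 \<theta>) / (mgf 0 \<theta> * mgf 0 \<theta>)) (at \<theta>)"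
    using DERIV_divide[OF mgf_deriv[of 2 \<theta>] mgf_deriv[of 0 \<theta>] nz] by (simp add: numeral_2_eq_2 numeral_3_eq_3)
  from DERIV_diff[OF this DERIV_power[OF K1_field_deriv[OF nz], of 2]]
  show ?thesis unfolding K2_def[abs_def] K3_def by (simp add: power2_eq_square mult_ac)
qed

lemma cgf_derivs: "deriv (cgf \<mu>) = K1" "(deriv ^^ 2) (cgf \<mu>) = K2" "(deriv ^^ 3) (cgf \<mu>) = K3"
proof -
  show 1: "deriv (cgf \<mu>) = K1" using cgf_deriv DERIV_imp_deriv by blast
  have d: "deriv K1 = (K2 :: real \<Rightarrow> real)" using K1_field_deriv mgf0_pos DERIV_imp_deriv by (metis less_irrefl ext)
  then show 2: "(deriv ^^ 2) (cgf \<mu>) = K2" using 1 by (simp add: numeral_2_eq_2)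
  have "deriv K2 = K3" using K2_deriv DERIV_imp_deriv by blast
  then show "(deriv ^^ 3) (cgf \<mu>) = K3" using 1 d by (simp add: numeral_3_eq_3)
qed

lemma K2_pos: "0 < K2 (\<theta> :: real)"
proof -
  define u where "u = (K1 \<theta> :: real)"
  have m0: "0 < mgf 0 \<theta>" by (rule mgf0_pos)
  have "0 < (\<integral>x. (x - u)\<^sup>2 * exp (\<theta> * x) \<partial>\<mu>)"
  proof (rule tilted_positive[of _ "(1 + \<bar>u\<bar>)\<^sup>2" u])
    fix x :: real assume "x \<in> {0..1}"
    then have "\<bar>x - u\<bar> \<le> 1 + \<bar>u\<bar>" by auto
    then show "\<bar>(x - u)\<^sup>2\<bar> \<le> (1 + \<bar>u\<bar>)\<^sup>2" using power_mono[of "\<bar>x - u\<bar>" "1 + \<bar>u\<bar>" 2] by simp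
  qed auto
  also have "(\<lambda>x. (x - u)\<^sup>2 * exp (\<theta> * x)) = (\<lambda>x. x ^ 2 * exp (\<theta> * x) - 2 * u * (x ^ 1 * exp (\<theta> * x)) + u\<^sup>2 * (x ^ 0 * exp (\<theta> * x)))"
    by (auto simp: power2_eq_square algebra_simps)
  also have "integral\<^sup>L \<mu> \<dots> = mgf 2 \<theta> - 2 * u * mgf 1 \<theta> + u\<^sup>2 * mgf 0 \<theta>"
  proof -
    have int: "integrable \<mu> (\<lambda>x. x ^ k * exp (\<theta> * x))" for k
      by (rule integrable_tilted[of _ 1]) (auto simp: power_abs power_le_one)
    have I: "has_bochner_integral \<mu> (\<lambda>x. x ^ k * exp (\<theta> * x)) (mgf k \<theta>)" for k
      unfolding mgf_integral using int by (rule has_bochner_integral_integrable)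
    show ?thesis
      by (intro has_bochner_integral_integral_eq has_bochner_integral_add has_bochner_integral_diff
          has_bochner_integral_mult_right I)
  qed
  also have "\<dots> = mgf 0 \<theta> * K2 \<theta>"
    using m0 by (simp add: u_def K1_def K2_def field_simps power2_eq_square)
  finally show ?thesis using m0 by (simp add: zero_less_mult_iff)
qed

lemma cont_mgf: "continuous_on A (mgf k)"
  by (rule continuous_at_imp_continuous_on) (use mgf_deriv DERIV_isCont in blast)

end

section \<open>Bounding homomorphism sums by few linear functions\<close>

lemma sum_PiE_insert:
  assumes "i \<notin> A"
  shows "(\<Sum>\<phi>\<in>PiE (insert i A) B. F \<phi>) = (\<Sum>a\<in>B i. \<Sum>\<phi>\<in>PiE A B. F (\<phi>(i := a)))"
  unfolding PiE_insert_eq sum.reindex[OF inj_combinator[OF assms]] sum.cartesian_product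
  by (simp add: o_def case_prod_unfold)

text \<open>
  Splits off the two vertices of an edge from a sum over all vertex maps.
\<close>

lemma sum_PiE_two:
  fixes F :: "(nat \<Rightarrow> nat) \<Rightarrow> 'a :: comm_monoid_add"
  assumes "i \<in> A" "j \<in> A" "i \<noteq> j"
  shows "(\<Sum>\<phi>\<in>PiE A (\<lambda>_. B). F \<phi>) = (\<Sum>\<phi>\<in>PiE (A - {i, j}) (\<lambda>_. B). \<Sum>a\<in>B. \<Sum>b\<in>B. F (\<phi>(j := b, i := a)))"
proof -
  have A: "A = insert i (insert j (A - {i, j}))" using assms by auto
  have "(\<Sum>\<phi>\<in>PiE A (\<lambda>_. B). F \<phi>) = (\<Sum>a\<in>B. \<Sum>\<phi>\<in>PiE (insert j (A - {i, j})) (\<lambda>_. B). F (\<phi>(i := a)))"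
    by (subst A, rule sum_PiE_insert) (use assms in auto)
  also have "\<dots> = (\<Sum>a\<in>B. \<Sum>b\<in>B. \<Sum>\<phi>\<in>PiE (A - {i, j}) (\<lambda>_. B). F (\<phi>(j := b, i := a)))"
    by (intro sum.cong refl sum_PiE_insert) auto
  also have "\<dots> = (\<Sum>a\<in>B. \<Sum>\<phi>\<in>PiE (A - {i, j}) (\<lambda>_. B). \<Sum>b\<in>B. F (\<phi>(j := b, i := a)))"
    by (intro sum.cong refl sum.swap)
  also have "\<dots> = (\<Sum>\<phi>\<in>PiE (A - {i, j}) (\<lambda>_. B). \<Sum>a\<in>B. \<Sum>b\<in>B. F (\<phi>(j := b, i := a)))"
    by (rule sum.swap)
  finally show ?thesis .
qed

type_synonym matrix = "nat \<Rightarrow> nat \<Rightarrow> real"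

text \<open>
  One half of a bound on the cut norm: it serves to bound homomorphism sums from above, so rectangle sums are
  bounded from above.
\<close>

definition cut_le :: "nat \<Rightarrow> real \<Rightarrow> matrix \<Rightarrow> bool" where
  "cut_le n c D \<longleftrightarrow> (\<forall>S\<subseteq>{1..n}. \<forall>T\<subseteq>{1..n}. (\<Sum>i\<in>S. \<Sum>j\<in>T. D i j) \<le> c)"

text \<open>
  A linear function of weights in \<open>[0,1]\<close> is largest at a vertex of the cube, the indicator of the positive terms.
\<close>

lemma weighted_sum_le:
  fixes f h :: "nat \<Rightarrow> real"
  assumes "finite A" "\<And>S. S \<subseteq> A \<Longrightarrow> sum h S \<le> c" "\<And>i. i \<in> A \<Longrightarrow> f i \<in> {0..1}"
  shows "(\<Sum>i\<in>A. f i * h i) \<le> c"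
proof -
  have "(\<Sum>i\<in>A. f i * h i) \<le> (\<Sum>i\<in>A. if 0 < h i then h i else 0)"
  proof (rule sum_mono)
    fix i assume "i \<in> A"
    then have "f i \<in> {0..1}" by (rule assms(3))
    then show "f i * h i \<le> (if 0 < h i then h i else 0)"
      by (auto simp: mult_left_le_one_le mult_nonneg_nonpos)
  qed
  also have "\<dots> = sum h {i \<in> A. 0 < h i}"
    using assms(1) by (simp add: sum.If_cases Int_def)
  also have "\<dots> \<le> c" by (rule assms(2)) auto
  finally show ?thesis .
qed

lemma cut_le_functions:
  assumes D: "cut_le n c D" and f: "\<And>i. i \<in> {1..n} \<Longrightarrow> f i \<in> {0..1}" and g: "\<And>j. j \<in> {1..n} \<Longrightarrow> g j \<in> {0..1}"
  shows "(\<Sum>i\<in>{1..n}. \<Sum>j\<in>{1..n}. D i j * (f i * g j)) \<le> c"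
proof -
  have "(\<Sum>i\<in>{1..n}. f i * (\<Sum>j\<in>{1..n}. g j * D i j)) \<le> c"
  proof (rule weighted_sum_le)
    fix S assume S: "S \<subseteq> {1..n}"
    have "(\<Sum>j\<in>{1..n}. g j * (\<Sum>i\<in>S. D i j)) \<le> c"
    proof (rule weighted_sum_le)
      fix T assume T: "T \<subseteq> {1..n}"
      have "(\<Sum>j\<in>T. \<Sum>i\<in>S. D i j) = (\<Sum>i\<in>S. \<Sum>j\<in>T. D i j)" by (rule sum.swap)
      then show "(\<Sum>j\<in>T. \<Sum>i\<in>S. D i j) \<le> c" using D S T by (simp add: cut_le_def)
    qed (use g in auto)
    also have "(\<Sum>j\<in>{1..n}. g j * (\<Sum>i\<in>S. D i j)) = (\<Sum>i\<in>S. \<Sum>j\<in>{1..n}. g j * D i j)"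
      unfolding sum_distrib_left by (rule sum.swap)
    finally show "(\<Sum>i\<in>S. \<Sum>j\<in>{1..n}. g j * D i j) \<le> c" .
  qed (use f in auto)
  then show ?thesis by (simp add: sum_distrib_left mult_ac)
qed

text \<open>
  Each edge of the graph may carry its own matrix, so that matrices can be exchanged one edge at a time.
\<close>

definition hom_sum :: "nat \<Rightarrow> graph \<Rightarrow> (nat \<times> nat \<Rightarrow> matrix) \<Rightarrow> real" where
  "hom_sum n H W = (\<Sum>\<phi>\<in>PiE {1..fst H} (\<lambda>_. {1..n}). \<Prod>e\<in>snd H. W e (\<phi> (fst e)) (\<phi> (snd e)))"

lemma vertex_pairsD: "e \<in> vertex_pairs k \<Longrightarrow> fst e \<in> {1..k} \<and> snd e \<in> {1..k} \<and> fst e < snd e"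
  by (auto simp: vertex_pairs_def)

lemma finite_vertex_pairs: "finite (vertex_pairs k)"
  by (rule finite_subset[of _ "{1..k} \<times> {1..k}"]) (auto simp: vertex_pairs_def)

lemma simple_graphD: "simple_graph H \<Longrightarrow> finite (snd H)" "simple_graph H \<Longrightarrow> e \<in> snd H \<Longrightarrow> e \<in> vertex_pairs (fst H)"
  using finite_subset[OF _ finite_vertex_pairs] by (auto simp: simple_graph_def)

text \<open>
  Fix the images of all vertices except the ends \<open>i\<close>, \<open>j\<close> of \<open>e0\<close>. The graph is simple, so no other edge
  contains both; the remaining factors split into a function of the image of \<open>i\<close> times one of the image
  of \<open>j\<close>, and the cut bound applies to that product.
\<close>

lemma edge_replacement:
  assumes H: "simple_graph H" and e0: "e0 \<in> snd H" and D: "cut_le n c D"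
    and W: "\<And>e i j. e \<in> snd H - {e0} \<Longrightarrow> i \<in> {1..n} \<Longrightarrow> j \<in> {1..n} \<Longrightarrow> W e i j \<in> {0..1}"
  shows "hom_sum n H (W(e0 := D)) \<le> real n ^ (fst H - 2) * c"
proof -
  obtain i j where e0_eq: "e0 = (i, j)" by (cases e0)
  then have ij: "i \<in> {1..fst H}" "j \<in> {1..fst H}" "i < j"
    using simple_graphD(2)[OF H e0] by (auto simp: vertex_pairs_def)
  define E1 where "E1 = {e \<in> snd H - {e0}. fst e \<noteq> j \<and> snd e \<noteq> j}"
  define E2 where "E2 = {e \<in> snd H - {e0}. fst e = j \<or> snd e = j}"
  have fin: "finite (snd H)" by (rule simple_graphD[OF H])
  have split: "snd H = insert e0 (E1 \<union> E2)" "e0 \<notin> E1 \<union> E2" "E1 \<inter> E2 = {}" "finite E1" "finite E2"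
    using e0 fin by (auto simp: E1_def E2_def)
  have E2: "fst e \<noteq> i \<and> snd e \<noteq> i" if "e \<in> E2" for e
    using that simple_graphD(2)[OF H, of e] ij e0_eq by (cases e) (auto simp: E2_def vertex_pairs_def)
  have inner: "(\<Sum>a\<in>{1..n}. \<Sum>b\<in>{1..n}. \<Prod>e\<in>snd H. (W(e0 := D)) e ((\<phi>(j := b, i := a)) (fst e)) ((\<phi>(j := b, i := a)) (snd e))) \<le> c"
    if \<phi>: "\<phi> \<in> PiE ({1..fst H} - {i, j}) (\<lambda>_. {1..n})" for \<phi>
  proof -
    define f where "f a = (\<Prod>e\<in>E1. W e ((\<phi>(i := a)) (fst e)) ((\<phi>(i := a)) (snd e)))" for a
    define g where "g b = (\<Prod>e\<in>E2. W e ((\<phi>(j := b)) (fst e)) ((\<phi>(j := b)) (snd e)))" for b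
    have "(\<Prod>e\<in>snd H. (W(e0 := D)) e ((\<phi>(j := b, i := a)) (fst e)) ((\<phi>(j := b, i := a)) (snd e))) = D a b * (f a * g b)"
      for a b
    proof -
      have "(\<Prod>e\<in>E1. (W(e0 := D)) e ((\<phi>(j := b, i := a)) (fst e)) ((\<phi>(j := b, i := a)) (snd e))) = f a"
        unfolding f_def by (rule prod.cong) (use split(2) in \<open>auto simp: E1_def\<close>)
      moreover have "(\<Prod>e\<in>E2. (W(e0 := D)) e ((\<phi>(j := b, i := a)) (fst e)) ((\<phi>(j := b, i := a)) (snd e))) = g b"
        unfolding g_def by (rule prod.cong) (use split(2) E2 in \<open>auto simp: E2_def\<close>)
      ultimately show ?thesis
        unfolding split(1) using split(2-5) ij by (simp add: prod.union_disjoint e0_eq)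
    qed
    then have "(\<Sum>a\<in>{1..n}. \<Sum>b\<in>{1..n}. \<Prod>e\<in>snd H. (W(e0 := D)) e ((\<phi>(j := b, i := a)) (fst e)) ((\<phi>(j := b, i := a)) (snd e)))
      = (\<Sum>a\<in>{1..n}. \<Sum>b\<in>{1..n}. D a b * (f a * g b))" by simp
    also have "\<dots> \<le> c"
    proof (rule cut_le_functions[OF D])
      have W1: "W e ((\<phi>(l := a)) (fst e)) ((\<phi>(l := a)) (snd e)) \<in> {0..1}"
        if "e \<in> E" "a \<in> {1..n}" "E = E1 \<and> l = i \<or> E = E2 \<and> l = j" for e a l E
      proof (rule W)
        show "e \<in> snd H - {e0}" using that by (auto simp: E1_def E2_def)
        then have "e \<in> vertex_pairs (fst H)" using simple_graphD(2)[OF H] by auto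
        then have v: "fst e \<in> {1..fst H}" "snd e \<in> {1..fst H}" using vertex_pairsD by blast+
        have "x \<in> {1..n}" if "x = (\<phi>(l := a)) y" "y \<in> {1..fst H}" "y \<noteq> l \<Longrightarrow> y \<noteq> i \<and> y \<noteq> j" for x y
          using that \<phi> \<open>a \<in> {1..n}\<close> by (cases "y = l") (auto dest!: PiE_mem)
        then show "(\<phi>(l := a)) (fst e) \<in> {1..n}" "(\<phi>(l := a)) (snd e) \<in> {1..n}"
          using that v E2[of e] unfolding E1_def by blast+
      qed
      show "f a \<in> {0..1}" if "a \<in> {1..n}" for a
        unfolding f_def using W1[OF _ that, of _ E1 i] by (auto intro!: prod_nonneg prod_le_1)
      show "g b \<in> {0..1}" if "b \<in> {1..n}" for b
        unfolding g_def using W1[OF _ that, of _ E2 j] by (auto intro!: prod_nonneg prod_le_1)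
    qed
    finally show ?thesis .
  qed
  have "hom_sum n H (W(e0 := D)) \<le> (\<Sum>\<phi>\<in>PiE ({1..fst H} - {i, j}) (\<lambda>_. {1..n}). c)"
    unfolding hom_sum_def sum_PiE_two[OF ij(1,2) less_imp_neq[OF ij(3)]] by (rule sum_mono) (rule inner)
  also have "\<dots> = real n ^ (fst H - 2) * c"
    using ij by (simp add: card_PiE numeral_2_eq_2)
  finally show ?thesis .
qed

text \<open>
  The counting lemma: exchange \<open>w\<close> for \<open>V\<close> edge by edge.
\<close>

lemma hom_sum_cut_le:
  assumes H: "simple_graph H" and D: "cut_le n c (\<lambda>i j. w i j - V i j)"
    and w: "\<And>i j. i \<in> {1..n} \<Longrightarrow> j \<in> {1..n} \<Longrightarrow> w i j \<in> {0..1}"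
    and V: "\<And>i j. i \<in> {1..n} \<Longrightarrow> j \<in> {1..n} \<Longrightarrow> V i j \<in> {0..1}"
  shows "hom_sum n H (\<lambda>_. w) \<le> hom_sum n H (\<lambda>_. V) + real (card (snd H)) * (real n ^ (fst H - 2) * c)"
proof -
  have fin: "finite (snd H)" by (rule simple_graphD[OF H])
  \<comment> \<open>\<open>A\<close> is the set of edges that already carry \<open>V\<close>\<close>
  have hyb: "hom_sum n H (\<lambda>_. w) \<le> hom_sum n H (\<lambda>e. if e \<in> A then V else w) + real (card A) * (real n ^ (fst H - 2) * c)"
    if "finite A" "A \<subseteq> snd H" for A
    using that
  proof (induction A rule: finite_induct)
    case (insert e A)
    define W where "W = (\<lambda>e. if e \<in> A then V else w)"
    have We: "W(e := w) = W" using insert by (auto simp: W_def)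
    have "hom_sum n H (W(e := w)) - hom_sum n H (W(e := V)) = hom_sum n H (W(e := (\<lambda>i j. w i j - V i j)))"
    proof -
      have "(\<Prod>e'\<in>snd H. (W(e := X)) e' (\<phi> (fst e')) (\<phi> (snd e')))
        = X (\<phi> (fst e)) (\<phi> (snd e)) * (\<Prod>e'\<in>snd H - {e}. W e' (\<phi> (fst e')) (\<phi> (snd e')))" for X \<phi>
        using insert.prems fin by (subst prod.remove[of _ e]) (auto intro!: prod.cong)
      then show ?thesis unfolding hom_sum_def by (simp add: sum_subtractf[symmetric] left_diff_distrib)
    qed
    also have "\<dots> \<le> real n ^ (fst H - 2) * c"
      by (rule edge_replacement[OF H _ D]) (use insert.prems w V in \<open>auto simp: W_def\<close>)
    finally have "hom_sum n H W \<le> hom_sum n H (W(e := V)) + real n ^ (fst H - 2) * c" unfolding We by simp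
    moreover have "W(e := V) = (\<lambda>e'. if e' \<in> insert e A then V else w)" by (auto simp: W_def)
    moreover have "real (card (insert e A)) = real (card A) + 1" using insert by simp
    ultimately show ?case using insert.IH insert.prems by (simp add: W_def algebra_simps)
  qed simp
  have "hom_sum n H (\<lambda>e. if e \<in> snd H then V else w) = hom_sum n H (\<lambda>_. V)"
    unfolding hom_sum_def by (intro sum.cong prod.cong) auto
  then show ?thesis using hyb[OF fin] by simp
qed

lemma prod_le_mean_power:
  fixes x :: "'a \<Rightarrow> real"
  assumes "finite A" "A \<noteq> {}" "\<And>i. i \<in> A \<Longrightarrow> 0 \<le> x i"
  shows "(\<Prod>i\<in>A. x i) \<le> (\<Sum>i\<in>A. x i ^ card A) / real (card A)"
proof -
  have c: "0 < card A" using assms by (simp add: card_gt_0_iff)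
  define P where "P = (\<Prod>i\<in>A. x i)"
  have P: "0 \<le> P" unfolding P_def using assms(3) by (rule prod_nonneg)
  have "(P ^ card A) powr (1 / real (card A)) = P"
    using P c by (cases "P = 0") (simp_all add: powr_realpow[symmetric] powr_powr)
  then have "(\<Prod>i\<in>A. x i ^ card A) powr (1 / real (card A)) = (\<Prod>i\<in>A. x i)"
    by (simp add: P_def prod_power_distrib)
  then show ?thesis
    using arith_geom_mean[OF assms(1,2), of "\<lambda>i. x i ^ card A"] assms(3) by (simp add: sum_divide_distrib)
qed

text \<open>
  Pointwise, the product over the \<open>p\<close> edges is at most the mean of the \<open>p\<close>-th powers; averaged over
  vertex maps, every edge contributes the same mean.
\<close>

lemma hom_sum_le_power:
  assumes H: "simple_graph H" and p: "card (snd H) = p" "0 < p"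
    and V: "\<And>i j. i \<in> {1..n} \<Longrightarrow> j \<in> {1..n} \<Longrightarrow> 0 \<le> V i j"
  shows "hom_sum n H (\<lambda>_. V) \<le> real n ^ (fst H - 2) * (\<Sum>i\<in>{1..n}. \<Sum>j\<in>{1..n}. V i j ^ p)"
proof -
  have fin: "finite (snd H)" "snd H \<noteq> {}" using p by (auto intro: card_ge_0_finite)
  have edge: "(\<Sum>\<phi>\<in>PiE {1..fst H} (\<lambda>_. {1..n}). V (\<phi> (fst e)) (\<phi> (snd e)) ^ p)
      = real n ^ (fst H - 2) * (\<Sum>i\<in>{1..n}. \<Sum>j\<in>{1..n}. V i j ^ p)" if e: "e \<in> snd H" for e
  proof -
    have ij: "fst e \<in> {1..fst H}" "snd e \<in> {1..fst H}" "fst e \<noteq> snd e"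
      using vertex_pairsD[OF simple_graphD(2)[OF H e]] by auto
    then show ?thesis
      unfolding sum_PiE_two[OF ij] by (simp add: card_PiE numeral_2_eq_2 fun_upd_twist)
  qed
  have "hom_sum n H (\<lambda>_. V) \<le> (\<Sum>\<phi>\<in>PiE {1..fst H} (\<lambda>_. {1..n}). (\<Sum>e\<in>snd H. V (\<phi> (fst e)) (\<phi> (snd e)) ^ p) / real p)"
    unfolding hom_sum_def
  proof (rule sum_mono)
    fix \<phi> assume \<phi>: "\<phi> \<in> PiE {1..fst H} (\<lambda>_. {1..n})"
    have "0 \<le> V (\<phi> (fst e)) (\<phi> (snd e))" if "e \<in> snd H" for e
      using vertex_pairsD[OF simple_graphD(2)[OF H that]] \<phi> by (intro V) (auto dest: PiE_mem)
    then show "(\<Prod>e\<in>snd H. V (\<phi> (fst e)) (\<phi> (snd e))) \<le> (\<Sum>e\<in>snd H. V (\<phi> (fst e)) (\<phi> (snd e)) ^ p) / real p"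
      using prod_le_mean_power[OF fin, of "\<lambda>e. V (\<phi> (fst e)) (\<phi> (snd e))"] p by simp
  qed
  also have "\<dots> = (\<Sum>e\<in>snd H. \<Sum>\<phi>\<in>PiE {1..fst H} (\<lambda>_. {1..n}). V (\<phi> (fst e)) (\<phi> (snd e)) ^ p) / real p"
    unfolding sum_divide_distrib[symmetric] by (subst sum.swap) simp
  also have "\<dots> = real n ^ (fst H - 2) * (\<Sum>i\<in>{1..n}. \<Sum>j\<in>{1..n}. V i j ^ p)"
    using p edge by simp
  finally show ?thesis .
qed

text \<open>
  The two moves of the greedy approximation. A bump on \<open>S \<times> T\<close> repairs a violated cut inequality; the truncation
  at \<open>1\<close> only brings the matrix closer to weights in \<open>[0,1]\<close>. A shrinking step repairs the remaining
  requirement, that \<open>V\<close> exceed \<open>w\<close> only slightly when tested against \<open>V ^ (p - 1)\<close>.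
\<close>

definition bump :: "real \<Rightarrow> nat set \<Rightarrow> nat set \<Rightarrow> matrix \<Rightarrow> matrix" where
  "bump \<epsilon> S T V = (\<lambda>i j. min 1 (V i j + \<epsilon> * of_bool (i \<in> S \<and> j \<in> T)))"

definition shrink :: "real \<Rightarrow> nat \<Rightarrow> matrix \<Rightarrow> matrix" where
  "shrink \<epsilon> p V = (\<lambda>i j. V i j - \<epsilon> * V i j ^ (p - 1))"

fun approximants :: "real \<Rightarrow> nat \<Rightarrow> nat \<Rightarrow> nat \<Rightarrow> matrix set" where
  "approximants \<epsilon> p n 0 = {\<lambda>_ _. 0}"
| "approximants \<epsilon> p n (Suc l) = (\<Union>V\<in>approximants \<epsilon> p n l.
     insert V (insert (shrink \<epsilon> p V) ((\<lambda>(S, T). bump \<epsilon> S T V) ` (Pow {1..n} \<times> Pow {1..n}))))"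

lemma approximants_finite: "finite (approximants \<epsilon> p n l)"
  by (induction l) auto

text \<open>
  Each step chooses among at most \<open>4 ^ n + 2\<close> moves.
\<close>

lemma approximants_card: "card (approximants \<epsilon> p n l) \<le> (4 ^ n + 2) ^ l"
proof (induction l)
  case (Suc l)
  have "card (insert V (insert (shrink \<epsilon> p V) ((\<lambda>(S, T). bump \<epsilon> S T V) ` (Pow {1..n} \<times> Pow {1..n})))) \<le> 4 ^ n + 2" for V
  proof -
    have "card ((\<lambda>(S, T). bump \<epsilon> S T V) ` (Pow {1..n} \<times> Pow {1..n})) \<le> card (Pow {1..n} \<times> Pow {1..n})"
      by (rule card_image_le) auto
    also have "\<dots> = 4 ^ n" by (simp add: card_cartesian_product card_Pow power_mult_distrib[symmetric])
    finally have "card ((\<lambda>(S, T). bump \<epsilon> S T V) ` (Pow {1..n} \<times> Pow {1..n})) \<le> 4 ^ n" .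
    then show ?thesis by (auto simp: card_insert_if)
  qed
  then have "card (approximants \<epsilon> p n (Suc l)) \<le> (\<Sum>V\<in>approximants \<epsilon> p n l. 4 ^ n + 2)"
    unfolding approximants.simps by (intro order_trans[OF card_UN_le] sum_mono approximants_finite)
  also have "\<dots> = card (approximants \<epsilon> p n l) * (4 ^ n + 2)" by simp
  also have "\<dots> \<le> (4 ^ n + 2) ^ l * (4 ^ n + 2)" by (rule mult_right_mono[OF Suc]) simp
  finally show ?case by (simp add: mult.commute)
qed simp

lemma approximants_range:
  assumes "0 \<le> \<epsilon>" "\<epsilon> \<le> 1" "2 \<le> p" "V \<in> approximants \<epsilon> p n l" shows "V i j \<in> {0..1}"
  using assms(4)
proof (induction l arbitrary: V)
  case (Suc l)
  then obtain V0 where V0: "V0 \<in> approximants \<epsilon> p n l"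
    and V: "V = V0 \<or> V = shrink \<epsilon> p V0 \<or> (\<exists>S T. V = bump \<epsilon> S T V0)" by auto
  have r: "0 \<le> V0 i j" "V0 i j \<le> 1" using Suc.IH[OF V0] by auto
  have "V0 i j ^ (p - 1) \<le> V0 i j ^ 1" using r assms(3) by (intro power_decreasing) auto
  then have "\<epsilon> * V0 i j ^ (p - 1) \<le> 1 * V0 i j" using assms(1,2) r by (intro mult_mono) auto
  moreover have "0 \<le> \<epsilon> * V0 i j ^ (p - 1)" using r assms by auto
  ultimately have "shrink \<epsilon> p V0 i j \<in> {0..1}" using r by (auto simp: shrink_def)
  moreover have "bump \<epsilon> S T V0 i j \<in> {0..1}" for S T using r assms(1) by (auto simp: bump_def)
  ultimately show ?case using V r by auto
qed simp

definition sq_dist :: "nat \<Rightarrow> matrix \<Rightarrow> matrix \<Rightarrow> real" where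
  "sq_dist n w V = (\<Sum>i\<in>{1..n}. \<Sum>j\<in>{1..n}. (w i j - V i j)\<^sup>2)"

text \<open>
  A step of length \<open>\<epsilon>\<close> in a direction \<open>D\<close> that correlates with the error removes a fixed share of the squared
  distance: the linear gain \<open>2 \<epsilon>\<^sup>2 n\<^sup>2\<close> beats the quadratic loss \<open>\<epsilon>\<^sup>2 n\<^sup>2\<close>.
\<close>

lemma sq_dist_step:
  assumes \<epsilon>: "0 \<le> \<epsilon>" and D: "\<And>i j. \<bar>D i j\<bar> \<le> 1"
    and corr: "\<epsilon> * (real n)\<^sup>2 \<le> (\<Sum>i\<in>{1..n}. \<Sum>j\<in>{1..n}. (w i j - V i j) * D i j)"
    and V': "\<And>i j. i \<in> {1..n} \<Longrightarrow> j \<in> {1..n} \<Longrightarrow> \<bar>w i j - V' i j\<bar> \<le> \<bar>w i j - (V i j + \<epsilon> * D i j)\<bar>"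
  shows "sq_dist n w V' \<le> sq_dist n w V - \<epsilon>\<^sup>2 * (real n)\<^sup>2"
proof -
  have "(w i j - V' i j)\<^sup>2 \<le> (w i j - V i j)\<^sup>2 - 2 * \<epsilon> * ((w i j - V i j) * D i j) + \<epsilon>\<^sup>2" if "i \<in> {1..n}" "j \<in> {1..n}" for i j
  proof -
    have "(w i j - V' i j)\<^sup>2 \<le> (w i j - (V i j + \<epsilon> * D i j))\<^sup>2"
      using power_mono[OF V'[OF that] abs_ge_zero, of 2] by simp
    also have "\<dots> = (w i j - V i j)\<^sup>2 - 2 * \<epsilon> * ((w i j - V i j) * D i j) + \<epsilon>\<^sup>2 * (D i j)\<^sup>2"
      by (simp add: power2_eq_square algebra_simps)
    also have "(D i j)\<^sup>2 \<le> 1" using D[of i j] by (simp add: abs_square_le_1)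
    then have "\<epsilon>\<^sup>2 * (D i j)\<^sup>2 \<le> \<epsilon>\<^sup>2" by (simp add: mult_left_le)
    finally show ?thesis by simp
  qed
  then have "sq_dist n w V' \<le> (\<Sum>i\<in>{1..n}. \<Sum>j\<in>{1..n}. (w i j - V i j)\<^sup>2 - 2 * \<epsilon> * ((w i j - V i j) * D i j) + \<epsilon>\<^sup>2)"
    unfolding sq_dist_def by (intro sum_mono)
  also have "\<dots> = sq_dist n w V - 2 * \<epsilon> * (\<Sum>i\<in>{1..n}. \<Sum>j\<in>{1..n}. (w i j - V i j) * D i j) + \<epsilon>\<^sup>2 * (real n)\<^sup>2"
    unfolding sq_dist_def by (simp add: sum.distrib sum_subtractf sum_distrib_left power2_eq_square algebra_simps)
  also have "\<dots> \<le> sq_dist n w V - 2 * \<epsilon> * (\<epsilon> * (real n)\<^sup>2) + \<epsilon>\<^sup>2 * (real n)\<^sup>2"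
    using mult_left_mono[OF corr, of "2 * \<epsilon>"] \<epsilon> by simp
  finally show ?thesis by (simp add: power2_eq_square)
qed

lemma sum_rectangle:
  fixes D :: matrix
  assumes "S \<subseteq> {1..n}" "T \<subseteq> {1..n}"
  shows "(\<Sum>i\<in>S. \<Sum>j\<in>T. D i j) = (\<Sum>i\<in>{1..n}. \<Sum>j\<in>{1..n}. D i j * of_bool (i \<in> S \<and> j \<in> T))"
proof (rule sum.mono_neutral_cong_left)
  fix i assume i: "i \<in> S"
  show "(\<Sum>j\<in>T. D i j) = (\<Sum>j\<in>{1..n}. D i j * of_bool (i \<in> S \<and> j \<in> T))"
    by (rule sum.mono_neutral_cong_left) (use assms i in auto)
qed (use assms in auto)

text \<open>
  As long as one of the two requirements fails, the corresponding move lowers the squared distance to \<open>w\<close> by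
  \<open>\<epsilon>\<^sup>2 n\<^sup>2\<close>. It starts at no more than \<open>n\<^sup>2\<close> and stays nonnegative, so there are fewer than \<open>l\<close> moves.
\<close>

lemma approximant_exists:
  assumes \<epsilon>: "0 < \<epsilon>" "\<epsilon> \<le> 1" and p: "2 \<le> p" and n: "0 < n" and l: "1 < real l * \<epsilon>\<^sup>2"
    and w: "\<And>i j. i \<in> {1..n} \<Longrightarrow> j \<in> {1..n} \<Longrightarrow> w i j \<in> {0..1}"
  shows "\<exists>V\<in>approximants \<epsilon> p n l. cut_le n (\<epsilon> * (real n)\<^sup>2) (\<lambda>i j. w i j - V i j)
     \<and> (\<Sum>i\<in>{1..n}. \<Sum>j\<in>{1..n}. V i j ^ (p - 1) * (V i j - w i j)) \<le> \<epsilon> * (real n)\<^sup>2"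
proof -
  define good where "good V \<longleftrightarrow> cut_le n (\<epsilon> * (real n)\<^sup>2) (\<lambda>i j. w i j - V i j)
     \<and> (\<Sum>i\<in>{1..n}. \<Sum>j\<in>{1..n}. V i j ^ (p - 1) * (V i j - w i j)) \<le> \<epsilon> * (real n)\<^sup>2" for V
  have step: "\<exists>V\<in>approximants \<epsilon> p n l. good V \<or> sq_dist n w V \<le> (1 - real l * \<epsilon>\<^sup>2) * (real n)\<^sup>2" for l
  proof (induction l)
    case 0
    have "(w i j)\<^sup>2 \<le> 1" if "i \<in> {1..n}" "j \<in> {1..n}" for i j
      using w[OF that] by (simp add: abs_square_le_1)
    then have "sq_dist n w (\<lambda>_ _. 0) \<le> (\<Sum>i\<in>{1..n}. \<Sum>j\<in>{1..n}. 1)"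
      unfolding sq_dist_def by (intro sum_mono) simp
    then show ?case by (simp add: power2_eq_square)
  next
    case (Suc l)
    then obtain V where V: "V \<in> approximants \<epsilon> p n l" "good V \<or> sq_dist n w V \<le> (1 - real l * \<epsilon>\<^sup>2) * (real n)\<^sup>2" by blast
    have r: "0 \<le> V i j" "V i j \<le> 1" for i j using approximants_range[OF _ _ p V(1), of i j] \<epsilon> by auto
    show ?case
    proof (cases "good V")
      case True
      then show ?thesis using V(1) by auto
    next
      case False
      have "\<exists>V'\<in>approximants \<epsilon> p n (Suc l). sq_dist n w V' \<le> sq_dist n w V - \<epsilon>\<^sup>2 * (real n)\<^sup>2"
      proof (cases "cut_le n (\<epsilon> * (real n)\<^sup>2) (\<lambda>i j. w i j - V i j)")
        case False
        then obtain S T where ST: "S \<subseteq> {1..n}" "T \<subseteq> {1..n}" "\<epsilon> * (real n)\<^sup>2 < (\<Sum>i\<in>S. \<Sum>j\<in>T. w i j - V i j)"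
          by (auto simp: cut_le_def not_le)
        have "(\<Sum>i\<in>S. \<Sum>j\<in>T. w i j - V i j) = (\<Sum>i\<in>{1..n}. \<Sum>j\<in>{1..n}. (w i j - V i j) * of_bool (i \<in> S \<and> j \<in> T))"
          by (rule sum_rectangle[OF ST(1,2)])
        then have "sq_dist n w (bump \<epsilon> S T V) \<le> sq_dist n w V - \<epsilon>\<^sup>2 * (real n)\<^sup>2"
          using \<epsilon> ST(3) w r
          by (intro sq_dist_step[where D = "\<lambda>i j. of_bool (i \<in> S \<and> j \<in> T)"]) (auto simp: bump_def min_def of_bool_def)
        moreover have "bump \<epsilon> S T V \<in> approximants \<epsilon> p n (Suc l)" using V(1) ST(1,2) by auto
        ultimately show ?thesis by blast
      next
        case True
        then have "\<epsilon> * (real n)\<^sup>2 < (\<Sum>i\<in>{1..n}. \<Sum>j\<in>{1..n}. V i j ^ (p - 1) * (V i j - w i j))"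
          using False by (auto simp: good_def not_le)
        also have "\<dots> = (\<Sum>i\<in>{1..n}. \<Sum>j\<in>{1..n}. (w i j - V i j) * (- (V i j ^ (p - 1))))"
          by (intro sum.cong refl) (simp add: algebra_simps)
        finally have "sq_dist n w (shrink \<epsilon> p V) \<le> sq_dist n w V - \<epsilon>\<^sup>2 * (real n)\<^sup>2"
          using \<epsilon> r
          by (intro sq_dist_step[where D = "\<lambda>i j. - (V i j ^ (p - 1))"]) (auto simp: shrink_def power_le_one)
        moreover have "shrink \<epsilon> p V \<in> approximants \<epsilon> p n (Suc l)" using V(1) by auto
        ultimately show ?thesis by blast
      qed
      then obtain V' where V': "V' \<in> approximants \<epsilon> p n (Suc l)" "sq_dist n w V' \<le> sq_dist n w V - \<epsilon>\<^sup>2 * (real n)\<^sup>2"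
        by blast
      \<comment> \<open>each move uses up one of the \<open>l\<close> steps and one portion of the squared distance\<close>
      have "sq_dist n w V' \<le> (1 - real l * \<epsilon>\<^sup>2) * (real n)\<^sup>2 - \<epsilon>\<^sup>2 * (real n)\<^sup>2"
        using V'(2) V(2) False by linarith
      also have "\<dots> = (1 - real (Suc l) * \<epsilon>\<^sup>2) * (real n)\<^sup>2" by (simp add: algebra_simps)
      finally show ?thesis using V'(1) by blast
    qed
  qed
  obtain V where V: "V \<in> approximants \<epsilon> p n l" "good V \<or> sq_dist n w V \<le> (1 - real l * \<epsilon>\<^sup>2) * (real n)\<^sup>2"
    using step by blast
  have "0 \<le> sq_dist n w V" unfolding sq_dist_def by (intro sum_nonneg) auto
  moreover have "(1 - real l * \<epsilon>\<^sup>2) * (real n)\<^sup>2 < 0" using l n by (intro mult_neg_pos) auto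
  ultimately have "good V" using V(2) by linarith
  then show ?thesis using V(1) by (auto simp: good_def)
qed

text \<open>
  The counting lemma replaces \<open>w\<close> by \<open>V\<close>, the mean inequality reduces to the sum of \<open>V ^ p\<close>, and the
  second requirement on \<open>V\<close> replaces \<open>V ^ p\<close> by the tangent \<open>p V ^ (p - 1) w - (p - 1) V ^ p\<close>, which is linear
  in \<open>w\<close>.
\<close>

lemma hom_sum_le_linear:
  assumes H: "simple_graph H" and p: "card (snd H) = p" "2 \<le> p" and n: "0 < n"
    and \<epsilon>: "0 < \<epsilon>" "\<epsilon> \<le> 1" and l: "1 < real l * \<epsilon>\<^sup>2"
    and w: "\<And>i j. i \<in> {1..n} \<Longrightarrow> j \<in> {1..n} \<Longrightarrow> w i j \<in> {0..1}"
  shows "\<exists>V\<in>approximants \<epsilon> p n l. (real n)\<^sup>2 * (hom_sum n H (\<lambda>_. w) / real n ^ fst H)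
     \<le> (\<Sum>i\<in>{1..n}. \<Sum>j\<in>{1..n}. real p * V i j ^ (p - 1) * w i j - (real p - 1) * V i j ^ p) + 2 * real p * \<epsilon> * (real n)\<^sup>2"
proof -
  obtain V where V: "V \<in> approximants \<epsilon> p n l" "cut_le n (\<epsilon> * (real n)\<^sup>2) (\<lambda>i j. w i j - V i j)"
    "(\<Sum>i\<in>{1..n}. \<Sum>j\<in>{1..n}. V i j ^ (p - 1) * (V i j - w i j)) \<le> \<epsilon> * (real n)\<^sup>2"
    using approximant_exists[where w = w, OF \<epsilon> p(2) n l w] by blast
  have r: "V i j \<in> {0..1}" for i j using approximants_range[OF _ _ p(2) V(1)] \<epsilon> by auto
  have "snd H \<noteq> {}" using p by auto
  then obtain e where e: "e \<in> snd H" by blast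
  have k: "2 \<le> fst H" using vertex_pairsD[OF simple_graphD(2)[OF H e]] by auto
  have nk: "real n ^ fst H = (real n)\<^sup>2 * real n ^ (fst H - 2)"
    by (simp only: power_add[symmetric] le_add_diff_inverse[OF k])
  have "hom_sum n H (\<lambda>_. w) \<le> real n ^ (fst H - 2) * (\<Sum>i\<in>{1..n}. \<Sum>j\<in>{1..n}. V i j ^ p) + real p * (real n ^ (fst H - 2) * (\<epsilon> * (real n)\<^sup>2))"
  proof -
    have "hom_sum n H (\<lambda>_. V) \<le> real n ^ (fst H - 2) * (\<Sum>i\<in>{1..n}. \<Sum>j\<in>{1..n}. V i j ^ p)"
      using p r by (intro hom_sum_le_power[OF H p(1)]) auto
    then show ?thesis using hom_sum_cut_le[OF H V(2) w r] p(1) by simp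
  qed
  also have "\<dots> = real n ^ (fst H - 2) * ((\<Sum>i\<in>{1..n}. \<Sum>j\<in>{1..n}. V i j ^ p) + real p * \<epsilon> * (real n)\<^sup>2)"
    by (simp add: algebra_simps)
  finally have "(real n)\<^sup>2 * (hom_sum n H (\<lambda>_. w) / real n ^ fst H) \<le> (\<Sum>i\<in>{1..n}. \<Sum>j\<in>{1..n}. V i j ^ p) + real p * \<epsilon> * (real n)\<^sup>2"
    unfolding nk using n by (simp add: field_simps)
  also have "(\<Sum>i\<in>{1..n}. \<Sum>j\<in>{1..n}. V i j ^ p)
     = (\<Sum>i\<in>{1..n}. \<Sum>j\<in>{1..n}. real p * V i j ^ (p - 1) * w i j - (real p - 1) * V i j ^ p)
       + real p * (\<Sum>i\<in>{1..n}. \<Sum>j\<in>{1..n}. V i j ^ (p - 1) * (V i j - w i j))"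
    unfolding sum_distrib_left sum.distrib[symmetric]
  proof (intro sum.cong refl)
    fix i j
    have "V i j ^ p = V i j ^ (p - 1) * V i j" using p(2) by (cases p) auto
    then show "V i j ^ p = real p * V i j ^ (p - 1) * w i j - (real p - 1) * V i j ^ p
       + real p * (V i j ^ (p - 1) * (V i j - w i j))" by (simp add: algebra_simps)
  qed
  also have "\<dots> \<le> (\<Sum>i\<in>{1..n}. \<Sum>j\<in>{1..n}. real p * V i j ^ (p - 1) * w i j - (real p - 1) * V i j ^ p)
       + real p * (\<epsilon> * (real n)\<^sup>2)"
    using V(3) by (intro add_left_mono mult_left_mono) auto
  finally show ?thesis using V(1) by (auto simp: algebra_simps)
qed

section \<open>Homomorphism densities as finite sums\<close>

text \<open>
  The integrand depends on each coordinate only through its cell in the partition of \<open>[0,1]\<close> into \<open>n\<close> intervals.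
  The cell of index \<open>0\<close>, the single point \<open>0\<close>, is null, so vertex maps with values in \<open>{1..n}\<close> suffice.
\<close>

lemma hom_density_eq:
  assumes n: "0 < n" and H: "simple_graph H"
  shows "hom_density H n w = hom_sum n H (\<lambda>_. edge_weight n w) / real n ^ fst H"
proof -
  define M where "M = restrict_space lborel {0..1::real}"
  define I where "I = {1..fst H}"
  define q where "q x = nat \<lceil>real n * x\<rceil>" for x :: real
  define cell where "cell a = {x \<in> {0..1::real}. q x = a}" for a
  define c where "c \<phi> = (\<Prod>e\<in>snd H. edge_weight n w (\<phi> (fst e)) (\<phi> (snd e)))" for \<phi>
  interpret M: prob_space M unfolding M_def by (rule prob_space_restrict_space) auto
  interpret PM: product_sigma_finite "\<lambda>_::nat. M" ..
  have cell0: "cell 0 = {0}"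
    using n by (auto simp: cell_def q_def mult_le_0_iff)
  have cellS: "cell a = {(real a - 1) / real n<..real a / real n}" if a: "a \<in> {1..n}" for a
  proof -
    have interval: "{x \<in> {0..1}. A < x \<and> x \<le> B} = {A<..B}" if "0 \<le> A" "B \<le> 1" for A B :: real
      using that by auto
    have "q x = a \<longleftrightarrow> (real a - 1) / real n < x \<and> x \<le> real a / real n" for x
    proof -
      have "q x = a \<longleftrightarrow> \<lceil>real n * x\<rceil> = int a" using a by (auto simp: q_def)
      also have "\<dots> \<longleftrightarrow> real a - 1 < real n * x \<and> real n * x \<le> real a" by (simp add: ceiling_eq_iff)
      finally show ?thesis using n by (simp add: field_simps)
    qed
    moreover have "0 \<le> (real a - 1) / real n" "real a / real n \<le> 1" using a n by auto
    ultimately show ?thesis unfolding cell_def using interval by simp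
  qed
  have cell_sets: "cell a \<in> sets M" if "a \<in> {0..n}" for a
  proof -
    have "cell a \<in> sets borel"
      using that cell0 cellS[of a] by (cases "a = 0") auto
    then show ?thesis by (auto simp: M_def sets_restrict_space cell_def image_iff intro!: bexI[of _ "cell a"])
  qed
  have m: "measure M (cell a) = (if a = 0 then 0 else 1 / real n)" if "a \<in> {0..n}" for a
  proof -
    have "measure M (cell a) = measure lborel (cell a)"
      unfolding M_def by (rule measure_restrict_space) (auto simp: cell_def)
    then show ?thesis using that n cell0 cellS[of a] by (cases "a = 0") (auto simp: diff_divide_distrib[symmetric] divide_right_mono)
  qed
  have ind: "(\<Prod>i\<in>I. indicator (cell (\<phi> i)) (x i)) = (if \<phi> = restrict (q \<circ> x) I then 1 else 0 :: real)"
    if "\<phi> \<in> PiE I (\<lambda>_. {0..n})" "x \<in> PiE I (\<lambda>_. {0..1})" for \<phi> x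
  proof (cases "\<phi> = restrict (q \<circ> x) I")
    case True
    then show ?thesis using that(2) by (auto simp: cell_def indicator_def PiE_mem intro!: prod.neutral)
  next
    case False
    have "\<exists>i\<in>I. \<phi> i \<noteq> q (x i)"
    proof (rule ccontr)
      assume "\<not> ?thesis"
      then have "\<phi> i = restrict (q \<circ> x) I i" for i using PiE_arb[OF that(1)] by (cases "i \<in> I") auto
      then show False using False by blast
    qed
    then obtain i where "i \<in> I" "\<phi> i \<noteq> q (x i)" by blast
    moreover have "finite I" by (simp add: I_def)
    ultimately have "(\<Prod>i\<in>I. indicator (cell (\<phi> i)) (x i)) = (0 :: real)"
      by (intro prod_zero) (auto simp: cell_def intro!: bexI[of _ i])
    then show ?thesis using False by simp
  qed
  have F: "(\<Prod>(i, j)\<in>snd H. graphon n w (x i) (x j)) = (\<Sum>\<phi>\<in>PiE I (\<lambda>_. {0..n}). c \<phi> * (\<Prod>i\<in>I. indicator (cell (\<phi> i)) (x i)))"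
    if x: "x \<in> space (PiM I (\<lambda>_. M))" for x
  proof -
    have xP: "x \<in> PiE I (\<lambda>_. {0..1})" using x by (simp add: space_PiM M_def)
    have q_le: "q y \<le> n" if "y \<in> {0..1}" for y
    proof -
      have "real n * y \<le> real n" using that by (simp add: mult_left_le)
      then show ?thesis by (simp add: q_def ceiling_le_iff nat_le_iff)
    qed
    have mem: "restrict (q \<circ> x) I \<in> PiE I (\<lambda>_. {0..n})" using q_le[OF PiE_mem[OF xP]] by auto
    define \<rho> where "\<rho> = restrict (q \<circ> x) I"
    have "(\<Sum>\<phi>\<in>PiE I (\<lambda>_. {0..n}). c \<phi> * (\<Prod>i\<in>I. indicator (cell (\<phi> i)) (x i)))
      = (\<Sum>\<phi>\<in>PiE I (\<lambda>_. {0..n}). if \<phi> = \<rho> then c \<phi> else 0)"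
    proof (rule sum.cong[OF refl])
      fix \<phi> assume "\<phi> \<in> PiE I (\<lambda>_. {0..n})"
      then have "(\<Prod>i\<in>I. indicator (cell (\<phi> i)) (x i)) = (if \<phi> = \<rho> then 1 else 0 :: real)"
        unfolding \<rho>_def by (rule ind[OF _ xP])
      then show "c \<phi> * (\<Prod>i\<in>I. indicator (cell (\<phi> i)) (x i)) = (if \<phi> = \<rho> then c \<phi> else 0)" by simp
    qed
    also have "\<dots> = c \<rho>"
    proof -
      have "finite (PiE I (\<lambda>_. {0..n}))" by (rule finite_PiE) (auto simp: I_def)
      moreover have "\<rho> \<in> PiE I (\<lambda>_. {0..n})" unfolding \<rho>_def by (rule mem)
      ultimately show ?thesis by (simp only: sum.delta' sum.delta if_True)
    qed
    also have "\<dots> = (\<Prod>(i, j)\<in>snd H. graphon n w (x i) (x j))"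
      unfolding c_def case_prod_unfold \<rho>_def
    proof (rule prod.cong)
      fix e assume e: "e \<in> snd H"
      have "fst e \<in> I" "snd e \<in> I" using vertex_pairsD[OF simple_graphD(2)[OF H e]] by (auto simp: I_def)
      then show "edge_weight n w (restrict (q \<circ> x) I (fst e)) (restrict (q \<circ> x) I (snd e)) = graphon n w (x (fst e)) (x (snd e))"
        by (simp add: graphon_def q_def)
    qed simp
    finally show ?thesis by simp
  qed
  have int1: "integrable M (indicator (cell a) :: real \<Rightarrow> real)" if "a \<in> {0..n}" for a
    using cell_sets[OF that] by (simp add: M.emeasure_eq_measure)
  have finI: "finite I" by (simp add: I_def)
  have "hom_density H n w = (\<integral>x. (\<Sum>\<phi>\<in>PiE I (\<lambda>_. {0..n}). c \<phi> * (\<Prod>i\<in>I. indicator (cell (\<phi> i)) (x i))) \<partial>PiM I (\<lambda>_. M))"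
    unfolding hom_density_def M_def[symmetric] I_def[symmetric] by (rule Bochner_Integration.integral_cong[OF refl F])
  also have "\<dots> = (\<Sum>\<phi>\<in>PiE I (\<lambda>_. {0..n}). c \<phi> * (\<Prod>i\<in>I. measure M (cell (\<phi> i))))"
  proof (subst Bochner_Integration.integral_sum)
    fix \<phi> assume \<phi>: "\<phi> \<in> PiE I (\<lambda>_. {0..n})"
    show "integrable (PiM I (\<lambda>_. M)) (\<lambda>x. c \<phi> * (\<Prod>i\<in>I. indicator (cell (\<phi> i)) (x i)))"
      using \<phi> by (intro integrable_mult_right PM.product_integrable_prod[OF finI] int1) (auto dest: PiE_mem)
  next
    have "(\<integral>x. c \<phi> * (\<Prod>i\<in>I. indicator (cell (\<phi> i)) (x i)) \<partial>PiM I (\<lambda>_. M)) = c \<phi> * (\<Prod>i\<in>I. measure M (cell (\<phi> i)))"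
      if \<phi>: "\<phi> \<in> PiE I (\<lambda>_. {0..n})" for \<phi>
    proof -
      have "(\<integral>x. (\<Prod>i\<in>I. indicator (cell (\<phi> i)) (x i)) \<partial>PiM I (\<lambda>_. M)) = (\<Prod>i\<in>I. integral\<^sup>L M (indicator (cell (\<phi> i)) :: real \<Rightarrow> real))"
        using \<phi> by (intro PM.product_integral_prod[OF finI] int1) (auto dest: PiE_mem)
      also have "\<dots> = (\<Prod>i\<in>I. measure M (cell (\<phi> i)))"
        using \<phi> cell_sets by (intro prod.cong refl) (auto dest!: PiE_mem simp: M.emeasure_eq_measure)
      finally show ?thesis by simp
    qed
    then show "(\<Sum>\<phi>\<in>PiE I (\<lambda>_. {0..n}). \<integral>x. c \<phi> * (\<Prod>i\<in>I. indicator (cell (\<phi> i)) (x i)) \<partial>PiM I (\<lambda>_. M))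
      = (\<Sum>\<phi>\<in>PiE I (\<lambda>_. {0..n}). c \<phi> * (\<Prod>i\<in>I. measure M (cell (\<phi> i))))"
      by (rule sum.cong[OF refl])
  qed
  also have "\<dots> = (\<Sum>\<phi>\<in>PiE I (\<lambda>_. {1..n}). c \<phi> * (1 / real n) ^ fst H)"
  proof (rule sum.mono_neutral_cong_right)
    show "finite (PiE I (\<lambda>_. {0..n}))" using finI by (intro finite_PiE) auto
    show "PiE I (\<lambda>_. {1..n}) \<subseteq> PiE I (\<lambda>_. {0..n})" by (rule PiE_mono) auto
    show "\<forall>\<phi>\<in>PiE I (\<lambda>_. {0..n}) - PiE I (\<lambda>_. {1..n}). c \<phi> * (\<Prod>i\<in>I. measure M (cell (\<phi> i))) = 0"
    proof
      fix \<phi> assume \<phi>: "\<phi> \<in> PiE I (\<lambda>_. {0..n}) - PiE I (\<lambda>_. {1..n})"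
      then obtain i where "i \<in> I" "\<phi> i \<notin> {1..n}" by (auto simp: PiE_def Pi_def)
      moreover have "\<phi> i \<in> {0..n}" using \<phi> \<open>i \<in> I\<close> by (auto dest: PiE_mem)
      ultimately have "measure M (cell (\<phi> i)) = 0" using m[of "\<phi> i"] by auto
      then have "(\<Prod>i\<in>I. measure M (cell (\<phi> i))) = 0" using \<open>i \<in> I\<close> finI by (intro prod_zero) auto
      then show "c \<phi> * (\<Prod>i\<in>I. measure M (cell (\<phi> i))) = 0" by simp
    qed
    fix \<phi> assume \<phi>: "\<phi> \<in> PiE I (\<lambda>_. {1..n})"
    have "(\<Prod>i\<in>I. measure M (cell (\<phi> i))) = (\<Prod>i\<in>I. 1 / real n)"
      using \<phi> m by (intro prod.cong refl) (auto dest!: PiE_mem)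
    then show "c \<phi> * (\<Prod>i\<in>I. measure M (cell (\<phi> i))) = c \<phi> * (1 / real n) ^ fst H" by (simp add: I_def)
  qed
  also have "\<dots> = hom_sum n H (\<lambda>_. edge_weight n w) / real n ^ fst H"
    by (simp add: hom_sum_def c_def I_def sum_divide_distrib power_divide)
  finally show ?thesis .
qed

lemma sum_offdiag:
  fixes f :: "nat \<Rightarrow> nat \<Rightarrow> real"
  assumes "\<And>i. f i i = 0"
  shows "(\<Sum>i\<in>{1..n}. \<Sum>j\<in>{1..n}. f i j) = (\<Sum>e\<in>vertex_pairs n. f (fst e) (snd e) + f (snd e) (fst e))"
proof -
  have split: "{1..n} \<times> {1..n} = vertex_pairs n \<union> prod.swap ` vertex_pairs n \<union> (\<lambda>i. (i, i)) ` {1..n}"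
    by (auto simp: vertex_pairs_def image_iff)
  have fin: "finite (vertex_pairs n)" by (rule finite_vertex_pairs)
  have "(\<Sum>i\<in>{1..n}. \<Sum>j\<in>{1..n}. f i j) = (\<Sum>e\<in>vertex_pairs n \<union> prod.swap ` vertex_pairs n \<union> (\<lambda>i. (i, i)) ` {1..n}. f (fst e) (snd e))"
    unfolding split[symmetric] sum.cartesian_product by (simp add: case_prod_unfold)
  also have "\<dots> = (\<Sum>e\<in>vertex_pairs n. f (fst e) (snd e)) + (\<Sum>e\<in>prod.swap ` vertex_pairs n. f (fst e) (snd e)) + (\<Sum>e\<in>(\<lambda>i. (i, i)) ` {1..n}. f (fst e) (snd e))"
  proof -
    have "(vertex_pairs n \<union> prod.swap ` vertex_pairs n) \<inter> (\<lambda>i. (i, i)) ` {1..n} = {}"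
      "vertex_pairs n \<inter> prod.swap ` vertex_pairs n = {}"
      by (auto simp: vertex_pairs_def)
    then show ?thesis using fin by (simp add: sum.union_disjoint)
  qed
  also have "(\<Sum>e\<in>(\<lambda>i. (i, i)) ` {1..n}. f (fst e) (snd e)) = 0" by (rule sum.neutral) (use assms in auto)
  also have "(\<Sum>e\<in>prod.swap ` vertex_pairs n. f (fst e) (snd e)) = (\<Sum>e\<in>vertex_pairs n. f (snd e) (fst e))"
    by (subst sum.reindex) (auto simp: inj_on_def)
  finally show ?thesis by (simp add: sum.distrib)
qed

lemma edge_weight_simps:
  "e \<in> vertex_pairs n \<Longrightarrow> edge_weight n w (fst e) (snd e) = w e"
  "e \<in> vertex_pairs n \<Longrightarrow> edge_weight n w (snd e) (fst e) = w e"
  "edge_weight n w i i = 0"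
  by (auto simp: edge_weight_def vertex_pairs_def)

lemma edge_weight_range: "(\<And>e. e \<in> vertex_pairs n \<Longrightarrow> w e \<in> {0..1}) \<Longrightarrow> edge_weight n w i j \<in> {0..1}"
  by (auto simp: edge_weight_def)

lemma card_vertex_pairs: "2 * real (card (vertex_pairs n)) = real n * (real n - 1)"
proof -
  have "(\<Sum>i\<in>{1..n}. \<Sum>j\<in>{1..n}. if i = j then 0 else 1 :: real) = 2 * real (card (vertex_pairs n))"
  proof (subst sum_offdiag)
    have "(\<Sum>e\<in>vertex_pairs n. (if fst e = snd e then 0 else 1) + (if snd e = fst e then 0 else 1 :: real)) = (\<Sum>e\<in>vertex_pairs n. 2)"
      by (rule sum.cong) (auto dest: vertex_pairsD)
    then show "(\<Sum>e\<in>vertex_pairs n. (if fst e = snd e then 0 else 1) + (if snd e = fst e then 0 else 1 :: real)) = 2 * real (card (vertex_pairs n))"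
      by simp
  qed simp
  moreover have "(\<Sum>j\<in>{1..n}. if i = j then 0 else 1 :: real) = real n - 1" if "i \<in> {1..n}" for i
  proof -
    have "(\<Sum>j\<in>{1..n}. if i = j then 0 else 1 :: real) = (\<Sum>j\<in>{1..n}. 1 - (if i = j then 1 else 0))"
      by (intro sum.cong) auto
    then show ?thesis using that by (simp add: sum_subtractf)
  qed
  ultimately show ?thesis by simp
qed

lemma single_edge_density:
  assumes n: "0 < n"
  shows "(real n)\<^sup>2 * hom_density single_edge n w = 2 * (\<Sum>e\<in>vertex_pairs n. w e)"
proof -
  have H: "simple_graph single_edge" by (auto simp: simple_graph_def single_edge_def vertex_pairs_def)
  have "hom_sum n single_edge (\<lambda>_. edge_weight n w) = (\<Sum>i\<in>{1..n}. \<Sum>j\<in>{1..n}. edge_weight n w i j)"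
    unfolding hom_sum_def by (subst sum_PiE_two[of 1 _ 2]) (auto simp: single_edge_def card_PiE)
  also have "\<dots> = 2 * (\<Sum>e\<in>vertex_pairs n. w e)"
    by (subst sum_offdiag) (auto simp: edge_weight_simps sum_distrib_left intro!: sum.cong)
  finally have "hom_sum n single_edge (\<lambda>_. edge_weight n w) = 2 * (\<Sum>e\<in>vertex_pairs n. w e)" .
  moreover have "fst single_edge = 2" by (simp add: single_edge_def)
  ultimately show ?thesis unfolding hom_density_eq[OF n H] using n by simp
qed

section \<open>The limiting normalization constant\<close>

lemma hom_sum_range:
  assumes "\<And>i j. V i j \<in> {0..1}"
  shows "0 \<le> hom_sum n H (\<lambda>_. V)" "hom_sum n H (\<lambda>_. V) \<le> real n ^ fst H"
proof -
  show "0 \<le> hom_sum n H (\<lambda>_. V)"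
    unfolding hom_sum_def using assms by (intro sum_nonneg prod_nonneg) auto
  have "hom_sum n H (\<lambda>_. V) \<le> (\<Sum>\<phi>\<in>PiE {1..fst H} (\<lambda>_. {1..n}). 1)"
    unfolding hom_sum_def using assms by (intro sum_mono prod_le_1) auto
  then show "hom_sum n H (\<lambda>_. V) \<le> real n ^ fst H" by (simp add: card_PiE)
qed

lemma hom_density_range:
  assumes "0 < n" "simple_graph H" "\<And>e. e \<in> vertex_pairs n \<Longrightarrow> w e \<in> {0..1}"
  shows "hom_density H n w \<in> {0..1}"
  using hom_sum_range[where V = "edge_weight n w" and n = n and H = H, OF edge_weight_range[OF assms(3)]] assms(1)
  by (simp add: hom_density_eq[OF assms(1,2)])

definition injections :: "nat \<Rightarrow> nat \<Rightarrow> (nat \<Rightarrow> nat) set" where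
  "injections k n = {\<phi> \<in> PiE {1..k} (\<lambda>_. {1..n}). inj_on \<phi> {1..k}}"

text \<open>
  The proportion of injective maps is a product of \<open>k\<close> factors \<open>1 - i / n\<close>.
\<close>

lemma injections_density: "(\<lambda>n. real (card (injections k n)) / real n ^ k) \<longlonglongrightarrow> 1"
proof -
  have "(\<lambda>n. \<Prod>i\<in>{0..<k}. 1 - real i / real n) \<longlonglongrightarrow> (\<Prod>i\<in>{0..<k}. 1 - 0)"
    by (intro tendsto_prod tendsto_diff tendsto_const lim_const_over_n)
  moreover have "eventually (\<lambda>n. (\<Prod>i\<in>{0..<k}. 1 - real i / real n) = real (card (injections k n)) / real n ^ k) sequentially"
    using eventually_ge_at_top[of "Suc k"]
  proof eventually_elim
    fix n assume n: "Suc k \<le> n"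
    have "card (injections k n) = (\<Prod>i\<in>{0..<k}. n - i)"
      unfolding injections_def
      using card_inj_on_subset_funcset[of "{1..k}" "{1..n}" "{1..k}"] by simp
    then have "real (card (injections k n)) = (\<Prod>i\<in>{0..<k}. real n - real i)"
      using n by (simp add: of_nat_diff)
    also have "\<dots> = (\<Prod>i\<in>{0..<k}. (1 - real i / real n) * real n)"
      using n by (intro prod.cong) (auto simp: field_simps)
    also have "\<dots> = (\<Prod>i\<in>{0..<k}. 1 - real i / real n) * real n ^ k" by (simp add: prod.distrib)
    finally show "(\<Prod>i\<in>{0..<k}. 1 - real i / real n) = real (card (injections k n)) / real n ^ k"
      using n by simp
  qed
  ultimately show ?thesis by (simp add: filterlim_cong)
qed

text \<open>
  An injective vertex map sends different edges to different pairs, so its contribution is a product of \<open>p\<close>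
  distinct, hence independent, weights.
\<close>

lemma injection_product:
  assumes H: "simple_graph H" and \<phi>: "\<phi> \<in> injections (fst H) n"
  shows "\<exists>S\<subseteq>vertex_pairs n. card S = card (snd H) \<and> (\<forall>w. (\<Prod>e\<in>snd H. edge_weight n w (\<phi> (fst e)) (\<phi> (snd e))) = (\<Prod>e\<in>S. w e))"
proof -
  define g where "g e = (min (\<phi> (fst e)) (\<phi> (snd e)), max (\<phi> (fst e)) (\<phi> (snd e)))" for e
  have inj: "inj_on \<phi> {1..fst H}" and mem: "\<And>i. i \<in> {1..fst H} \<Longrightarrow> \<phi> i \<in> {1..n}"
    using \<phi> by (auto simp: injections_def dest: PiE_mem)
  have e: "fst e \<in> {1..fst H}" "snd e \<in> {1..fst H}" "fst e < snd e" if "e \<in> snd H" for e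
    using vertex_pairsD[OF simple_graphD(2)[OF H that]] by auto
  have ne: "\<phi> (fst e) \<noteq> \<phi> (snd e)" if "e \<in> snd H" for e
    using e[OF that] inj by (auto dest: inj_onD)
  have g_mem: "g e \<in> vertex_pairs n" if "e \<in> snd H" for e
    using mem[OF e(1)[OF that]] mem[OF e(2)[OF that]] ne[OF that] by (auto simp: g_def vertex_pairs_def min_def max_def)
  have g_inj: "inj_on g (snd H)"
  proof (rule inj_onI)
    fix a b assume a: "a \<in> snd H" and b: "b \<in> snd H" and eq: "g a = g b"
    from eq have "\<phi> (fst a) = \<phi> (fst b) \<and> \<phi> (snd a) = \<phi> (snd b) \<or> \<phi> (fst a) = \<phi> (snd b) \<and> \<phi> (snd a) = \<phi> (fst b)"
      by (auto simp: g_def min_def max_def split: if_splits)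
    then have "fst a = fst b \<and> snd a = snd b \<or> fst a = snd b \<and> snd a = fst b"
      using inj_onD[OF inj] e[OF a] e[OF b] by blast
    then show "a = b" using e(3)[OF a] e(3)[OF b] by (auto simp: prod_eq_iff)
  qed
  have "edge_weight n w (\<phi> (fst e)) (\<phi> (snd e)) = w (g e)" if "e \<in> snd H" for e w
    using edge_weight_simps(1,2)[OF g_mem[OF that], of w] by (auto simp: g_def min_def max_def split: if_splits)
  then have "(\<Prod>e\<in>snd H. edge_weight n w (\<phi> (fst e)) (\<phi> (snd e))) = (\<Prod>e\<in>g ` snd H. w e)" for w
    by (simp add: prod.reindex[OF g_inj])
  then show ?thesis using g_mem card_image[OF g_inj] by (intro exI[of _ "g ` snd H"]) auto
qed

context unit_law
begin

interpretation edges: product_sigma_finite "\<lambda>_ :: nat \<times> nat. \<mu>" ..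

lemma prob_space_weights: "prob_space (weighted_graph_measure \<mu> n)"
  unfolding weighted_graph_measure_def by (rule prob_space_PiM) (rule prob_space_axioms)

lemma AE_weights_in_unit: "AE w in weighted_graph_measure \<mu> n. \<forall>e\<in>vertex_pairs n. w e \<in> {0..1}"
  unfolding weighted_graph_measure_def
  by (intro AE_finite_allI finite_vertex_pairs AE_PiM_component prob_space_axioms in_unit)

lemma measurable_weight:
  assumes "e \<in> vertex_pairs n" shows "(\<lambda>w. w e) \<in> borel_measurable (weighted_graph_measure \<mu> n)"
proof -
  have "(\<lambda>w. w e) \<in> measurable (PiM (vertex_pairs n) (\<lambda>_. \<mu>)) \<mu>" by (rule measurable_component_singleton[OF assms])
  then show ?thesis unfolding weighted_graph_measure_def by (subst (asm) measurable_cong_sets[OF refl sets_mu])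
qed

lemma measurable_edge_weight: "(\<lambda>w. edge_weight n w i j) \<in> borel_measurable (weighted_graph_measure \<mu> n)"
  unfolding edge_weight_def using measurable_weight[of "(i, j)" n] measurable_weight[of "(j, i)" n]
  by (cases "(i, j) \<in> vertex_pairs n"; cases "(j, i) \<in> vertex_pairs n") simp_all

lemma measurable_hom_density:
  assumes "0 < n" "simple_graph H"
  shows "hom_density H n \<in> borel_measurable (weighted_graph_measure \<mu> n)"
proof -
  have "(\<lambda>w. hom_sum n H (\<lambda>_. edge_weight n w) / real n ^ fst H) \<in> borel_measurable (weighted_graph_measure \<mu> n)"
    unfolding hom_sum_def
    by (intro borel_measurable_divide borel_measurable_sum borel_measurable_prod borel_measurable_const measurable_edge_weight)
  moreover have "hom_density H n = (\<lambda>w. hom_sum n H (\<lambda>_. edge_weight n w) / real n ^ fst H)"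
    using hom_density_eq[OF assms] by blast
  ultimately show ?thesis by simp
qed

lemma integrable_exp: "integrable \<mu> (\<lambda>x. exp (\<theta> * x))"
  using integrable_tilted[of "\<lambda>_. 1" 1 \<theta>] by simp

lemma integral_exp: "(\<integral>x. exp (\<theta> * x) \<partial>\<mu>) = exp (cgf \<mu> \<theta>)"
  using mgf0_pos[of \<theta>] mgf_integral[of 0 \<theta>] by (simp add: cgf_eq)

text \<open>
  Independence turns the exponential moment into a product.
\<close>

lemma has_integral_exp_linear:
  "has_bochner_integral (weighted_graph_measure \<mu> n) (\<lambda>w. exp ((\<Sum>e\<in>vertex_pairs n. a e * w e) + b))
     (exp ((\<Sum>e\<in>vertex_pairs n. cgf \<mu> (a e)) + b))"
proof -
  have eq: "exp ((\<Sum>e\<in>vertex_pairs n. a e * w e) + b) = exp b * (\<Prod>e\<in>vertex_pairs n. exp (a e * w e))" for w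
    by (simp add: exp_add exp_sum finite_vertex_pairs)
  have "integrable (weighted_graph_measure \<mu> n) (\<lambda>w. \<Prod>e\<in>vertex_pairs n. exp (a e * w e))"
    unfolding weighted_graph_measure_def
    by (rule edges.product_integrable_prod[OF finite_vertex_pairs]) (rule integrable_exp)
  moreover have "(\<integral>w. (\<Prod>e\<in>vertex_pairs n. exp (a e * w e)) \<partial>weighted_graph_measure \<mu> n) = (\<Prod>e\<in>vertex_pairs n. exp (cgf \<mu> (a e)))"
    unfolding weighted_graph_measure_def integral_exp[symmetric]
    by (rule edges.product_integral_prod[OF finite_vertex_pairs]) (rule integrable_exp)
  ultimately show ?thesis
    unfolding eq by (simp add: has_bochner_integral_iff exp_add exp_sum finite_vertex_pairs)
qed

lemma has_integral_tilted:
  assumes S: "S \<subseteq> vertex_pairs n"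
  shows "has_bochner_integral (weighted_graph_measure \<mu> n) (\<lambda>w. exp (\<theta> * (\<Sum>e\<in>vertex_pairs n. w e)) * (\<Prod>e\<in>S. w e))
     (exp (real (card (vertex_pairs n)) * cgf \<mu> \<theta>) * K1 \<theta> ^ card S)"
proof -
  note fin = finite_vertex_pairs[of n]
  define f where "f e x = (if e \<in> S then x ^ 1 else x ^ 0) * exp (\<theta> * x)" for e :: "nat \<times> nat" and x :: real
  have eq: "exp (\<theta> * (\<Sum>e\<in>vertex_pairs n. w e)) * (\<Prod>e\<in>S. w e) = (\<Prod>e\<in>vertex_pairs n. f e (w e))" for w
  proof -
    have "(\<Prod>e\<in>vertex_pairs n. if e \<in> S then w e else 1) = (\<Prod>e\<in>S. w e)"
      using S fin by (simp add: prod.If_cases Int_absorb1 Int_def[symmetric])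
    moreover have "f e x = (if e \<in> S then x else 1) * exp (\<theta> * x)" for e x by (simp add: f_def)
    ultimately show ?thesis by (simp add: prod.distrib sum_distrib_left exp_sum fin mult.commute)
  qed
  have int: "integrable \<mu> (f e)" for e
    unfolding f_def by (rule integrable_tilted[of _ 1]) auto
  have "integral\<^sup>L \<mu> (f e) = exp (cgf \<mu> \<theta>) * (if e \<in> S then K1 \<theta> else 1)" for e
    using mgf0_pos[of \<theta>] mgf_integral[of 1 \<theta>] mgf_integral[of 0 \<theta>] by (simp add: f_def[abs_def] cgf_eq K1_def)
  then have "(\<Prod>e\<in>vertex_pairs n. integral\<^sup>L \<mu> (f e)) = exp (cgf \<mu> \<theta>) ^ card (vertex_pairs n) * (\<Prod>e\<in>vertex_pairs n. if e \<in> S then K1 \<theta> else 1)"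
    by (simp add: prod.distrib)
  also have "\<dots> = exp (real (card (vertex_pairs n)) * cgf \<mu> \<theta>) * K1 \<theta> ^ card S"
    using S fin by (simp add: prod.If_cases Int_absorb1 exp_of_nat_mult)
  finally show ?thesis
    unfolding eq weighted_graph_measure_def
    using edges.product_integral_prod[OF fin int] edges.product_integrable_prod[OF fin int]
    by (simp add: has_bochner_integral_iff)
qed

definition energy :: "graph \<Rightarrow> nat \<Rightarrow> real \<times> real \<Rightarrow> (nat \<times> nat \<Rightarrow> real) \<Rightarrow> real" where
  "energy H n \<beta> w = (real n)\<^sup>2 * (fst \<beta> * hom_density single_edge n w + snd \<beta> * hom_density H n w)"

lemma energy_eq:
  "0 < n \<Longrightarrow> energy H n \<beta> w = 2 * fst \<beta> * (\<Sum>e\<in>vertex_pairs n. w e) + snd \<beta> * ((real n)\<^sup>2 * hom_density H n w)"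
  using single_edge_density[of n w] by (simp add: energy_def algebra_simps)

lemma integrable_energy:
  assumes n: "0 < n" and H: "simple_graph H"
  shows "integrable (weighted_graph_measure \<mu> n) (\<lambda>w. exp (energy H n \<beta> w))"
proof -
  interpret P: prob_space "weighted_graph_measure \<mu> n" by (rule prob_space_weights)
  have H1: "simple_graph single_edge" by (auto simp: simple_graph_def single_edge_def vertex_pairs_def)
  show ?thesis
  proof (rule P.integrable_const_bound[of _ "exp ((real n)\<^sup>2 * (\<bar>fst \<beta>\<bar> + \<bar>snd \<beta>\<bar>))"])
    show "(\<lambda>w. exp (energy H n \<beta> w)) \<in> borel_measurable (weighted_graph_measure \<mu> n)"
      unfolding energy_def using measurable_hom_density[OF n H] measurable_hom_density[OF n H1] by measurable
    show "AE w in weighted_graph_measure \<mu> n. norm (exp (energy H n \<beta> w)) \<le> exp ((real n)\<^sup>2 * (\<bar>fst \<beta>\<bar> + \<bar>snd \<beta>\<bar>))"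
      using AE_weights_in_unit
    proof eventually_elim
      fix w :: "nat \<times> nat \<Rightarrow> real" assume w: "\<forall>e\<in>vertex_pairs n. w e \<in> {0..1}"
      have b: "c * h \<le> \<bar>c\<bar>" if "h \<in> {0..1}" for c h :: real
      proof -
        have "\<bar>c * h\<bar> \<le> \<bar>c\<bar> * 1" unfolding abs_mult using that by (intro mult_left_mono) auto
        then show ?thesis by linarith
      qed
      have "fst \<beta> * hom_density single_edge n w + snd \<beta> * hom_density H n w \<le> \<bar>fst \<beta>\<bar> + \<bar>snd \<beta>\<bar>"
        using w by (intro add_mono b hom_density_range n H H1) auto
      then show "norm (exp (energy H n \<beta> w)) \<le> exp ((real n)\<^sup>2 * (\<bar>fst \<beta>\<bar> + \<bar>snd \<beta>\<bar>))"
        by (simp add: energy_def mult_left_mono)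
    qed
  qed
qed

lemma psi_n_eq: "psi_n \<mu> single_edge H n \<beta> = ln (\<integral>w. exp (energy H n \<beta> w) \<partial>weighted_graph_measure \<mu> n) / (real n)\<^sup>2"
  by (simp add: psi_n_def energy_def)

text \<open>
  With \<open>Y = \<theta> \<Sum> w + c\<close> one has \<open>exp X \<ge> exp Y * (1 + X - Y)\<close>. All terms on the right are products of
  functions of single edges, so their integrals are explicit. The constant \<open>c\<close> is the one for which
  \<open>exp Y * (X - Y)\<close> integrates to zero, where \<open>X\<close> is the energy with its density restricted to injective maps.
\<close>

lemma psi_n_lower:
  fixes \<theta> :: real
  assumes n: "0 < n" and H: "simple_graph H" and b2: "0 \<le> snd \<beta>"
  defines "N \<equiv> real (card (vertex_pairs n))"
  defines "\<rho> \<equiv> real (card (injections (fst H) n)) / real n ^ fst H"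
  shows "((2 * fst \<beta> - \<theta>) * N * K1 \<theta> + N * cgf \<mu> \<theta>) / (real n)\<^sup>2 + snd \<beta> * \<rho> * K1 \<theta> ^ card (snd H)
     \<le> psi_n \<mu> single_edge H n \<beta>"
proof -
  let ?P = "weighted_graph_measure \<mu> n"
  define c where "c = (2 * fst \<beta> - \<theta>) * N * K1 \<theta> + snd \<beta> * (real n)\<^sup>2 * \<rho> * K1 \<theta> ^ card (snd H)"
  define s where "s w = (\<Sum>e\<in>vertex_pairs n. w e)" for w :: "nat \<times> nat \<Rightarrow> real"
  define t where "t \<phi> w = (\<Prod>e\<in>snd H. edge_weight n w (\<phi> (fst e)) (\<phi> (snd e)))" for \<phi> w
  define R where "R w = exp (\<theta> * s w) * (1 - c) + (2 * fst \<beta> - \<theta>) * (\<Sum>e\<in>vertex_pairs n. exp (\<theta> * s w) * w e)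
      + snd \<beta> * (real n)\<^sup>2 / real n ^ fst H * (\<Sum>\<phi>\<in>injections (fst H) n. exp (\<theta> * s w) * t \<phi> w)" for w
  have R_eq: "R w = exp (\<theta> * s w) * ((1 - c) + (2 * fst \<beta> - \<theta>) * s w
      + snd \<beta> * (real n)\<^sup>2 / real n ^ fst H * (\<Sum>\<phi>\<in>injections (fst H) n. t \<phi> w))" for w
    unfolding R_def sum_distrib_left[symmetric] s_def[symmetric] by (simp add: algebra_simps)
  have i0: "has_bochner_integral ?P (\<lambda>w. exp (\<theta> * s w)) (exp (N * cgf \<mu> \<theta>))"
    using has_integral_tilted[of "{}" n \<theta>] by (simp add: s_def N_def)
  have i1: "has_bochner_integral ?P (\<lambda>w. exp (\<theta> * s w) * w e) (exp (N * cgf \<mu> \<theta>) * K1 \<theta>)" if "e \<in> vertex_pairs n" for e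
    using has_integral_tilted[of "{e}" n \<theta>] that by (simp add: s_def N_def)
  have i2: "has_bochner_integral ?P (\<lambda>w. exp (\<theta> * s w) * t \<phi> w) (exp (N * cgf \<mu> \<theta>) * K1 \<theta> ^ card (snd H))"
    if \<phi>: "\<phi> \<in> injections (fst H) n" for \<phi>
  proof -
    obtain S where S: "S \<subseteq> vertex_pairs n" "card S = card (snd H)" "\<And>w. t \<phi> w = (\<Prod>e\<in>S. w e)"
      using injection_product[OF H \<phi>] unfolding t_def by blast
    show ?thesis using has_integral_tilted[OF S(1), of \<theta>] S(2,3) by (simp add: s_def N_def)
  qed
  have "has_bochner_integral ?P R (exp (N * cgf \<mu> \<theta>) * (1 - c)
      + (2 * fst \<beta> - \<theta>) * (\<Sum>e\<in>vertex_pairs n. exp (N * cgf \<mu> \<theta>) * K1 \<theta>)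
      + snd \<beta> * (real n)\<^sup>2 / real n ^ fst H * (\<Sum>\<phi>\<in>injections (fst H) n. exp (N * cgf \<mu> \<theta>) * K1 \<theta> ^ card (snd H)))"
    unfolding R_def[abs_def]
    by (intro has_bochner_integral_add has_bochner_integral_mult_right has_bochner_integral_mult_left has_bochner_integral_sum i0 i1 i2)
  also have "exp (N * cgf \<mu> \<theta>) * (1 - c)
      + (2 * fst \<beta> - \<theta>) * (\<Sum>e\<in>vertex_pairs n. exp (N * cgf \<mu> \<theta>) * K1 \<theta>)
      + snd \<beta> * (real n)\<^sup>2 / real n ^ fst H * (\<Sum>\<phi>\<in>injections (fst H) n. exp (N * cgf \<mu> \<theta>) * K1 \<theta> ^ card (snd H))
    = exp (N * cgf \<mu> \<theta>)"
    by (simp add: c_def \<rho>_def N_def[symmetric] algebra_simps)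
  finally have R_int: "has_bochner_integral ?P R (exp (N * cgf \<mu> \<theta>))" .
  have "exp (c + N * cgf \<mu> \<theta>) = (\<integral>w. exp c * R w \<partial>?P)"
    using R_int by (simp add: has_bochner_integral_iff exp_add)
  also have "\<dots> \<le> (\<integral>w. exp (energy H n \<beta> w) \<partial>?P)"
  proof (rule integral_mono_AE)
    show "integrable ?P (\<lambda>w. exp c * R w)" using R_int by (simp add: has_bochner_integral_iff)
    show "integrable ?P (\<lambda>w. exp (energy H n \<beta> w))" by (rule integrable_energy[OF n H])
    show "AE w in ?P. exp c * R w \<le> exp (energy H n \<beta> w)"
      using AE_weights_in_unit
    proof eventually_elim
      fix w :: "nat \<times> nat \<Rightarrow> real" assume w: "\<forall>e\<in>vertex_pairs n. w e \<in> {0..1}"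
      have "(\<Sum>\<phi>\<in>injections (fst H) n. t \<phi> w) \<le> hom_sum n H (\<lambda>_. edge_weight n w)"
        unfolding hom_sum_def t_def
      proof (rule sum_mono2)
        show "finite ({1..fst H} \<rightarrow>\<^sub>E {1..n})" by (rule finite_PiE) auto
        show "injections (fst H) n \<subseteq> {1..fst H} \<rightarrow>\<^sub>E {1..n}" by (auto simp: injections_def)
        show "0 \<le> (\<Prod>e\<in>snd H. edge_weight n w (\<phi> (fst e)) (\<phi> (snd e)))" for \<phi>
          using edge_weight_range[of n w] w by (intro prod_nonneg) auto
      qed
      then have "(\<Sum>\<phi>\<in>injections (fst H) n. t \<phi> w) / real n ^ fst H \<le> hom_density H n w"
        unfolding hom_density_eq[OF n H] by (rule divide_right_mono) simp
      then have "snd \<beta> * (real n)\<^sup>2 * ((\<Sum>\<phi>\<in>injections (fst H) n. t \<phi> w) / real n ^ fst H) \<le> snd \<beta> * (real n)\<^sup>2 * hom_density H n w"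
        using b2 by (intro mult_left_mono) auto
      then have le: "2 * fst \<beta> * s w + snd \<beta> * (real n)\<^sup>2 / real n ^ fst H * (\<Sum>\<phi>\<in>injections (fst H) n. t \<phi> w) \<le> energy H n \<beta> w"
        unfolding energy_eq[OF n] s_def by simp
      have "exp c * R w \<le> exp (c + \<theta> * s w) * (1 + (energy H n \<beta> w - (c + \<theta> * s w)))"
        unfolding R_eq exp_add mult.assoc using le by (intro mult_left_mono) (auto simp: algebra_simps)
      also have "\<dots> \<le> exp (c + \<theta> * s w) * exp (energy H n \<beta> w - (c + \<theta> * s w))"
        by (intro mult_left_mono exp_ge_add_one_self) simp
      also have "\<dots> = exp (energy H n \<beta> w)" by (simp add: exp_add[symmetric])
      finally show "exp c * R w \<le> exp (energy H n \<beta> w)" .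
    qed
  qed
  finally have "c + N * cgf \<mu> \<theta> \<le> ln (\<integral>w. exp (energy H n \<beta> w) \<partial>?P)"
    by (subst ln_ge_iff) (auto intro: less_le_trans[OF exp_gt_zero])
  then have "(c + N * cgf \<mu> \<theta>) / (real n)\<^sup>2 \<le> psi_n \<mu> single_edge H n \<beta>"
    unfolding psi_n_eq by (rule divide_right_mono) simp
  moreover have "(c + N * cgf \<mu> \<theta>) / (real n)\<^sup>2 = ((2 * fst \<beta> - \<theta>) * N * K1 \<theta> + N * cgf \<mu> \<theta>) / (real n)\<^sup>2 + snd \<beta> * \<rho> * K1 \<theta> ^ card (snd H)"
    using n by (simp add: c_def field_simps)
  ultimately show ?thesis by simp
qed

text \<open>
  The exponential of the energy is at most a sum, over the approximants \<open>V\<close>, of exponentials of linear functions.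
  By convexity of \<open>K\<close> the symmetric coefficient at an edge \<open>{i, j}\<close> splits into the contributions of
  \<open>V i j\<close> and \<open>V j i\<close>, and each of them is at most \<open>\<Phi>\<close> by the assumption \<open>dual\<close>.
\<close>

lemma psi_n_upper:
  assumes n: "0 < n" and H: "simple_graph H" and p: "card (snd H) = p" "2 \<le> p" and b2: "0 \<le> snd \<beta>"
    and \<epsilon>: "0 < \<epsilon>" "\<epsilon> \<le> 1" and l: "1 < real l * \<epsilon>\<^sup>2"
    and dual: "\<And>v. v \<in> {0..1} \<Longrightarrow> cgf \<mu> (2 * (fst \<beta> + real p * snd \<beta> * v ^ (p - 1))) / 2 - snd \<beta> * (real p - 1) * v ^ p \<le> \<Phi>"
    and mid: "\<And>a b. cgf \<mu> (a + b) \<le> cgf \<mu> (2 * a) / 2 + cgf \<mu> (2 * b) / 2"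
  shows "psi_n \<mu> single_edge H n \<beta> \<le> real l * (real n * ln 8) / (real n)\<^sup>2 + real n * (real n - 1) / (real n)\<^sup>2 * \<Phi> + 2 * real p * \<epsilon> * snd \<beta>"
proof -
  let ?P = "weighted_graph_measure \<mu> n"
  let ?A = "approximants \<epsilon> p n l"
  define a where "a V e = 2 * fst \<beta> + snd \<beta> * real p * (V (fst e) (snd e) ^ (p - 1) + V (snd e) (fst e) ^ (p - 1))"
    for V :: matrix and e :: "nat \<times> nat"
  define b where "b V = snd \<beta> * (2 * real p * \<epsilon> * (real n)\<^sup>2) - snd \<beta> * (real p - 1) * (\<Sum>i\<in>{1..n}. \<Sum>j\<in>{1..n}. V i j ^ p)" for V :: matrix
  define B where "B = real n * (real n - 1) * \<Phi> + snd \<beta> * (2 * real p * \<epsilon> * (real n)\<^sup>2)"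
  have bound: "(\<Sum>e\<in>vertex_pairs n. cgf \<mu> (a V e)) + b V \<le> B" if V: "V \<in> ?A" for V
  proof -
    have r: "V i j \<in> {0..1}" for i j using approximants_range[OF _ _ p(2) V] \<epsilon> by auto
    define q where "q v = cgf \<mu> (2 * (fst \<beta> + real p * snd \<beta> * v ^ (p - 1))) / 2 - snd \<beta> * (real p - 1) * v ^ p" for v
    have off: "(\<Sum>i\<in>{1..n}. \<Sum>j\<in>{1..n}. if i = j then 0 else V i j ^ p)
      = (\<Sum>e\<in>vertex_pairs n. V (fst e) (snd e) ^ p + V (snd e) (fst e) ^ p)"
      by (subst sum_offdiag) (auto dest: vertex_pairsD intro!: sum.cong)
    have "(\<Sum>i\<in>{1..n}. \<Sum>j\<in>{1..n}. if i = j then 0 else V i j ^ p) \<le> (\<Sum>i\<in>{1..n}. \<Sum>j\<in>{1..n}. V i j ^ p)"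
      using r by (intro sum_mono) auto
    then have S: "snd \<beta> * (real p - 1) * (\<Sum>e\<in>vertex_pairs n. V (fst e) (snd e) ^ p + V (snd e) (fst e) ^ p)
        \<le> snd \<beta> * (real p - 1) * (\<Sum>i\<in>{1..n}. \<Sum>j\<in>{1..n}. V i j ^ p)"
      unfolding off using b2 p(2) by (intro mult_left_mono) auto
    have "(\<Sum>e\<in>vertex_pairs n. cgf \<mu> (a V e)) - snd \<beta> * (real p - 1) * (\<Sum>e\<in>vertex_pairs n. V (fst e) (snd e) ^ p + V (snd e) (fst e) ^ p)
      = (\<Sum>e\<in>vertex_pairs n. cgf \<mu> (a V e) - snd \<beta> * (real p - 1) * (V (fst e) (snd e) ^ p + V (snd e) (fst e) ^ p))"
      by (simp add: sum_subtractf sum_distrib_left)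
    also have "\<dots> \<le> (\<Sum>e\<in>vertex_pairs n. 2 * \<Phi>)"
    proof (rule sum_mono)
      fix e
      let ?x = "V (fst e) (snd e)" and ?y = "V (snd e) (fst e)"
      have "cgf \<mu> (a V e) \<le> cgf \<mu> (2 * (fst \<beta> + real p * snd \<beta> * ?x ^ (p - 1))) / 2 + cgf \<mu> (2 * (fst \<beta> + real p * snd \<beta> * ?y ^ (p - 1))) / 2"
      proof -
        have "a V e = fst \<beta> + real p * snd \<beta> * ?x ^ (p - 1) + (fst \<beta> + real p * snd \<beta> * ?y ^ (p - 1))"
          by (simp add: a_def algebra_simps)
        then show ?thesis using mid by metis
      qed
      then have "cgf \<mu> (a V e) - snd \<beta> * (real p - 1) * (?x ^ p + ?y ^ p) \<le> q ?x + q ?y"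
        unfolding q_def ring_distribs by linarith
      also have "q ?x \<le> \<Phi>" "q ?y \<le> \<Phi>" unfolding q_def by (rule dual[OF r])+
      then have "q ?x + q ?y \<le> 2 * \<Phi>" by linarith
      finally show "cgf \<mu> (a V e) - snd \<beta> * (real p - 1) * (?x ^ p + ?y ^ p) \<le> 2 * \<Phi>" .
    qed
    also have "\<dots> = real n * (real n - 1) * \<Phi>"
      using card_vertex_pairs[of n] by simp
    finally show ?thesis using S unfolding b_def B_def by linarith
  qed
  have "(\<integral>w. exp (energy H n \<beta> w) \<partial>?P) \<le> (\<integral>w. (\<Sum>V\<in>?A. exp ((\<Sum>e\<in>vertex_pairs n. a V e * w e) + b V)) \<partial>?P)"
  proof (rule integral_mono_AE)
    show "integrable ?P (\<lambda>w. exp (energy H n \<beta> w))" by (rule integrable_energy[OF n H])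
    show "integrable ?P (\<lambda>w. \<Sum>V\<in>?A. exp ((\<Sum>e\<in>vertex_pairs n. a V e * w e) + b V))"
      by (intro Bochner_Integration.integrable_sum integrable.intros[OF has_integral_exp_linear])
    show "AE w in ?P. exp (energy H n \<beta> w) \<le> (\<Sum>V\<in>?A. exp ((\<Sum>e\<in>vertex_pairs n. a V e * w e) + b V))"
      using AE_weights_in_unit
    proof eventually_elim
      fix w :: "nat \<times> nat \<Rightarrow> real" assume w: "\<forall>e\<in>vertex_pairs n. w e \<in> {0..1}"
      have ew: "edge_weight n w i j \<in> {0..1}" for i j using edge_weight_range w by blast
      obtain V where V: "V \<in> ?A" and le: "(real n)\<^sup>2 * hom_density H n w
         \<le> (\<Sum>i\<in>{1..n}. \<Sum>j\<in>{1..n}. real p * V i j ^ (p - 1) * edge_weight n w i j - (real p - 1) * V i j ^ p) + 2 * real p * \<epsilon> * (real n)\<^sup>2"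
        using hom_sum_le_linear[where w = "edge_weight n w", OF H p n \<epsilon> l ew] unfolding hom_density_eq[OF n H] by blast
      have lin: "(\<Sum>i\<in>{1..n}. \<Sum>j\<in>{1..n}. real p * V i j ^ (p - 1) * edge_weight n w i j)
        = real p * (\<Sum>e\<in>vertex_pairs n. (V (fst e) (snd e) ^ (p - 1) + V (snd e) (fst e) ^ (p - 1)) * w e)"
        by (subst sum_offdiag) (auto simp: edge_weight_simps sum_distrib_left algebra_simps intro!: sum.cong)
      have "snd \<beta> * ((real n)\<^sup>2 * hom_density H n w) \<le> snd \<beta> * ((\<Sum>i\<in>{1..n}. \<Sum>j\<in>{1..n}. real p * V i j ^ (p - 1) * edge_weight n w i j)
         - (real p - 1) * (\<Sum>i\<in>{1..n}. \<Sum>j\<in>{1..n}. V i j ^ p) + 2 * real p * \<epsilon> * (real n)\<^sup>2)"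
        using le by (intro mult_left_mono[OF _ b2]) (simp add: sum_subtractf sum_distrib_left)
      then have "energy H n \<beta> w \<le> 2 * fst \<beta> * (\<Sum>e\<in>vertex_pairs n. w e) + snd \<beta> * (real p * (\<Sum>e\<in>vertex_pairs n. (V (fst e) (snd e) ^ (p - 1) + V (snd e) (fst e) ^ (p - 1)) * w e)) + b V"
        unfolding energy_eq[OF n] lin b_def by (simp add: algebra_simps)
      also have "\<dots> = (\<Sum>e\<in>vertex_pairs n. a V e * w e) + b V"
        unfolding sum_distrib_left sum.distrib[symmetric]
        by (intro arg_cong2[where f = "(+)"] sum.cong refl) (simp add: a_def algebra_simps)
      finally have "exp (energy H n \<beta> w) \<le> exp ((\<Sum>e\<in>vertex_pairs n. a V e * w e) + b V)" by simp
      also have "\<dots> \<le> (\<Sum>V\<in>?A. exp ((\<Sum>e\<in>vertex_pairs n. a V e * w e) + b V))"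
        by (rule member_le_sum[OF V]) (auto simp: approximants_finite)
      finally show "exp (energy H n \<beta> w) \<le> (\<Sum>V\<in>?A. exp ((\<Sum>e\<in>vertex_pairs n. a V e * w e) + b V))" .
    qed
  qed
  also have "\<dots> = (\<Sum>V\<in>?A. exp ((\<Sum>e\<in>vertex_pairs n. cgf \<mu> (a V e)) + b V))"
    by (intro has_bochner_integral_integral_eq has_bochner_integral_sum has_integral_exp_linear)
  also have "\<dots> \<le> (\<Sum>V\<in>?A. exp B)" using bound by (intro sum_mono) simp
  also have "\<dots> = real (card ?A) * exp B" by simp
  also have "\<dots> \<le> exp (real l * (real n * ln 8)) * exp B"
  proof (rule mult_right_mono)
    have "real (card ?A) \<le> real ((4 ^ n + 2) ^ l)" by (rule of_nat_mono[OF approximants_card])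
    also have "\<dots> = (4 ^ n + 2) ^ l" by (simp add: add.commute)
    also have "\<dots> \<le> (8 ^ n) ^ l"
    proof (rule power_mono)
      obtain m where m: "n = Suc m" using n by (cases n) auto
      have "(1::real) \<le> 4 ^ m" "(4::real) ^ m \<le> 8 ^ m" by (auto intro: power_mono)
      then show "(4::real) ^ n + 2 \<le> 8 ^ n" unfolding m power_Suc by linarith
    qed simp
    also have "\<dots> = exp (real l * (real n * ln 8))" by (simp add: exp_of_nat_mult)
    finally show "real (card ?A) \<le> exp (real l * (real n * ln 8))" .
  qed simp
  also have "\<dots> = exp (real l * (real n * ln 8) + B)" by (simp add: exp_add)
  finally have Z: "(\<integral>w. exp (energy H n \<beta> w) \<partial>?P) \<le> exp (real l * (real n * ln 8) + B)" .
  interpret P: prob_space ?P by (rule prob_space_weights)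
  have "0 < (\<integral>w. exp (energy H n \<beta> w) \<partial>?P)"
  proof -
    have "(\<integral>w. exp (energy H n \<beta> w) \<partial>?P) \<noteq> 0"
      using integral_nonneg_eq_0_iff_AE[OF integrable_energy[OF n H, of \<beta>]] P.AE_False by simp
    moreover have "0 \<le> (\<integral>w. exp (energy H n \<beta> w) \<partial>?P)" by (rule integral_nonneg_AE) simp
    ultimately show ?thesis by linarith
  qed
  then have "ln (\<integral>w. exp (energy H n \<beta> w) \<partial>?P) \<le> real l * (real n * ln 8) + B"
    using ln_mono[OF Z] by simp
  then have "psi_n \<mu> single_edge H n \<beta> \<le> (real l * (real n * ln 8) + B) / (real n)\<^sup>2"
    unfolding psi_n_eq by (rule divide_right_mono) simp
  also have "\<dots> = real l * (real n * ln 8) / (real n)\<^sup>2 + real n * (real n - 1) / (real n)\<^sup>2 * \<Phi> + 2 * real p * \<epsilon> * snd \<beta>"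
    using n by (simp add: B_def field_simps)
  finally show ?thesis .
qed

theorem psi_n_tendsto:
  assumes H: "simple_graph H" and p: "card (snd H) = p" "2 \<le> p" and b2: "0 \<le> snd \<beta>"
    and dual: "\<And>v. v \<in> {0..1} \<Longrightarrow> cgf \<mu> (2 * (fst \<beta> + real p * snd \<beta> * v ^ (p - 1))) / 2 - snd \<beta> * (real p - 1) * v ^ p \<le> \<Phi>"
    and mid: "\<And>a b. cgf \<mu> (a + b) \<le> cgf \<mu> (2 * a) / 2 + cgf \<mu> (2 * b) / 2"
    and attained: "\<Phi> = fst \<beta> * K1 \<theta> + snd \<beta> * K1 \<theta> ^ p - (\<theta> * K1 \<theta> - cgf \<mu> \<theta>) / 2"
  shows "(\<lambda>n. psi_n \<mu> single_edge H n \<beta>) \<longlonglongrightarrow> \<Phi>"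
proof (rule order_tendstoI)
  have half: "(\<lambda>n. real (card (vertex_pairs n)) / (real n)\<^sup>2) \<longlonglongrightarrow> 1 / 2"
  proof -
    have "(\<lambda>n. (real n * (real n - 1) / 2) / (real n)\<^sup>2) \<longlonglongrightarrow> 1 / 2" by real_asymp
    moreover have "real n * (real n - 1) / 2 = real (card (vertex_pairs n))" for n using card_vertex_pairs[of n] by simp
    ultimately show ?thesis by simp
  qed
  fix a assume a: "a < \<Phi>"
  have "(\<lambda>n. ((2 * fst \<beta> - \<theta>) * K1 \<theta> + cgf \<mu> \<theta>) * (real (card (vertex_pairs n)) / (real n)\<^sup>2)
      + snd \<beta> * (real (card (injections (fst H) n)) / real n ^ fst H) * K1 \<theta> ^ p)
    \<longlonglongrightarrow> ((2 * fst \<beta> - \<theta>) * K1 \<theta> + cgf \<mu> \<theta>) * (1 / 2) + snd \<beta> * 1 * K1 \<theta> ^ p"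
    by (intro tendsto_intros half injections_density)
  also have "((2 * fst \<beta> - \<theta>) * K1 \<theta> + cgf \<mu> \<theta>) * (1 / 2) + snd \<beta> * 1 * K1 \<theta> ^ p = \<Phi>"
    unfolding attained by (simp add: field_simps)
  finally have "eventually (\<lambda>n. a < ((2 * fst \<beta> - \<theta>) * K1 \<theta> + cgf \<mu> \<theta>) * (real (card (vertex_pairs n)) / (real n)\<^sup>2)
      + snd \<beta> * (real (card (injections (fst H) n)) / real n ^ fst H) * K1 \<theta> ^ p) sequentially"
    using a by (rule order_tendstoD)
  with eventually_gt_at_top[of 0] show "eventually (\<lambda>n. a < psi_n \<mu> single_edge H n \<beta>) sequentially"
  proof eventually_elim
    fix n :: nat assume n: "0 < n" and *: "a < ((2 * fst \<beta> - \<theta>) * K1 \<theta> + cgf \<mu> \<theta>) * (real (card (vertex_pairs n)) / (real n)\<^sup>2)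
      + snd \<beta> * (real (card (injections (fst H) n)) / real n ^ fst H) * K1 \<theta> ^ p"
    show "a < psi_n \<mu> single_edge H n \<beta>"
    proof -
      let ?N = "real (card (vertex_pairs n))"
      have eq: "((2 * fst \<beta> - \<theta>) * ?N * K1 \<theta> + ?N * cgf \<mu> \<theta>) / (real n)\<^sup>2 = ((2 * fst \<beta> - \<theta>) * K1 \<theta> + cgf \<mu> \<theta>) * (?N / (real n)\<^sup>2)"
        using n by (simp add: field_simps)
      show ?thesis by (rule less_le_trans[OF * psi_n_lower[OF n H b2, of \<theta>, unfolded eq p(1)]])
    qed
  qed
next
  fix a assume a: "\<Phi> < a"
  \<comment> \<open>small enough that the approximation error \<open>2 p \<epsilon> \<beta>\<^sub>2\<close> stays below the gap \<open>a - \<Phi>\<close>\<close>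
  define \<epsilon> where "\<epsilon> = min 1 ((a - \<Phi>) / (4 * real p * (snd \<beta> + 1)))"
  have den: "0 < 4 * real p * (snd \<beta> + 1)" using p b2 by simp
  have \<epsilon>: "0 < \<epsilon>" "\<epsilon> \<le> 1" using a den by (auto simp: \<epsilon>_def)
  have "\<epsilon> * (4 * real p * (snd \<beta> + 1)) \<le> a - \<Phi>"
    using den by (simp add: \<epsilon>_def pos_le_divide_eq[symmetric])
  moreover have "4 * real p * \<epsilon> * snd \<beta> \<le> \<epsilon> * (4 * real p * (snd \<beta> + 1))"
    using \<epsilon> p by (simp add: algebra_simps)
  moreover have "0 \<le> 2 * real p * \<epsilon> * snd \<beta>" using \<epsilon> b2 by simp
  ultimately have small: "\<Phi> + 2 * real p * \<epsilon> * snd \<beta> < a" using a by linarith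
  obtain l :: nat where "1 / \<epsilon>\<^sup>2 < real l" using reals_Archimedean2 by blast
  then have l: "1 < real l * \<epsilon>\<^sup>2" using \<epsilon> by (simp add: field_simps)
  have "(\<lambda>n. real l * (real n * ln 8) / (real n)\<^sup>2) \<longlonglongrightarrow> 0" by real_asymp
  moreover have "(\<lambda>n. real n * (real n - 1) / (real n)\<^sup>2) \<longlonglongrightarrow> 1" by real_asymp
  ultimately have "(\<lambda>n. real l * (real n * ln 8) / (real n)\<^sup>2 + real n * (real n - 1) / (real n)\<^sup>2 * \<Phi> + 2 * real p * \<epsilon> * snd \<beta>)
     \<longlonglongrightarrow> 0 + 1 * \<Phi> + 2 * real p * \<epsilon> * snd \<beta>" by (intro tendsto_intros)
  then have "eventually (\<lambda>n. real l * (real n * ln 8) / (real n)\<^sup>2 + real n * (real n - 1) / (real n)\<^sup>2 * \<Phi> + 2 * real p * \<epsilon> * snd \<beta> < a) sequentially"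
    using small by (intro order_tendstoD) auto
  with eventually_gt_at_top[of 0] show "eventually (\<lambda>n. psi_n \<mu> single_edge H n \<beta> < a) sequentially"
    by eventually_elim (use psi_n_upper[OF _ H p b2 \<epsilon> l dual mid] in \<open>meson le_less_trans\<close>)
qed

end

section \<open>Maximizers of the variational problem and the phase curve\<close>

text \<open>
  What the analysis of the variational problem uses of \<open>K = cgf \<mu>\<close>: the functions \<open>K1\<close>, \<open>K2\<close>, \<open>K3\<close> are its
  derivatives and \<open>\<theta>0\<close> is the solution of the equation in the hypothesis of the theorem.
\<close>

locale mean_field =
  fixes K K1 K2 K3 :: "real \<Rightarrow> real" and p :: nat and \<theta>0 :: real
  assumes p2: "2 \<le> p"
    and K_deriv: "\<And>\<theta>. (K has_real_derivative K1 \<theta>) (at \<theta>)"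
    and K1_deriv: "\<And>\<theta>. (K1 has_real_derivative K2 \<theta>) (at \<theta>)"
    and K2_deriv: "\<And>\<theta>. (K2 has_real_derivative K3 \<theta>) (at \<theta>)"
    and K3_cont: "continuous_on UNIV K3"
    and K_0: "K 0 = 0"
    and K1_pos: "\<And>\<theta>. 0 < K1 \<theta>"
    and K1_le: "\<And>\<theta>. K1 \<theta> \<le> 1"
    and K2_pos: "\<And>\<theta>. 0 < K2 \<theta>"
    and crit: "\<And>\<theta>. K3 \<theta> * K1 \<theta> = - (real p - 2) * (K2 \<theta>)\<^sup>2 \<longleftrightarrow> \<theta> = \<theta>0"
begin

text \<open>
  The maximand \<open>L \<beta>\<close> has derivative \<open>K2 \<theta> * slope \<beta> \<theta>\<close>; \<open>slope'\<close> is the derivative of the slope, which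
  depends on \<open>\<beta>\<close> only through \<open>\<beta>\<^sub>2\<close>; and \<open>rate \<theta>\<close> is the Legendre transform of \<open>K\<close> at the density \<open>K1 \<theta>\<close>.
\<close>

definition gain :: "real \<Rightarrow> real" where
  "gain \<theta> = K1 \<theta> ^ (p - 2) * K2 \<theta>"

definition slope :: "real \<times> real \<Rightarrow> real \<Rightarrow> real" where
  "slope \<beta> \<theta> = fst \<beta> + real p * snd \<beta> * K1 \<theta> ^ (p - 1) - \<theta> / 2"

definition slope' :: "real \<Rightarrow> real \<Rightarrow> real" where
  "slope' b2 \<theta> = real p * (real p - 1) * b2 * gain \<theta> - 1 / 2"

definition rate :: "real \<Rightarrow> real" where
  "rate \<theta> = \<theta> * K1 \<theta> - K \<theta>"

definition L :: "real \<times> real \<Rightarrow> real \<Rightarrow> real" where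
  "L \<beta> \<theta> = fst \<beta> * K1 \<theta> + snd \<beta> * K1 \<theta> ^ p - rate \<theta> / 2"

definition maximizers :: "real \<times> real \<Rightarrow> real set" where
  "maximizers \<beta> = {t. \<forall>\<theta>. L \<beta> \<theta> \<le> L \<beta> t}"

definition \<Psi> :: "real \<times> real \<Rightarrow> real" where
  "\<Psi> \<beta> = (SUP \<theta>. L \<beta> \<theta>)"

text \<open>
  The end of the curve: the parameters at which slope and \<open>slope'\<close> vanish together at \<open>\<theta>0\<close>.
\<close>

definition b2c :: real where "b2c = 1 / (2 * real p * (real p - 1) * gain \<theta>0)"
definition b1c :: real where "b1c = \<theta>0 / 2 - real p * b2c * K1 \<theta>0 ^ (p - 1)"

lemma K1_mono_strict: "a < b \<Longrightarrow> K1 a < K1 b"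
  by (rule DERIV_pos_imp_increasing, assumption) (rule exI, rule conjI, rule K1_deriv, rule K2_pos)

lemma K1_less_iff [simp]: "K1 a < K1 b \<longleftrightarrow> a < b" and K1_le_iff [simp]: "K1 a \<le> K1 b \<longleftrightarrow> a \<le> b"
  and K1_eq_iff [simp]: "K1 a = K1 b \<longleftrightarrow> a = b"
  using K1_mono_strict[of a b] K1_mono_strict[of b a] by (cases a b rule: linorder_cases; simp)+

lemma cont_K [continuous_intros]: "continuous_on A f \<Longrightarrow> continuous_on A (\<lambda>x. K (f x))"
  using continuous_on_compose2[OF continuous_at_imp_continuous_on[OF ballI[OF DERIV_isCont[OF K_deriv]]], of A f UNIV] by simp
lemma cont_K1 [continuous_intros]: "continuous_on A f \<Longrightarrow> continuous_on A (\<lambda>x. K1 (f x))"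
  using continuous_on_compose2[OF continuous_at_imp_continuous_on[OF ballI[OF DERIV_isCont[OF K1_deriv]]], of A f UNIV] by simp
lemma cont_K2 [continuous_intros]: "continuous_on A f \<Longrightarrow> continuous_on A (\<lambda>x. K2 (f x))"
  using continuous_on_compose2[OF continuous_at_imp_continuous_on[OF ballI[OF DERIV_isCont[OF K2_deriv]]], of A f UNIV] by simp

lemma gain_pos: "0 < gain \<theta>"
  by (simp add: gain_def K1_pos K2_pos)

lemma cont_gain [continuous_intros]: "continuous_on A f \<Longrightarrow> continuous_on A (\<lambda>x. gain (f x))"
  unfolding gain_def by (intro continuous_intros)

lemma power_deriv: "((\<lambda>\<theta>. K1 \<theta> ^ (p - 1)) has_real_derivative (real p - 1) * gain \<theta>) (at \<theta>)"
proof -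
  have "p - Suc (Suc 0) = p - 2" "real (p - Suc 0) = real p - 1" using p2 by auto
  then show ?thesis
    by (auto intro!: derivative_eq_intros K1_deriv simp: gain_def mult_ac)
qed

text \<open>
  Up to a positive factor, the derivative of \<open>gain\<close>.
\<close>

definition crit_fun :: "real \<Rightarrow> real" where
  "crit_fun \<theta> = K3 \<theta> * K1 \<theta> + (real p - 2) * (K2 \<theta>)\<^sup>2"

lemma gain_deriv: "(gain has_real_derivative K1 \<theta> ^ (p - 2) / K1 \<theta> * crit_fun \<theta>) (at \<theta>)"
proof -
  have *: "real (p - 2) * K1 \<theta> ^ (p - 3) = (real p - 2) * K1 \<theta> ^ (p - 2) / K1 \<theta>"
  proof (cases "p = 2")
    case False
    then have "p - 2 = Suc (p - 3)" using p2 by auto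
    then show ?thesis using K1_pos[of \<theta>] p2 by (simp add: of_nat_diff)
  qed simp
  have "(gain has_real_derivative real (p - 2) * K1 \<theta> ^ (p - 3) * K2 \<theta> * K2 \<theta> + K1 \<theta> ^ (p - 2) * K3 \<theta>) (at \<theta>)"
    unfolding gain_def 
    by (auto intro!: derivative_eq_intros K1_deriv K2_deriv simp: numeral_3_eq_3 numeral_2_eq_2)
  also have "real (p - 2) * K1 \<theta> ^ (p - 3) * K2 \<theta> * K2 \<theta> + K1 \<theta> ^ (p - 2) * K3 \<theta> = K1 \<theta> ^ (p - 2) / K1 \<theta> * crit_fun \<theta>"
    unfolding * crit_fun_def using K1_pos[of \<theta>] by (simp add: field_simps power2_eq_square)
  finally show ?thesis .
qed

lemma crit_fun_zero: "crit_fun \<theta> = 0 \<longleftrightarrow> \<theta> = \<theta>0"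
proof -
  have "crit_fun \<theta> = 0 \<longleftrightarrow> K3 \<theta> * K1 \<theta> = - ((real p - 2) * (K2 \<theta>)\<^sup>2)"
    unfolding crit_fun_def by linarith
  then show ?thesis using crit[of \<theta>] by (simp only: minus_mult_left)
qed

lemma cont_crit: "continuous_on A crit_fun"
  unfolding crit_fun_def by (intro continuous_intros continuous_on_subset[OF K3_cont]) auto

lemma crit_sign_const:
  assumes "a < b" "\<theta>0 \<notin> {a..b}" "crit_fun a < 0 \<or> crit_fun b < 0" shows "crit_fun a < 0 \<and> crit_fun b < 0"
proof (rule ccontr)
  assume "\<not> (crit_fun a < 0 \<and> crit_fun b < 0)"
  then consider "crit_fun a \<le> 0" "0 \<le> crit_fun b" | "crit_fun b \<le> 0" "0 \<le> crit_fun a" using assms(3) by linarith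
  then have "\<exists>x. a \<le> x \<and> x \<le> b \<and> crit_fun x = 0"
    using IVT'[of crit_fun a 0 b] IVT2'[of crit_fun b 0 a] assms(1) cont_crit by cases auto
  then show False using crit_fun_zero assms(2) by auto
qed

lemma gain_le_bound:
  assumes "0 < R" "\<And>\<theta>. a \<le> \<theta> \<Longrightarrow> \<theta> \<le> a + R \<Longrightarrow> c \<le> gain \<theta>" shows "(real p - 1) * c * R \<le> 1"
proof -
  obtain z where z: "a < z" "z < a + R" "K1 (a + R) ^ (p - 1) - K1 a ^ (p - 1) = (a + R - a) * ((real p - 1) * gain z)"
    using MVT2[of a "a + R" "\<lambda>\<theta>. K1 \<theta> ^ (p - 1)" "\<lambda>\<theta>. (real p - 1) * gain \<theta>"] power_deriv assms(1) by auto
  have "K1 (a + R) ^ (p - 1) \<le> 1" using K1_le K1_pos by (simp add: power_le_one less_imp_le)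
  moreover have "0 \<le> K1 a ^ (p - 1)" using K1_pos by (simp add: less_imp_le)
  ultimately have "R * ((real p - 1) * gain z) \<le> 1" using z(3) by simp
  moreover have "(real p - 1) * c * R \<le> R * ((real p - 1) * gain z)"
    using assms z p2 by (auto intro!: mult_left_mono)
  ultimately show ?thesis by linarith
qed

text \<open>
  \<open>(p - 1) * gain\<close> has the primitive \<open>K1 ^ (p - 1)\<close> with values in \<open>[0,1]\<close>, so \<open>gain\<close> cannot stay above a
  positive constant on long intervals.
\<close>

lemma not_gain_ge:
  assumes "c > 0" shows "\<exists>R>0. \<forall>a. \<exists>\<theta>. a \<le> \<theta> \<and> \<theta> \<le> a + R \<and> gain \<theta> < c"
proof -
  define R where "R = 2 / ((real p - 1) * c)"
  have R: "R > 0" using assms p2 by (simp add: R_def)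
  have "(real p - 1) * c * R = 2" using assms p2 by (simp add: R_def)
  then have "\<exists>\<theta>. a \<le> \<theta> \<and> \<theta> \<le> a + R \<and> gain \<theta> < c" for a
    using gain_le_bound[OF R, of a c] by (smt (verit))
  then show ?thesis using R by blast
qed

text \<open>
  Otherwise \<open>gain\<close> would be decreasing on the whole half-line below \<open>\<theta>0\<close> and stay above \<open>gain \<theta>0\<close> there.
\<close>

lemma crit_fun_left: "\<theta> < \<theta>0 \<Longrightarrow> 0 < crit_fun \<theta>"
proof (rule ccontr)
  assume t: "\<theta> < \<theta>0" and "\<not> 0 < crit_fun \<theta>"
  then have neg: "crit_fun \<theta> < 0" using crit_fun_zero[of \<theta>] by auto
  have neg': "crit_fun s < 0" if "s < \<theta>0" for s
    using crit_sign_const[of s \<theta>] crit_sign_const[of \<theta> s] neg that t by (cases s \<theta> rule: linorder_cases) auto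
  have ge: "gain \<theta>0 \<le> gain s" if "s \<le> \<theta>0" for s
  proof (rule DERIV_nonpos_imp_nonincreasing[OF that])
    fix x assume "s \<le> x" "x \<le> \<theta>0"
    then have "crit_fun x \<le> 0" using neg'[of x] crit_fun_zero[of x] by (cases "x = \<theta>0") auto
    with K1_pos[of x] show "\<exists>y. (gain has_real_derivative y) (at x) \<and> y \<le> 0"
      by - (rule exI, rule conjI, rule gain_deriv, (simp add: mult_nonneg_nonpos divide_nonpos_pos))
  qed
  \<comment> \<open>an interval of length \<open>R\<close> ending at \<open>\<theta>0\<close> contradicts monotonicity\<close>
  obtain R where "R > 0" "\<forall>a. \<exists>\<theta>. a \<le> \<theta> \<and> \<theta> \<le> a + R \<and> gain \<theta> < gain \<theta>0"
    using not_gain_ge[OF gain_pos] by blast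
  then obtain s where "s \<le> \<theta>0 - R + R" "gain s < gain \<theta>0" by metis
  then show False using ge[of s] by auto
qed

lemma crit_fun_right: "\<theta>0 < \<theta> \<Longrightarrow> crit_fun \<theta> < 0"
proof (rule ccontr)
  assume t: "\<theta>0 < \<theta>" and "\<not> crit_fun \<theta> < 0"
  then have neg: "0 < crit_fun \<theta>" using crit_fun_zero[of \<theta>] by auto
  have neg': "0 < crit_fun s" if "\<theta>0 < s" for s
    using crit_sign_const[of s \<theta>] crit_sign_const[of \<theta> s] neg that t crit_fun_zero[of s]
    by (smt (verit) atLeastAtMost_iff)
  have ge: "gain \<theta>0 \<le> gain s" if "\<theta>0 \<le> s" for s
  proof (rule DERIV_nonneg_imp_nondecreasing[OF that])
    fix x assume "x \<le> s" "\<theta>0 \<le> x"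
    then have "0 \<le> crit_fun x" using neg'[of x] crit_fun_zero[of x] by (cases "x = \<theta>0") auto
    with K1_pos[of x] show "\<exists>y. (gain has_real_derivative y) (at x) \<and> 0 \<le> y"
      by - (rule exI, rule conjI, rule gain_deriv, simp)
  qed
  obtain R where "R > 0" "\<forall>a. \<exists>\<theta>. a \<le> \<theta> \<and> \<theta> \<le> a + R \<and> gain \<theta> < gain \<theta>0"
    using not_gain_ge[OF gain_pos] by blast
  then obtain s where "\<theta>0 \<le> s" "gain s < gain \<theta>0" by metis
  then show False using ge[of s] by auto
qed

lemma gain_increasing:
  assumes "a < b" "b \<le> \<theta>0" shows "gain a < gain b"
proof (rule DERIV_pos_imp_increasing_open[OF assms(1)])
  fix x assume "a < x" "x < b"
  then have "0 < crit_fun x" using crit_fun_left[of x] assms by auto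
  with K1_pos[of x] show "\<exists>y. (gain has_real_derivative y) (at x) \<and> 0 < y"
      by - (rule exI, rule conjI, rule gain_deriv, simp)
qed (intro continuous_intros)

lemma gain_decreasing:
  assumes "a < b" "\<theta>0 \<le> a" shows "gain b < gain a"
proof (rule DERIV_neg_imp_decreasing_open[OF assms(1)])
  fix x assume "a < x" "x < b"
  then have "crit_fun x < 0" using crit_fun_right[of x] assms by auto
  with K1_pos[of x] show "\<exists>y. (gain has_real_derivative y) (at x) \<and> y < 0"
      by - (rule exI, rule conjI, rule gain_deriv, (simp add: mult_pos_neg divide_neg_pos))
qed (intro continuous_intros)

lemma gain_peak: "\<theta> \<noteq> \<theta>0 \<Longrightarrow> gain \<theta> < gain \<theta>0"
  using gain_increasing[of \<theta> \<theta>0] gain_decreasing[of \<theta>0 \<theta>] by (cases \<theta> \<theta>0 rule: linorder_cases) auto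

lemma K1_pow_bounds: "0 < K1 \<theta> ^ k" "K1 \<theta> ^ k \<le> 1"
  using K1_pos[of \<theta>] K1_le[of \<theta>] by (auto simp: power_le_one)

lemma L_deriv: "(L \<beta> has_real_derivative K2 \<theta> * slope \<beta> \<theta>) (at \<theta>)"
  unfolding L_def rate_def
  by (auto intro!: derivative_eq_intros K_deriv K1_deriv simp: slope_def field_simps)

lemma slope_deriv: "(slope \<beta> has_real_derivative slope' (snd \<beta>) \<theta>) (at \<theta>)"
proof -
  have "(slope \<beta> has_real_derivative 0 + real p * snd \<beta> * ((real p - 1) * gain \<theta>) - 1 / 2) (at \<theta>)"
    unfolding slope_def
    by (intro DERIV_add DERIV_diff DERIV_cmult power_deriv DERIV_cdivide DERIV_const DERIV_ident)
  then show ?thesis by (simp add: slope'_def mult_ac)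
qed

lemma cont_L [continuous_intros]:
  "continuous_on A f \<Longrightarrow> continuous_on A g \<Longrightarrow> continuous_on A (\<lambda>x. L (f x) (g x))"
  unfolding L_def rate_def by (intro continuous_intros) auto

lemma cont_slope' [continuous_intros]:
  "continuous_on A f \<Longrightarrow> continuous_on A g \<Longrightarrow> continuous_on A (\<lambda>x. slope' (f x) (g x))"
  unfolding slope'_def by (intro continuous_intros)

lemma slope_bound: "\<bar>slope \<beta> \<theta> + \<theta> / 2\<bar> \<le> \<bar>fst \<beta>\<bar> + real p * \<bar>snd \<beta>\<bar>"
proof -
  have "\<bar>real p * snd \<beta> * K1 \<theta> ^ (p - 1)\<bar> \<le> real p * \<bar>snd \<beta>\<bar> * 1"
    unfolding abs_mult using K1_pow_bounds[of \<theta> "p - 1"] by (intro mult_mono) auto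
  then show ?thesis unfolding slope_def by linarith
qed

lemma maximizer_slope:
  assumes "t \<in> maximizers \<beta>" shows "slope \<beta> t = 0"
proof -
  have "K2 t * slope \<beta> t = 0"
    by (rule DERIV_local_max[OF L_deriv, of 1]) (use assms in \<open>auto simp: maximizers_def\<close>)
  then show ?thesis using K2_pos[of t] by simp
qed

lemma maximizers_bounded:
  assumes "t \<in> maximizers \<beta>" shows "\<bar>t\<bar> \<le> 2 * (\<bar>fst \<beta>\<bar> + real p * \<bar>snd \<beta>\<bar>)"
  using slope_bound[of \<beta> t] maximizer_slope[OF assms] by simp

lemma maximizers_nonempty: "maximizers \<beta> \<noteq> {}"
proof -
  define R where "R = 2 * (\<bar>fst \<beta>\<bar> + real p * \<bar>snd \<beta>\<bar>)"
  have R0: "0 \<le> R" by (simp add: R_def)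
  have "\<exists>t\<in>{-R..R}. \<forall>\<theta>\<in>{-R..R}. L \<beta> \<theta> \<le> L \<beta> t"
    by (rule continuous_attains_sup) (use R0 in \<open>auto intro!: continuous_intros\<close>)
  then obtain t where t: "t \<in> {-R..R}" "\<And>\<theta>. \<theta> \<in> {-R..R} \<Longrightarrow> L \<beta> \<theta> \<le> L \<beta> t" by blast
  have right: "L \<beta> \<theta> \<le> L \<beta> R" if "R \<le> \<theta>" for \<theta>
  proof (rule DERIV_nonpos_imp_nonincreasing[OF that])
    fix x assume "R \<le> x"
    then have "slope \<beta> x \<le> 0" using slope_bound[of \<beta> x] by (auto simp: R_def)
    then show "\<exists>y. (L \<beta> has_real_derivative y) (at x) \<and> y \<le> 0"
      using K2_pos[of x] by - (rule exI, rule conjI, rule L_deriv, simp add: mult_nonneg_nonpos)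
  qed
  have left: "L \<beta> \<theta> \<le> L \<beta> (-R)" if "\<theta> \<le> -R" for \<theta>
  proof (rule DERIV_nonneg_imp_nondecreasing[OF that])
    fix x assume "x \<le> -R"
    then have "0 \<le> slope \<beta> x" using slope_bound[of \<beta> x] by (auto simp: R_def)
    then show "\<exists>y. (L \<beta> has_real_derivative y) (at x) \<and> 0 \<le> y"
      using K2_pos[of x] by - (rule exI, rule conjI, rule L_deriv, simp)
  qed
  have "L \<beta> \<theta> \<le> L \<beta> t" for \<theta>
    using left[of \<theta>] right[of \<theta>] t(2)[of \<theta>] t(2)[of R] t(2)[of "-R"] R0
    by (cases "\<theta> < -R"; cases "R < \<theta>"; force)
  then show ?thesis by (auto simp: maximizers_def)
qed

lemma Psi_eq: "t \<in> maximizers \<beta> \<Longrightarrow> \<Psi> \<beta> = L \<beta> t"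
  unfolding \<Psi>_def maximizers_def by (rule cSup_eq_maximum) auto

lemma L_le_Psi: "L \<beta> \<theta> \<le> \<Psi> \<beta>"
proof -
  obtain t where "t \<in> maximizers \<beta>" using maximizers_nonempty by blast
  then show ?thesis using Psi_eq by (auto simp: maximizers_def)
qed

lemma maximizers_subseq:
  assumes X: "X \<longlonglongrightarrow> \<beta>" and t: "\<And>n. t n \<in> maximizers (X n)"
  shows "\<exists>r l. strict_mono (r :: nat \<Rightarrow> nat) \<and> (t \<circ> r) \<longlonglongrightarrow> l \<and> l \<in> maximizers \<beta>"
proof -
  have "bounded (range X)" using X convergent_imp_bounded convergentI by metis
  then obtain B where B: "\<And>n. norm (X n) \<le> B" by (auto simp: bounded_iff)
  have "\<bar>t n\<bar> \<le> 2 * (B + real p * B)" for n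
  proof -
    have "\<bar>fst (X n)\<bar> \<le> B" "\<bar>snd (X n)\<bar> \<le> B"
      using norm_fst_le[of "fst (X n)" "snd (X n)"] norm_snd_le[of "snd (X n)" "fst (X n)"] B[of n] by auto
    moreover from this have "real p * \<bar>snd (X n)\<bar> \<le> real p * B" by (intro mult_left_mono) auto
    ultimately show ?thesis using maximizers_bounded[OF t[of n]] by (smt (verit))
  qed
  then have "bounded (range t)" by (auto simp: bounded_iff intro!: exI[of _ "2 * (B + real p * B)"])
  then obtain r l where r: "strict_mono (r :: nat \<Rightarrow> nat)" "(t \<circ> r) \<longlonglongrightarrow> l"
    using bounded_imp_convergent_subsequence[of t] by auto
  have Xr: "(X \<circ> r) \<longlonglongrightarrow> \<beta>" by (rule LIMSEQ_subseq_LIMSEQ[OF X r(1)])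
  have cL: "continuous_on UNIV (\<lambda>z. L (fst z) (snd z))" by (intro continuous_intros)
  have lim: "(\<lambda>n. L ((X \<circ> r) n) (f n)) \<longlonglongrightarrow> L \<beta> c" if "f \<longlonglongrightarrow> c" for f c
    using continuous_on_tendsto_compose[OF cL tendsto_Pair[OF Xr that]] by (simp add: o_def)
  have "L \<beta> \<theta> \<le> L \<beta> l" for \<theta>
    by (rule LIMSEQ_le[OF lim[OF tendsto_const] lim[OF r(2)]])
       (use t in \<open>auto simp: maximizers_def\<close>)
  then show ?thesis using r by (auto simp: maximizers_def)
qed

text \<open>
  The set of maximizers is bounded and has closed graph. So if the limit parameter has only one maximizer in a closed
  set \<open>S\<close>, any selection of maximizers in \<open>S\<close> converges to it. With \<open>S\<close> a half-line this gives one-sided limits at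
  the curve.
\<close>

lemma maximizers_tendsto:
  assumes X: "X \<longlonglongrightarrow> \<beta>" and t: "\<And>n. t n \<in> maximizers (X n)" and S: "\<And>n. t n \<in> S" "closed S"
    and s: "maximizers \<beta> \<inter> S \<subseteq> {s}"
  shows "t \<longlonglongrightarrow> s"
proof (rule ccontr)
  assume "\<not> t \<longlonglongrightarrow> s"
  then obtain e where e: "e > 0" "\<forall>N. \<exists>n\<ge>N. dist (t n) s \<ge> e"
    by (auto simp: lim_sequentially not_less)
  have inf: "infinite {n. dist (t n) s \<ge> e}"
    unfolding infinite_nat_iff_unbounded_le using e(2) by blast
  \<comment> \<open>a subsequence that stays at distance at least \<open>e\<close> from \<open>s\<close>\<close>
  define q where "q = enumerate {n. dist (t n) s \<ge> e}"
  have q: "strict_mono q" "\<And>n. dist (t (q n)) s \<ge> e"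
    using inf enumerate_in_set[OF inf] by (auto simp: q_def strict_mono_enumerate)
  obtain r l where r: "strict_mono (r :: nat \<Rightarrow> nat)" "((t \<circ> q) \<circ> r) \<longlonglongrightarrow> l" "l \<in> maximizers \<beta>"
    using maximizers_subseq[OF LIMSEQ_subseq_LIMSEQ[OF X q(1)], of "t \<circ> q"] t by auto
  have "l \<in> S" by (rule closed_sequentially[OF S(2) _ r(2)]) (use S in auto)
  then have "l = s" using s r(3) by auto
  then have "(\<lambda>n. dist (((t \<circ> q) \<circ> r) n) s) \<longlonglongrightarrow> 0"
    using r(2) tendsto_dist_iff by blast
  moreover have "\<forall>n. e \<le> dist (((t \<circ> q) \<circ> r) n) s" using q(2) by auto
  ultimately have "e \<le> 0" by (meson LIMSEQ_le_const)
  then show False using e(1) by simp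
qed

lemma not_maximizer_right:
  assumes "t < s" "\<And>x. t < x \<Longrightarrow> x < s \<Longrightarrow> 0 < slope \<beta> x" shows "t \<notin> maximizers \<beta>"
proof -
  have "L \<beta> t < L \<beta> s"
  proof (rule DERIV_pos_imp_increasing_open[OF assms(1)])
    fix x assume "t < x" "x < s"
    then show "\<exists>y. (L \<beta> has_real_derivative y) (at x) \<and> 0 < y"
      using assms(2) K2_pos[of x] by - (rule exI, rule conjI, rule L_deriv, simp)
  qed (intro continuous_intros)
  then show ?thesis by (auto simp: maximizers_def not_le)
qed

lemma not_maximizer_left:
  assumes "s < t" "\<And>x. s < x \<Longrightarrow> x < t \<Longrightarrow> slope \<beta> x < 0" shows "t \<notin> maximizers \<beta>"
proof -
  have "L \<beta> t < L \<beta> s"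
  proof (rule DERIV_neg_imp_decreasing_open[OF assms(1)])
    fix x assume "s < x" "x < t"
    then show "\<exists>y. (L \<beta> has_real_derivative y) (at x) \<and> y < 0"
      using assms(2)[of x] K2_pos[of x] by - (rule exI, rule conjI, rule L_deriv, simp add: mult_pos_neg)
  qed (intro continuous_intros)
  then show ?thesis by (auto simp: maximizers_def not_le)
qed

lemma cont_slope: "continuous_on A (slope \<beta>)"
  unfolding slope_def by (intro continuous_intros) auto

lemma slope_increasing:
  assumes "a < b" "\<And>x. a < x \<Longrightarrow> x < b \<Longrightarrow> 0 < slope' (snd \<beta>) x" shows "slope \<beta> a < slope \<beta> b"
  by (rule DERIV_pos_imp_increasing_open[OF assms(1)])
     (use assms(2) slope_deriv cont_slope in blast)+

lemma slope_decreasing: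
  assumes "a < b" "\<And>x. a < x \<Longrightarrow> x < b \<Longrightarrow> slope' (snd \<beta>) x < 0" shows "slope \<beta> b < slope \<beta> a"
  by (rule DERIV_neg_imp_decreasing_open[OF assms(1)])
     (use assms(2) slope_deriv cont_slope in blast)+

lemma maximizer_second_order:
  assumes "t \<in> maximizers \<beta>" shows "slope' (snd \<beta>) t \<le> 0"
proof (rule ccontr)
  assume "\<not> ?thesis"
  then obtain d where d: "d > 0" "\<And>h. 0 < h \<Longrightarrow> h < d \<Longrightarrow> slope \<beta> t < slope \<beta> (t + h)"
    using DERIV_pos_inc_right[OF slope_deriv, of \<beta> t] by auto
  have "0 < slope \<beta> x" if "t < x" "x < t + d" for x
    using d(2)[of "x - t"] that maximizer_slope[OF assms] by simp
  then show False using not_maximizer_right[of t "t + d" \<beta>] d(1) assms by auto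
qed

lemma slope'_mono:
  assumes "gain x < gain y" "0 \<le> slope' b2 x" shows "0 < b2" "0 < slope' b2 y"
proof -
  have pp: "0 < real p * (real p - 1)" using p2 by simp
  show b: "0 < b2"
  proof (rule ccontr)
    assume "\<not> 0 < b2"
    then have "real p * (real p - 1) * b2 * gain x \<le> 0" using pp gain_pos[of x]
      by (intro mult_nonpos_nonneg mult_nonneg_nonpos) auto
    then show False using assms(2) by (simp add: slope'_def)
  qed
  have "real p * (real p - 1) * b2 * gain x < real p * (real p - 1) * b2 * gain y"
    using pp b assms(1) by (intro mult_strict_left_mono) auto
  then show "0 < slope' b2 y" using assms(2) by (simp add: slope'_def)
qed

text \<open>
  Two zeros of the slope enclose a point where \<open>slope' \<ge> 0\<close>. If both lay on one side of \<open>\<theta>0\<close>, monotonicity of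
  \<open>gain\<close> there would make \<open>slope'\<close> positive at the zero nearer to \<open>\<theta>0\<close>, against the second-order condition.
\<close>

lemma maximizers_separated:
  assumes t: "t \<in> maximizers \<beta>" and s: "s \<in> maximizers \<beta>" and "t < s"
  shows "t < \<theta>0" "\<theta>0 < s"
proof -
  have ex: "\<exists>x. t < x \<and> x < s \<and> 0 \<le> slope' (snd \<beta>) x"
    using slope_decreasing[OF \<open>t < s\<close>, of \<beta>] maximizer_slope[OF t] maximizer_slope[OF s]
    by (force simp: not_le)
  then obtain x where x: "t < x" "x < s" "0 \<le> slope' (snd \<beta>) x" by blast
  show "\<theta>0 < s"
  proof (rule ccontr)
    assume "\<not> \<theta>0 < s"
    then have "0 < slope' (snd \<beta>) s" using slope'_mono[OF gain_increasing[OF x(2)] x(3)] by auto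
    then show False using maximizer_second_order[OF s] by simp
  qed
  show "t < \<theta>0"
  proof (rule ccontr)
    assume "\<not> t < \<theta>0"
    then have "0 < slope' (snd \<beta>) t" using slope'_mono[OF gain_decreasing[OF x(1)] x(3)] by auto
    then show False using maximizer_second_order[OF t] by simp
  qed
qed

lemma slope'_critical: "slope' b2 \<theta>0 = (b2 - b2c) * (real p * (real p - 1) * gain \<theta>0)"
  using p2 gain_pos[of \<theta>0] by (simp add: slope'_def b2c_def field_simps)

lemma pp_gain_pos: "0 < real p * (real p - 1) * gain \<theta>0"
  using p2 gain_pos[of \<theta>0] by simp

lemma b2c_pos: "0 < b2c"
  using p2 gain_pos[of \<theta>0] by (simp add: b2c_def)

lemma slope_critical: "slope (b1c, b2c) \<theta>0 = 0"
  by (simp add: slope_def b1c_def)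

text \<open>
  If \<open>slope'\<close> vanishes at a zero \<open>t \<noteq> \<theta>0\<close> of the slope, then \<open>slope'\<close> is positive from \<open>t\<close> towards \<open>\<theta>0\<close>, so
  that \<open>L \<beta>\<close> increases strictly when leaving \<open>t\<close> in that direction.
\<close>

lemma maximizer_degenerate:
  assumes t: "t \<in> maximizers \<beta>" and z: "slope' (snd \<beta>) t = 0"
  shows "\<beta> = (b1c, b2c)" "t = \<theta>0"
proof -
  show t0: "t = \<theta>0"
  proof (rule ccontr)
    assume "t \<noteq> \<theta>0"
    then consider "t < \<theta>0" | "\<theta>0 < t" by linarith
    then show False
    proof cases
      case 1
      have "0 < slope \<beta> x" if "t < x" "x < \<theta>0" for x
        using slope_increasing[of t x \<beta>] that slope'_mono(2)[OF gain_increasing, of t _ "snd \<beta>"] z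
          maximizer_slope[OF t] by auto
      then show False using not_maximizer_right[OF 1] t by blast
    next
      case 2
      have "slope \<beta> x < 0" if "x < t" "\<theta>0 < x" for x
        using slope_increasing[of x t \<beta>] that slope'_mono(2)[OF gain_decreasing, of _ t "snd \<beta>"] z
          maximizer_slope[OF t] by auto
      then show False using not_maximizer_left[OF 2] t by blast
    qed
  qed
  have b2: "snd \<beta> = b2c" using z p2 gain_pos[of \<theta>0] unfolding t0 slope'_critical by simp
  moreover have "fst \<beta> = b1c" using maximizer_slope[OF t] b2 unfolding t0 slope_def b1c_def by simp
  ultimately show "\<beta> = (b1c, b2c)" by (simp add: prod_eq_iff)
qed

lemma \<theta>0_maximizer:
  assumes "\<theta>0 \<in> maximizers \<beta>" "b2c \<le> snd \<beta>" shows "\<beta> = (b1c, b2c)"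
proof -
  have "0 \<le> slope' (snd \<beta>) \<theta>0" using assms(2) pp_gain_pos unfolding slope'_critical by (intro mult_nonneg_nonneg[OF _ less_imp_le]) auto
  then show ?thesis using maximizer_degenerate(1)[OF assms(1)] maximizer_second_order[OF assms(1)] by simp
qed

lemma slope'_subcritical:
  assumes "b2 \<le> b2c" "\<theta> \<noteq> \<theta>0" shows "slope' b2 \<theta> < 0"
proof (rule ccontr)
  assume "\<not> ?thesis"
  then have "0 < slope' b2 \<theta>0" using slope'_mono[OF gain_peak[OF assms(2)]] by auto
  moreover have "slope' b2 \<theta>0 \<le> 0" using assms(1) pp_gain_pos
    unfolding slope'_critical by (intro mult_nonpos_nonneg[OF _ less_imp_le]) auto
  ultimately show False by simp
qed

lemma slope_subcritical:
  assumes "snd \<beta> \<le> b2c" "a < b" "b \<le> \<theta>0 \<or> \<theta>0 \<le> a" shows "slope \<beta> b < slope \<beta> a"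
  by (rule slope_decreasing[OF assms(2)]) (use assms slope'_subcritical in auto)

lemma maximizers_critical: "maximizers (b1c, b2c) = {\<theta>0}"
proof -
  have "t = \<theta>0" if "t \<in> maximizers (b1c, b2c)" for t
    using slope_subcritical[of "(b1c, b2c)" t \<theta>0] slope_subcritical[of "(b1c, b2c)" \<theta>0 t]
      maximizer_slope[OF that] slope_critical by (cases t \<theta>0 rule: linorder_cases) auto
  then show ?thesis using maximizers_nonempty[of "(b1c, b2c)"] by blast
qed

text \<open>
  Monotone comparative statics: add the two optimality inequalities and use that \<open>u\<close> and \<open>u ^ p\<close> increase together.
\<close>

lemma maximizers_compare:
  assumes le: "fst \<beta> \<le> fst \<beta>'" "snd \<beta> \<le> snd \<beta>'" and "\<beta> \<noteq> \<beta>'"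
    and t: "t \<in> maximizers \<beta>" "t' \<in> maximizers \<beta>'"
  shows "t \<le> t'"
proof (rule ccontr)
  assume "\<not> t \<le> t'"
  then have u: "K1 t' < K1 t" by simp
  then have up: "K1 t' ^ p < K1 t ^ p" using K1_pos[of t'] p2 by (intro power_strict_mono) auto
  have "L \<beta> t' \<le> L \<beta> t" "L \<beta>' t \<le> L \<beta>' t'" using t by (auto simp: maximizers_def)
  then have "0 \<le> (fst \<beta>' - fst \<beta>) * (K1 t' - K1 t) + (snd \<beta>' - snd \<beta>) * (K1 t' ^ p - K1 t ^ p)"
    unfolding L_def by (simp add: algebra_simps)
  moreover have "(fst \<beta>' - fst \<beta>) * (K1 t' - K1 t) \<le> 0" "(snd \<beta>' - snd \<beta>) * (K1 t' ^ p - K1 t ^ p) \<le> 0"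
    using le u up by (intro mult_nonneg_nonpos; simp)+
  ultimately have "(fst \<beta>' - fst \<beta>) * (K1 t' - K1 t) = 0" "(snd \<beta>' - snd \<beta>) * (K1 t' ^ p - K1 t ^ p) = 0"
    by linarith+
  then have "fst \<beta>' = fst \<beta>" "snd \<beta>' = snd \<beta>" using u up by auto
  then show False using \<open>\<beta> \<noteq> \<beta>'\<close> by (auto simp: prod_eq_iff)
qed

definition coexist :: "real \<times> real \<Rightarrow> bool" where
  "coexist \<beta> \<longleftrightarrow> 0 \<le> snd \<beta> \<and> (\<exists>t\<in>maximizers \<beta>. \<exists>s\<in>maximizers \<beta>. t < s)"

lemma coexistD:
  assumes "coexist \<beta>"
  obtains t s where "maximizers \<beta> = {t, s}" "t < \<theta>0" "\<theta>0 < s"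
proof -
  obtain t s where ts: "t \<in> maximizers \<beta>" "s \<in> maximizers \<beta>" "t < s" using assms by (auto simp: coexist_def)
  have "x \<in> {t, s}" if x: "x \<in> maximizers \<beta>" for x
    using maximizers_separated[OF ts] maximizers_separated[OF x ts(1)] maximizers_separated[OF ts(1) x]
      maximizers_separated[OF x ts(2)] maximizers_separated[OF ts(2) x]
    by (cases x t rule: linorder_cases; cases x s rule: linorder_cases) auto
  then have "maximizers \<beta> = {t, s}" using ts by blast
  then show thesis using that maximizers_separated[OF ts] by blast
qed

lemma coexist_bounds:
  assumes c: "coexist \<beta>" shows "fst \<beta> < b1c" "b2c < snd \<beta>"
proof -
  obtain t s where ts: "maximizers \<beta> = {t, s}" "t < \<theta>0" "\<theta>0 < s" using coexistD[OF c] .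
  then have tm: "t \<in> maximizers \<beta>" "s \<in> maximizers \<beta>" by auto
  show b2: "b2c < snd \<beta>"
  proof (rule ccontr)
    assume "\<not> ?thesis"
    then show False using slope_subcritical[of \<beta> t \<theta>0] slope_subcritical[of \<beta> \<theta>0 s] ts
      maximizer_slope[OF tm(1)] maximizer_slope[OF tm(2)] by auto
  qed
  show "fst \<beta> < b1c"
    using maximizers_compare[of "(b1c, b2c)" \<beta> \<theta>0 t] maximizers_critical tm(1) ts(2) b2 by force
qed

text \<open>
  For two ordered coexistence points the larger maximizer of the lower one exceeds \<open>\<theta>0\<close>, and the smaller maximizer
  of the upper one lies below \<open>\<theta>0\<close>, against monotonicity.
\<close>

lemma coexist_antitone:
  assumes c: "coexist \<beta>" "coexist \<beta>'" and le: "fst \<beta> \<le> fst \<beta>'" "snd \<beta> \<le> snd \<beta>'" shows "\<beta> = \<beta>'"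
proof (rule ccontr)
  assume ne: "\<beta> \<noteq> \<beta>'"
  obtain t s where ts: "maximizers \<beta> = {t, s}" "t < \<theta>0" "\<theta>0 < s" using coexistD[OF c(1)] .
  obtain t' s' where ts': "maximizers \<beta>' = {t', s'}" "t' < \<theta>0" "\<theta>0 < s'" using coexistD[OF c(2)] .
  show False using maximizers_compare[OF le ne, of s t'] ts ts' by auto
qed

lemma rate_deriv: "(rate has_real_derivative \<theta> * K2 \<theta>) (at \<theta>)"
  unfolding rate_def by (auto intro!: derivative_eq_intros K_deriv K1_deriv)

lemma rate_nonneg: "0 \<le> rate \<theta>"
proof -
  have "rate 0 \<le> rate \<theta>"
  proof (cases "0 \<le> \<theta>")
    case True
    show ?thesis
      by (rule DERIV_nonneg_imp_nondecreasing[OF True])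
         (use K2_pos rate_deriv in \<open>meson less_imp_le mult_nonneg_nonneg\<close>)
  next
    case False
    then have "\<theta> \<le> 0" by simp
    then show ?thesis
      by (rule DERIV_nonpos_imp_nonincreasing)
         (use K2_pos rate_deriv in \<open>meson less_imp_le mult_nonpos_nonneg\<close>)
  qed
  then show ?thesis by (simp add: rate_def K_0)
qed

text \<open>
  For \<open>\<beta>\<^sub>2\<close> large the term \<open>\<beta>\<^sub>2 u ^ p\<close> favours \<open>\<theta>0 + 1\<close> over all \<open>t \<le> \<theta>0\<close>.
\<close>

lemma L_mono_high:
  assumes b2: "B \<le> b2" and t: "t \<le> \<theta>0" and B: "B * (K1 (\<theta>0 + 1) ^ p - K1 \<theta>0 ^ p) = \<bar>b1\<bar> + rate (\<theta>0 + 1) / 2 + 1"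
    and rate: "0 \<le> rate t"
  shows "L (b1, b2) t < L (b1, b2) (\<theta>0 + 1)"
proof -
  have *: "(K1 (\<theta>0 + 1) ^ p - K1 \<theta>0 ^ p) > 0"
    using K1_pos[of \<theta>0] p2 by (simp add: power_strict_mono less_imp_le)
  have up: "K1 t ^ p \<le> K1 \<theta>0 ^ p" using t K1_pos[of t] by (intro power_mono) (auto simp: less_imp_le)
  have B0: "\<bar>b1\<bar> + rate (\<theta>0 + 1) / 2 + 1 \<le> b2 * (K1 (\<theta>0 + 1) ^ p - K1 \<theta>0 ^ p)"
    unfolding B[symmetric] using b2 * by (intro mult_right_mono) auto
  have d: "0 < K1 (\<theta>0 + 1) - K1 t" "K1 (\<theta>0 + 1) - K1 t \<le> 1"
    using t K1_le[of "\<theta>0 + 1"] K1_pos[of t] by (auto simp: less_imp_le)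
  have "\<bar>b1 * (K1 (\<theta>0 + 1) - K1 t)\<bar> \<le> \<bar>b1\<bar> * 1" unfolding abs_mult using d by (intro mult_left_mono) auto
  then have c1: "- \<bar>b1\<bar> \<le> b1 * (K1 (\<theta>0 + 1) - K1 t)" by linarith
  have L_diff: "L (b1, b2) (\<theta>0 + 1) - L (b1, b2) t
      = b1 * (K1 (\<theta>0 + 1) - K1 t) + b2 * (K1 (\<theta>0 + 1) ^ p - K1 t ^ p) - rate (\<theta>0 + 1) / 2 + rate t / 2"
    unfolding L_def by (simp add: algebra_simps)
  show ?thesis
  proof (cases "0 \<le> b2")
    case True
    then have "b2 * (K1 (\<theta>0 + 1) ^ p - K1 \<theta>0 ^ p) \<le> b2 * (K1 (\<theta>0 + 1) ^ p - K1 t ^ p)"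
      using up by (intro mult_left_mono) auto
    then show ?thesis using c1 B0 rate L_diff by linarith
  next
    case False
    then have "b2 * (K1 (\<theta>0 + 1) ^ p - K1 \<theta>0 ^ p) \<le> 0" using * by (intro mult_nonpos_nonneg) auto
    moreover have "0 \<le> rate (\<theta>0 + 1)" by (rule rate_nonneg)
    ultimately show ?thesis using B0 by linarith
  qed
qed

text \<open>
  On the half-line \<open>\<beta>\<^sub>2 \<ge> b2c\<close> over \<open>b1\<close>, the parameters with a maximizer \<open>\<le> \<theta>0\<close> and those with a maximizer
  \<open>\<ge> \<theta>0\<close> form two closed sets that cover it. The first contains \<open>b2c\<close>, the second all large values, so they meet,
  and \<open>\<theta>0\<close> itself is not a maximizer there.
\<close>

lemma coexist_exists:
  assumes b1: "b1 < b1c" shows "\<exists>b2. coexist (b1, b2)"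
proof -
  define A where "A = {b2. b2c \<le> b2 \<and> (\<exists>t\<le>\<theta>0. t \<in> maximizers (b1, b2))}"
  define B where "B = {b2. b2c \<le> b2 \<and> (\<exists>t\<ge>\<theta>0. t \<in> maximizers (b1, b2))}"
  have not\<theta>0: "\<theta>0 \<notin> maximizers (b1, b2)" if "b2c \<le> b2" for b2
    using \<theta>0_maximizer[of "(b1, b2)"] that b1 by auto
  have closed_aux: "closed {b2. b2c \<le> b2 \<and> (\<exists>t\<in>S. t \<in> maximizers (b1, b2))}" if S: "closed S" for S
    unfolding closed_sequential_limits
  proof (intro allI impI, elim conjE)
    fix X l assume X: "\<forall>n. X n \<in> {b2. b2c \<le> b2 \<and> (\<exists>t\<in>S. t \<in> maximizers (b1, b2))}" and l: "X \<longlonglongrightarrow> l"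
    then obtain t where t: "\<And>n. t n \<in> S" "\<And>n. t n \<in> maximizers (b1, X n)" by simp metis
    obtain r s where r: "strict_mono (r :: nat \<Rightarrow> nat)" "(t \<circ> r) \<longlonglongrightarrow> s" "s \<in> maximizers (b1, l)"
      using maximizers_subseq[OF tendsto_Pair[OF tendsto_const l], of t b1] t(2) by auto
    have "s \<in> S" by (rule closed_sequentially[OF S _ r(2)]) (use t in auto)
    moreover have "b2c \<le> l" by (rule LIMSEQ_le_const[OF l]) (use X in auto)
    ultimately show "l \<in> {b2. b2c \<le> b2 \<and> (\<exists>t\<in>S. t \<in> maximizers (b1, b2))}" using r by auto
  qed
  have clA: "closed A" using closed_aux[of "{..\<theta>0}"] by (simp add: A_def Bex_def atMost_iff conj_commute)
  have clB: "closed B" using closed_aux[of "{\<theta>0..}"] by (simp add: B_def Bex_def atLeast_iff conj_commute)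
  have cover: "{b2c..} \<subseteq> A \<union> B"
  proof
    fix b2 assume "b2 \<in> {b2c..}"
    moreover obtain t where "t \<in> maximizers (b1, b2)" using maximizers_nonempty by blast
    ultimately show "b2 \<in> A \<union> B" unfolding A_def B_def using linear[of t \<theta>0] by auto
  qed
  have neA: "A \<inter> {b2c..} \<noteq> {}"
  proof -
    obtain t where "t \<in> maximizers (b1, b2c)" using maximizers_nonempty by blast
    moreover from this have "t \<le> \<theta>0"
      using maximizers_compare[of "(b1, b2c)" "(b1c, b2c)" t \<theta>0] b1 maximizers_critical by auto
    ultimately show ?thesis by (auto simp: A_def)
  qed
  have neB: "B \<inter> {b2c..} \<noteq> {}"
  proof -
    have *: "(K1 (\<theta>0 + 1) ^ p - K1 \<theta>0 ^ p) > 0"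
      using K1_pos[of \<theta>0] p2 by (simp add: power_strict_mono less_imp_le)
    define H where "H = (\<bar>b1\<bar> + rate (\<theta>0 + 1) / 2 + 1) / (K1 (\<theta>0 + 1) ^ p - K1 \<theta>0 ^ p)"
    define b2 where "b2 = max H b2c"
    obtain t where t: "t \<in> maximizers (b1, b2)" using maximizers_nonempty by blast
    have "\<not> t \<le> \<theta>0"
    proof
      assume "t \<le> \<theta>0"
      then have "L (b1, b2) t < L (b1, b2) (\<theta>0 + 1)"
        by (rule L_mono_high[of H, rotated]) (use * rate_nonneg in \<open>auto simp: b2_def H_def\<close>)
      moreover have "L (b1, b2) (\<theta>0 + 1) \<le> L (b1, b2) t" using t by (simp add: maximizers_def)
      ultimately show False by simp
    qed
    moreover have "b2c \<le> b2" by (simp add: b2_def)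
    ultimately have "b2 \<in> B \<inter> {b2c..}" using t by (auto simp: B_def intro!: exI[of _ t])
    then show ?thesis by blast
  qed
  have "A \<inter> B \<inter> {b2c..} \<noteq> {}"
    using connected_closedD[of "{b2c..}" A B] clA clB cover neA neB
    by (auto simp: is_interval_connected_1[symmetric] is_interval_ci)
  then obtain b2 t s where "b2c \<le> b2" "t \<le> \<theta>0" "t \<in> maximizers (b1, b2)" "\<theta>0 \<le> s" "s \<in> maximizers (b1, b2)"
    by (auto simp: A_def B_def)
  moreover from this have "t \<noteq> \<theta>0" "s \<noteq> \<theta>0" using not\<theta>0 by auto
  ultimately have "coexist (b1, b2)"
    using b2c_pos unfolding coexist_def by (intro conjI bexI[of _ t] bexI[of _ s]) auto
  then show ?thesis by blast
qed

text \<open>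
  Existence and uniqueness of the coexistence point over \<open>b1 < b1c\<close> are \<open>coexist_exists\<close> and \<open>coexist_antitone\<close>.
\<close>

definition r :: "real \<Rightarrow> real" where
  "r b1 = (if b1 = b1c then b2c else (THE b2. coexist (b1, b2)))"

lemma r_end [simp]: "r b1c = b2c"
  by (simp add: r_def)

lemma coexist_r: "b1 < b1c \<Longrightarrow> coexist (b1, r b1)"
proof -
  assume b1: "b1 < b1c"
  obtain b2 where b2: "coexist (b1, b2)" using coexist_exists[OF b1] by blast
  moreover have "b2' = b2" if "coexist (b1, b2')" for b2'
  proof (cases "b2 \<le> b2'")
    case True
    then have "(b1, b2) = (b1, b2')" by (intro coexist_antitone[OF b2 that]) auto
    then show ?thesis by simp
  next
    case False
    then have "(b1, b2') = (b1, b2)" by (intro coexist_antitone[OF that b2]) auto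
    then show ?thesis by simp
  qed
  ultimately have "coexist (b1, THE b2. coexist (b1, b2))" by (rule theI)
  then show ?thesis using b1 by (simp add: r_def)
qed

lemma curve_iff: "\<beta> \<in> curve_of r b1c \<longleftrightarrow> coexist \<beta> \<or> \<beta> = (b1c, b2c)"
proof
  assume "\<beta> \<in> curve_of r b1c"
  then have "fst \<beta> \<le> b1c" "\<beta> = (fst \<beta>, r (fst \<beta>))" by (auto simp: curve_of_def)
  then show "coexist \<beta> \<or> \<beta> = (b1c, b2c)" using coexist_r[of "fst \<beta>"] by (cases "fst \<beta> = b1c") auto
next
  assume *: "coexist \<beta> \<or> \<beta> = (b1c, b2c)"
  show "\<beta> \<in> curve_of r b1c"
  proof (cases "\<beta> = (b1c, b2c)")
    case False
    then have c: "coexist \<beta>" using * by blast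
    then have b1: "fst \<beta> < b1c" by (rule coexist_bounds)
    have "\<beta> = (fst \<beta>, r (fst \<beta>))"
    proof (cases "snd \<beta> \<le> r (fst \<beta>)")
      case True
      then show ?thesis by (intro coexist_antitone[OF c coexist_r[OF b1]]) auto
    next
      case False
      then show ?thesis by (intro coexist_antitone[OF coexist_r[OF b1] c, symmetric]) auto
    qed
    then show ?thesis using b1 by (auto simp: curve_of_def prod_eq_iff)
  qed (auto simp: curve_of_def)
qed

lemma r_ge: "b1 \<le> b1c \<Longrightarrow> b2c \<le> r b1"
  using coexist_bounds(2)[OF coexist_r[of b1]] by (cases "b1 = b1c") auto

lemma r_strict_antimono: "strict_antimono_on {..b1c} r"
proof (rule monotone_onI)
  fix x y assume xy: "x \<in> {..b1c}" "y \<in> {..b1c}" "x < y"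
  show "r y < r x"
  proof (cases "y = b1c")
    case True
    then show ?thesis using coexist_bounds(2)[OF coexist_r[of x]] xy by auto
  next
    case False
    then show ?thesis using coexist_antitone[OF coexist_r[of x] coexist_r[of y]] xy by force
  qed
qed

lemma curve_maximizers:
  assumes "\<beta> \<in> curve_of r b1c"
  obtains t s where "maximizers \<beta> = {t, s}" "t \<le> \<theta>0" "\<theta>0 \<le> s"
  using assms coexistD[of \<beta>] maximizers_critical unfolding curve_iff
  by (metis insert_absorb2 less_imp_le order_refl)

lemma curve_closed: "closed (curve_of r b1c)"
  unfolding closed_sequential_limits
proof (intro allI impI, elim conjE)
  fix X l assume X: "\<forall>n. X n \<in> curve_of r b1c" and l: "X \<longlonglongrightarrow> l"
  have "\<exists>t s. t \<in> maximizers (X n) \<and> s \<in> maximizers (X n) \<and> t \<le> \<theta>0 \<and> \<theta>0 \<le> s" for n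
    by (rule curve_maximizers[of "X n"]) (use X in auto)
  then obtain t s where ts: "\<And>n. t n \<in> maximizers (X n)" "\<And>n. s n \<in> maximizers (X n)"
    "\<And>n. t n \<le> \<theta>0" "\<And>n. \<theta>0 \<le> s n" by metis
  obtain q a where q: "(t \<circ> q) \<longlonglongrightarrow> a" "a \<in> maximizers l" using maximizers_subseq[OF l ts(1)] by blast
  obtain q' b where q': "(s \<circ> q') \<longlonglongrightarrow> b" "b \<in> maximizers l" using maximizers_subseq[OF l ts(2)] by blast
  have a: "a \<le> \<theta>0" by (rule LIMSEQ_le_const2[OF q(1)]) (use ts in auto)
  have b: "\<theta>0 \<le> b" by (rule LIMSEQ_le_const[OF q'(1)]) (use ts in auto)
  have "b2c \<le> snd (X n)" for n
  proof -
    have "X n \<in> curve_of r b1c" using X by blast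
    then show ?thesis using r_ge[of "fst (X n)"] by (auto simp: curve_of_def)
  qed
  then have b2: "b2c \<le> snd l" by (intro LIMSEQ_le_const[OF tendsto_snd[OF l]]) auto
  show "l \<in> curve_of r b1c"
  proof (cases "a = b")
    case True
    then show ?thesis using \<theta>0_maximizer[of l] q(2) a b b2 by (auto simp: curve_iff)
  next
    case False
    then have "a < b" using a b by simp
    then have "coexist l" using q(2) q'(2) b2 b2c_pos unfolding coexist_def by (intro conjI bexI[of _ a] bexI[of _ b]) auto
    then show ?thesis by (simp add: curve_iff)
  qed
qed

text \<open>
  The graph is closed, and \<open>r\<close> maps \<open>{a..b1c}\<close> into the compact interval from \<open>b2c\<close> to \<open>r a\<close>.
\<close>

lemma r_cont: "continuous_on {..b1c} r"
proof -
  have *: "continuous_on {a..b1c} r" for a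
  proof (rule continuous_from_closed_graph[of "{b2c..r a}"])
    show "r \<in> {a..b1c} \<rightarrow> {b2c..r a}"
      using r_ge r_strict_antimono by (force simp: monotone_on_def less_eq_real_def)
    have "(\<lambda>x. (x, r x)) ` {a..b1c} = curve_of r b1c \<inter> ({a..} \<times> UNIV)"
      by (auto simp: curve_of_def)
    then show "closed ((\<lambda>x. (x, r x)) ` {a..b1c})"
      by (simp add: closed_Int closed_Times curve_closed)
  qed auto
  show ?thesis unfolding continuous_on_eq_continuous_within
  proof
    fix x assume x: "x \<in> {..b1c}"
    have "continuous (at x within {x - 1..b1c}) r"
      using *[of "x - 1"] x by (auto simp: continuous_on_eq_continuous_within)
    moreover have "at x within {x - 1..b1c} = at x within {..b1c}"
      by (rule at_within_nhd[of _ "{x - 1<..}"]) auto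
    ultimately show "continuous (at x within {..b1c}) r" by simp
  qed
qed

definition opt :: "real \<times> real \<Rightarrow> real" where
  "opt \<beta> = (SOME t. t \<in> maximizers \<beta>)"

lemma opt_maximizer: "opt \<beta> \<in> maximizers \<beta>"
  unfolding opt_def using maximizers_nonempty by (simp add: some_in_eq)

lemma off_curve:
  assumes "0 \<le> snd \<beta>" "\<beta> \<notin> curve_of r b1c"
  shows "maximizers \<beta> = {opt \<beta>}" "slope' (snd \<beta>) (opt \<beta>) < 0"
proof -
  have "\<not> coexist \<beta>" "\<beta> \<noteq> (b1c, b2c)" using assms(2) by (auto simp: curve_iff)
  then show "maximizers \<beta> = {opt \<beta>}" using opt_maximizer[of \<beta>] assms(1) 
    unfolding coexist_def by (metis insertI1 insert_absorb is_singletonI' is_singleton_the_elem linorder_neqE_linordered_idom singletonD empty_iff)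
  show "slope' (snd \<beta>) (opt \<beta>) < 0"
    using maximizer_degenerate(1)[OF opt_maximizer, of \<beta>] maximizer_second_order[OF opt_maximizer, of \<beta>] \<open>\<beta> \<noteq> (b1c, b2c)\<close>
    by (auto simp: less_le)
qed

lemma opt_tendsto_within:
  assumes "\<And>\<beta>'. \<beta>' \<in> A \<Longrightarrow> opt \<beta>' \<in> S" "closed S" "maximizers \<beta> \<inter> S \<subseteq> {s}"
  shows "(opt \<longlongrightarrow> s) (at \<beta> within A)"
  unfolding tendsto_at_iff_sequentially
proof (intro allI impI)
  fix X assume "\<forall>i. X i \<in> A - {\<beta>}" "X \<longlonglongrightarrow> \<beta>"
  then show "(opt \<circ> X) \<longlonglongrightarrow> s"
    by (intro maximizers_tendsto[of X \<beta> "opt \<circ> X" S]) (use opt_maximizer assms in auto)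
qed

lemma opt_tendsto: "maximizers \<beta> = {s} \<Longrightarrow> (opt \<longlongrightarrow> s) (at \<beta>)"
  by (rule opt_tendsto_within[of _ UNIV]) auto

lemma L_line: "L (a + x *\<^sub>R v) \<theta> = L a \<theta> + x * (fst v * K1 \<theta> + snd v * K1 \<theta> ^ p)"
  by (simp add: L_def algebra_simps)

lemma slope_line: "slope (a + x *\<^sub>R v) \<theta> = slope a \<theta> + x * (fst v + real p * snd v * K1 \<theta> ^ (p - 1))"
  by (simp add: slope_def algebra_simps)

lemma filterlim_line:
  fixes a v :: "real \<times> real"
  assumes "v \<noteq> 0" shows "filterlim (\<lambda>x. a + x *\<^sub>R v) (at (a + x0 *\<^sub>R v)) (at x0)"
proof (rule filterlim_atI)
  show "((\<lambda>x. a + x *\<^sub>R v) \<longlongrightarrow> a + x0 *\<^sub>R v) (at x0)" by (intro tendsto_intros)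
  show "\<forall>\<^sub>F x in at x0. a + x *\<^sub>R v \<noteq> a + x0 *\<^sub>R v"
    using assms by (auto simp: eventually_at_filter)
qed

text \<open>
  Along a line \<open>L\<close> is affine in the parameter \<open>x\<close>. Comparing the optimal values at \<open>x\<close> and \<open>x0\<close> with either
  maximizer traps the difference quotient between \<open>u t\<close> and \<open>u (\<tau> x)\<close>, and \<open>\<tau> x\<close> tends to \<open>t\<close>. The
  coordinate directions give the two partial derivatives.
\<close>

lemma Psi_deriv_line:
  assumes v: "v \<noteq> 0" and m: "maximizers (a + x0 *\<^sub>R v) = {t}"
  shows "((\<lambda>x. \<Psi> (a + x *\<^sub>R v)) has_real_derivative fst v * K1 t + snd v * K1 t ^ p) (at x0)"
proof -
  define u where "u \<theta> = fst v * K1 \<theta> + snd v * K1 \<theta> ^ p" for \<theta>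
  define f where "f x = \<Psi> (a + x *\<^sub>R v)" for x
  define \<tau> where "\<tau> x = opt (a + x *\<^sub>R v)" for x
  have f0: "f x0 = L a t + x0 * u t" unfolding f_def u_def using Psi_eq[of t] m L_line by auto
  have f1: "f x = L a (\<tau> x) + x * u (\<tau> x)" for x
    unfolding f_def u_def \<tau>_def using Psi_eq[OF opt_maximizer] L_line by metis
  have ge: "L a \<theta> + x * u \<theta> \<le> f x" for \<theta> x
    unfolding f_def u_def using L_le_Psi[of "a + x *\<^sub>R v" \<theta>] L_line by auto
  have lo: "(x - x0) * u t \<le> f x - f x0" for x using ge[of t x] f0 by (simp add: algebra_simps)
  have hi: "f x - f x0 \<le> (x - x0) * u (\<tau> x)" for x using ge[of "\<tau> x" x0] f1[of x] by (simp add: algebra_simps)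
  have bd: "norm ((f x - f x0) / (x - x0) - u t) \<le> \<bar>u (\<tau> x) - u t\<bar>" if "x \<noteq> x0" for x
  proof (cases "x0 < x")
    case True
    then have "u t \<le> (f x - f x0) / (x - x0)" "(f x - f x0) / (x - x0) \<le> u (\<tau> x)"
      using lo[of x] hi[of x] by (auto simp: field_simps)
    then show ?thesis by simp
  next
    case False
    then have "x - x0 < 0" using that by simp
    then have "(f x - f x0) / (x - x0) \<le> u t" "u (\<tau> x) \<le> (f x - f x0) / (x - x0)"
      using lo[of x] hi[of x] by (simp_all add: neg_divide_le_eq neg_le_divide_eq mult.commute)
    then show ?thesis by simp
  qed
  have "(\<tau> \<longlongrightarrow> t) (at x0)"
    unfolding \<tau>_def by (rule filterlim_compose[OF opt_tendsto[OF m] filterlim_line[OF v]])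
  moreover have "continuous_on UNIV u" unfolding u_def by (intro continuous_intros)
  ultimately have "((\<lambda>x. u (\<tau> x)) \<longlongrightarrow> u t) (at x0)"
    using continuous_on_tendsto_compose[of UNIV u \<tau> t] by auto
  then have "((\<lambda>x. \<bar>u (\<tau> x) - u t\<bar>) \<longlongrightarrow> 0) (at x0)"
    using LIM_zero tendsto_rabs_zero by blast
  then have "((\<lambda>x. (f x - f x0) / (x - x0) - u t) \<longlongrightarrow> 0) (at x0)"
    by (rule Lim_null_comparison[rotated]) (use bd in \<open>auto simp: eventually_at_filter\<close>)
  then have "((\<lambda>x. (f x - f x0) / (x - x0)) \<longlongrightarrow> u t) (at x0)" by (rule LIM_zero_cancel)
  then show ?thesis unfolding has_field_derivative_iff f_def u_def .
qed

text \<open>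
  Each maximizer \<open>t\<close> provides a line of slope \<open>K1 t\<close> that touches \<open>\<Psi>\<close> from below, so a derivative would equal
  \<open>K1 t\<close> for both maximizers.
\<close>

lemma Psi_not_differentiable:
  assumes "coexist (b1, b2)" shows "\<not> (\<lambda>x. \<Psi> (x, b2)) differentiable (at b1)"
proof
  assume "(\<lambda>x. \<Psi> (x, b2)) differentiable (at b1)"
  then obtain D where D: "((\<lambda>x. \<Psi> (x, b2)) has_real_derivative D) (at b1)"
    using real_differentiable_def by blast
  have slope: "D = K1 t" if "t \<in> maximizers (b1, b2)" for t
  proof -
    have "((\<lambda>x. \<Psi> (x, b2) - x * K1 t) has_real_derivative D - K1 t) (at b1)"
      by (rule derivative_eq_intros D refl)+ simp
    moreover have "\<Psi> (b1, b2) - b1 * K1 t \<le> \<Psi> (x, b2) - x * K1 t" for x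
      using Psi_eq[OF that] L_le_Psi[of "(x, b2)" t] by (simp add: L_def algebra_simps)
    ultimately show ?thesis using DERIV_local_min[of _ "D - K1 t" b1 1] by auto
  qed
  obtain t s where "maximizers (b1, b2) = {t, s}" "t < \<theta>0" "\<theta>0 < s" using coexistD[OF assms] .
  then show False using slope[of t] slope[of s] by simp
qed

text \<open>
  Solving the equation \<open>slope = 0\<close> for the line parameter instead of \<open>\<theta>\<close> gives an explicit left inverse \<open>B\<close> of
  the continuous map \<open>x \<mapsto> opt (a + x v)\<close>.
\<close>

lemma opt_deriv_line:
  fixes a v :: "real \<times> real" and x0 :: real
  defines "\<beta> \<equiv> a + x0 *\<^sub>R v"
  assumes w: "\<And>\<theta>. 0 < fst v + real p * snd v * K1 \<theta> ^ (p - 1)"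
    and off: "\<beta> \<notin> curve_of r b1c" and pos: "0 < snd \<beta>"
  shows "((\<lambda>x. opt (a + x *\<^sub>R v)) has_real_derivative
     (fst v + real p * snd v * K1 (opt \<beta>) ^ (p - 1)) / (- slope' (snd \<beta>) (opt \<beta>))) (at x0)"
proof -
  define w where "w \<theta> = fst v + real p * snd v * K1 \<theta> ^ (p - 1)" for \<theta>
  define B where "B \<theta> = - slope a \<theta> / w \<theta>" for \<theta>
  define w' where "w' = real p * snd v * ((real p - 1) * gain (opt \<beta>))"
  have v0: "v \<noteq> 0" using w[of 0] by auto
  have wpos: "0 < w \<theta>" for \<theta> using w by (simp add: w_def)
  have wd: "(w has_real_derivative w') (at (opt \<beta>))"
    unfolding w_def w'_def using DERIV_add[OF DERIV_const DERIV_cmult[OF power_deriv]] by simp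
  have sl: "slope a (opt \<beta>) = - x0 * w (opt \<beta>)"
    using maximizer_slope[OF opt_maximizer, of \<beta>] slope_line[of a x0 v "opt \<beta>"] unfolding \<beta>_def w_def by simp
  have sl': "slope' (snd \<beta>) (opt \<beta>) = slope' (snd a) (opt \<beta>) + x0 * w'"
    unfolding \<beta>_def slope'_def w'_def by (simp add: algebra_simps)
  have Bd: "(B has_real_derivative - slope' (snd \<beta>) (opt \<beta>) / w (opt \<beta>)) (at (opt \<beta>))"
    unfolding B_def
    by (rule derivative_eq_intros slope_deriv wd refl)+
       (use wpos[of "opt \<beta>"] sl sl' in \<open>auto simp: field_simps\<close>)
  have Bo: "B (opt (a + x *\<^sub>R v)) = x" for x
    using maximizer_slope[OF opt_maximizer, of "a + x *\<^sub>R v"] wpos[of "opt (a + x *\<^sub>R v)"]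
    unfolding slope_line B_def w_def[symmetric] by (simp add: field_simps)
  have m: "maximizers \<beta> = {opt \<beta>}" and neg: "slope' (snd \<beta>) (opt \<beta>) < 0"
    using off_curve[of \<beta>] off pos by auto
  have "((\<lambda>x. opt (a + x *\<^sub>R v)) has_real_derivative inverse (- slope' (snd \<beta>) (opt \<beta>) / w (opt \<beta>))) (at x0)"
  proof (rule DERIV_inverse_function[where f = B and a = "x0 - 1" and b = "x0 + 1"])
    show "(B has_real_derivative - slope' (snd \<beta>) (opt \<beta>) / w (opt \<beta>)) (at (opt (a + x0 *\<^sub>R v)))"
      using Bd by (simp add: \<beta>_def)
    show "isCont (\<lambda>x. opt (a + x *\<^sub>R v)) x0"
      unfolding isCont_def using filterlim_compose[OF opt_tendsto filterlim_line[OF v0]] m by (simp add: \<beta>_def)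
  qed (use neg wpos[of "opt \<beta>"] Bo in auto)
  then show ?thesis by (simp add: w_def inverse_eq_divide)
qed

lemma partial_Psi:
  assumes "maximizers \<beta> = {t}"
  shows "partial1 \<Psi> \<beta> = K1 t" "partial2 \<Psi> \<beta> = K1 t ^ p"
proof -
  have "((\<lambda>x. \<Psi> (x, snd \<beta>)) has_real_derivative K1 t) (at (fst \<beta>))"
    using Psi_deriv_line[of "(1, 0)" "(0, snd \<beta>)" "fst \<beta>" t] assms by (simp add: zero_prod_def)
  then show "partial1 \<Psi> \<beta> = K1 t" unfolding partial1_def by (rule DERIV_imp_deriv)
  have "((\<lambda>y. \<Psi> (fst \<beta>, y)) has_real_derivative K1 t ^ p) (at (snd \<beta>))"
    using Psi_deriv_line[of "(0, 1)" "(fst \<beta>, 0)" "snd \<beta>" t] assms by (simp add: zero_prod_def)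
  then show "partial2 \<Psi> \<beta> = K1 t ^ p" unfolding partial2_def by (rule DERIV_imp_deriv)
qed

text \<open>
  The boundary \<open>\<beta>\<^sub>2 = 0\<close> is left out in order to have an open set.
\<close>

definition domain :: "(real \<times> real) set" where
  "domain = {\<beta>. 0 < snd \<beta>} - curve_of r b1c"

lemma domain_open: "open domain"
  unfolding domain_def by (intro open_Diff curve_closed open_Collect_less continuous_intros)

lemma domainD: "\<beta> \<in> domain \<Longrightarrow> 0 < snd \<beta> \<and> \<beta> \<notin> curve_of r b1c \<and> maximizers \<beta> = {opt \<beta>} \<and> slope' (snd \<beta>) (opt \<beta>) < 0"
  using off_curve[of \<beta>] by (auto simp: domain_def)

lemma eventually_domain: "0 < snd \<beta> \<Longrightarrow> eventually (\<lambda>\<beta>'. \<beta>' \<in> domain) (at \<beta> within - curve_of r b1c)"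
proof -
  assume "0 < snd \<beta>"
  then have "eventually (\<lambda>\<beta>'. \<beta>' \<in> {\<beta>. 0 < snd \<beta>}) (at \<beta> within - curve_of r b1c)"
    by (intro topological_tendstoD[OF tendsto_ident_at] open_Collect_less continuous_intros) auto
  moreover have "eventually (\<lambda>\<beta>'. \<beta>' \<in> - curve_of r b1c) (at \<beta> within - curve_of r b1c)"
    by (auto simp: eventually_at_filter)
  ultimately show ?thesis by eventually_elim (auto simp: domain_def)
qed

lemma second_partials:
  assumes d: "\<beta> \<in> domain" and g: "\<And>\<beta>'. \<beta>' \<in> domain \<Longrightarrow> g \<beta>' = h (opt \<beta>')"
    and h: "\<And>\<theta>. (h has_real_derivative h' \<theta>) (at \<theta>)"
  shows "partial1 g \<beta> = h' (opt \<beta>) / (- slope' (snd \<beta>) (opt \<beta>))"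
    and "partial2 g \<beta> = h' (opt \<beta>) * (real p * K1 (opt \<beta>) ^ (p - 1)) / (- slope' (snd \<beta>) (opt \<beta>))"
proof -
  have *: "((\<lambda>x. g (a + x *\<^sub>R v)) has_real_derivative h' (opt \<beta>) * (fst v + real p * snd v * K1 (opt \<beta>) ^ (p - 1)) / (- slope' (snd \<beta>) (opt \<beta>))) (at x0)"
    if \<beta>: "\<beta> = a + x0 *\<^sub>R v" and w: "\<And>\<theta>. 0 < fst v + real p * snd v * K1 \<theta> ^ (p - 1)" for a v x0
  proof -
    have "((\<lambda>x. h (opt (a + x *\<^sub>R v))) has_real_derivative h' (opt \<beta>) * ((fst v + real p * snd v * K1 (opt \<beta>) ^ (p - 1)) / (- slope' (snd \<beta>) (opt \<beta>)))) (at x0)"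
      by (rule DERIV_chain2) (use h opt_deriv_line[OF w, of a x0] domainD[OF d] \<beta> in auto)
    moreover have "eventually (\<lambda>x. a + x *\<^sub>R v \<in> domain) (nhds x0)"
      by (rule topological_tendstoD[OF _ domain_open]) (use d \<beta> in \<open>auto intro!: tendsto_intros filterlim_ident\<close>)
    then have "eventually (\<lambda>x. h (opt (a + x *\<^sub>R v)) = g (a + x *\<^sub>R v)) (nhds x0)"
      by eventually_elim (simp add: g)
    ultimately show ?thesis by (subst DERIV_cong_ev[OF refl _ refl]) (auto elim: eventually_mono)
  qed
  show "partial1 g \<beta> = h' (opt \<beta>) / (- slope' (snd \<beta>) (opt \<beta>))"
    using DERIV_imp_deriv[OF *[of "(0, snd \<beta>)" "fst \<beta>" "(1, 0)"]] by (simp add: partial1_def)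
  show "partial2 g \<beta> = h' (opt \<beta>) * (real p * K1 (opt \<beta>) ^ (p - 1)) / (- slope' (snd \<beta>) (opt \<beta>))"
    using DERIV_imp_deriv[OF *[of "(fst \<beta>, 0)" "snd \<beta>" "(0, 1)"]] K1_pow_bounds p2 by (simp add: partial2_def)
qed

lemma first_partials_domain:
  "\<beta> \<in> domain \<Longrightarrow> partial1 \<Psi> \<beta> = K1 (opt \<beta>)" "\<beta> \<in> domain \<Longrightarrow> partial2 \<Psi> \<beta> = K1 (opt \<beta>) ^ p"
  using partial_Psi domainD by blast+

lemma K1_pow_deriv: "((\<lambda>\<theta>. K1 \<theta> ^ p) has_real_derivative real p * K1 \<theta> ^ (p - 1) * K2 \<theta>) (at \<theta>)"
  by (auto intro!: derivative_eq_intros K1_deriv)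

lemma opt_tendsto_critical: "(opt \<longlongrightarrow> \<theta>0) (at (b1c, b2c) within A)"
  by (rule tendsto_within_subset[OF opt_tendsto[OF maximizers_critical]]) auto

lemma continuous_opt_tendsto:
  assumes "(opt \<longlongrightarrow> s) F" "continuous_on UNIV h" shows "((\<lambda>\<beta>. h (opt \<beta>)) \<longlongrightarrow> h s) F"
  using continuous_on_tendsto_compose[OF assms(2,1)] by auto

text \<open>
  At the end of the curve the maximizer tends to \<open>\<theta>0\<close> from everywhere, and there \<open>slope'\<close> vanishes.
\<close>

lemma second_partial_diverges:
  assumes eq: "\<And>\<beta>. \<beta> \<in> domain \<Longrightarrow> g \<beta> = h (opt \<beta>) / (- slope' (snd \<beta>) (opt \<beta>))"
    and h: "continuous_on UNIV h" "h \<theta>0 \<noteq> 0"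
  shows "filterlim g at_infinity (at (b1c, b2c) within - curve_of r b1c)"
proof -
  let ?F = "at (b1c, b2c) within - curve_of r b1c"
  have ev: "eventually (\<lambda>\<beta>. \<beta> \<in> domain) ?F" using eventually_domain b2c_pos by auto
  have cont: "continuous_on UNIV (\<lambda>z. slope' (fst z) (snd z))" by (intro continuous_intros)
  have "((\<lambda>\<beta>. snd \<beta>) \<longlongrightarrow> snd (b1c, b2c)) ?F" by (intro tendsto_snd tendsto_ident_at)
  then have "((\<lambda>\<beta>. (snd \<beta>, opt \<beta>)) \<longlongrightarrow> (b2c, \<theta>0)) ?F"
    by (intro tendsto_Pair opt_tendsto_critical) simp
  then have "((\<lambda>\<beta>. slope' (snd \<beta>) (opt \<beta>)) \<longlongrightarrow> slope' b2c \<theta>0) ?F"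
    using continuous_on_tendsto_compose[OF cont] by fastforce
  then have "((\<lambda>\<beta>. - slope' (snd \<beta>) (opt \<beta>)) \<longlongrightarrow> 0) ?F"
    by (auto intro!: tendsto_eq_intros simp: slope'_critical)
  moreover have "eventually (\<lambda>\<beta>. - slope' (snd \<beta>) (opt \<beta>) \<noteq> 0) ?F"
    using ev by eventually_elim (use domainD in force)
  ultimately have "filterlim (\<lambda>\<beta>. - slope' (snd \<beta>) (opt \<beta>)) (at 0) ?F" by (rule filterlim_atI)
  then have "filterlim (\<lambda>\<beta>. h (opt \<beta>) / (- slope' (snd \<beta>) (opt \<beta>))) at_infinity ?F"
    unfolding divide_inverse
    by (intro tendsto_mult_filterlim_at_infinity[OF continuous_opt_tendsto[OF opt_tendsto_critical h(1)] h(2)]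
        filterlim_compose[OF filterlim_inverse_at_infinity])
  then show ?thesis
    by (rule filterlim_mono_eventually[OF _ order_refl order_refl])
       (use ev in \<open>eventually_elim, simp add: eq\<close>)
qed

lemma second_partials_diverge:
  "filterlim (partial1 (partial1 \<Psi>)) at_infinity (at (b1c, b2c) within - curve_of r b1c)"
  "filterlim (partial1 (partial2 \<Psi>)) at_infinity (at (b1c, b2c) within - curve_of r b1c)"
  "filterlim (partial2 (partial2 \<Psi>)) at_infinity (at (b1c, b2c) within - curve_of r b1c)"
proof -
  note nz = K1_pos[THEN less_imp_neq, of \<theta>0, symmetric] K2_pos[THEN less_imp_neq, of \<theta>0, symmetric]
  show "filterlim (partial1 (partial1 \<Psi>)) at_infinity (at (b1c, b2c) within - curve_of r b1c)"
    by (rule second_partial_diverges[OF second_partials(1)[OF _ first_partials_domain(1) K1_deriv]])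
       (use nz in \<open>auto intro!: continuous_intros\<close>)
  show "filterlim (partial1 (partial2 \<Psi>)) at_infinity (at (b1c, b2c) within - curve_of r b1c)"
    by (rule second_partial_diverges[OF second_partials(1)[OF _ first_partials_domain(2) K1_pow_deriv]])
       (use nz p2 in \<open>auto intro!: continuous_intros\<close>)
  show "filterlim (partial2 (partial2 \<Psi>)) at_infinity (at (b1c, b2c) within - curve_of r b1c)"
    by (rule second_partial_diverges[OF second_partials(2)[OF _ first_partials_domain(2) K1_pow_deriv]])
       (use nz p2 in \<open>auto intro!: continuous_intros\<close>)
qed

lemma first_partials_limit:
  "(partial1 \<Psi> \<longlongrightarrow> K1 \<theta>0) (at (b1c, b2c) within - curve_of r b1c)"
  "(partial2 \<Psi> \<longlongrightarrow> K1 \<theta>0 ^ p) (at (b1c, b2c) within - curve_of r b1c)"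
proof -
  let ?F = "at (b1c, b2c) within - curve_of r b1c"
  have ev: "eventually (\<lambda>\<beta>. \<beta> \<in> domain) ?F" using eventually_domain b2c_pos by auto
  have "((\<lambda>\<beta>. K1 (opt \<beta>)) \<longlongrightarrow> K1 \<theta>0) ?F" "((\<lambda>\<beta>. K1 (opt \<beta>) ^ p) \<longlongrightarrow> K1 \<theta>0 ^ p) ?F"
    by (intro continuous_opt_tendsto[OF opt_tendsto_critical] continuous_intros)+
  moreover have "eventually (\<lambda>\<beta>. K1 (opt \<beta>) = partial1 \<Psi> \<beta>) ?F" "eventually (\<lambda>\<beta>. K1 (opt \<beta>) ^ p = partial2 \<Psi> \<beta>) ?F"
    using ev by (auto elim!: eventually_mono simp: first_partials_domain)
  ultimately show "(partial1 \<Psi> \<longlongrightarrow> K1 \<theta>0) ?F" "(partial2 \<Psi> \<longlongrightarrow> K1 \<theta>0 ^ p) ?F"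
    by (blast intro: Lim_transform_eventually)+
qed

lemma partials_limit_side:
  assumes ev: "A \<subseteq> domain" and S: "\<And>\<beta>. \<beta> \<in> A \<Longrightarrow> opt \<beta> \<in> S" "closed S" and m: "maximizers \<beta> \<inter> S \<subseteq> {s}"
  shows "(partial1 \<Psi> \<longlongrightarrow> K1 s) (at \<beta> within A)" "(partial2 \<Psi> \<longlongrightarrow> K1 s ^ p) (at \<beta> within A)"
proof -
  have evA: "eventually (\<lambda>\<beta>. \<beta> \<in> domain) (at \<beta> within A)"
    unfolding eventually_at_filter by (rule always_eventually) (use ev in blast)
  have "(opt \<longlongrightarrow> s) (at \<beta> within A)" by (rule opt_tendsto_within[OF S m])
  then have "((\<lambda>\<beta>. K1 (opt \<beta>)) \<longlongrightarrow> K1 s) (at \<beta> within A)" "((\<lambda>\<beta>. K1 (opt \<beta>) ^ p) \<longlongrightarrow> K1 s ^ p) (at \<beta> within A)"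
    by (auto intro!: continuous_opt_tendsto continuous_intros)
  moreover have "eventually (\<lambda>\<beta>. K1 (opt \<beta>) = partial1 \<Psi> \<beta>) (at \<beta> within A)"
    "eventually (\<lambda>\<beta>. K1 (opt \<beta>) ^ p = partial2 \<Psi> \<beta>) (at \<beta> within A)"
    using evA by (auto elim!: eventually_mono simp: first_partials_domain)
  ultimately show "(partial1 \<Psi> \<longlongrightarrow> K1 s) (at \<beta> within A)" "(partial2 \<Psi> \<longlongrightarrow> K1 s ^ p) (at \<beta> within A)"
    by (blast intro: Lim_transform_eventually)+
qed

lemma above_curve_opt: "\<beta> \<in> above_curve r b1c \<Longrightarrow> \<beta> \<in> domain \<and> \<theta>0 \<le> opt \<beta>"
proof -
  assume "\<beta> \<in> above_curve r b1c"
  then have b: "fst \<beta> \<le> b1c" "r (fst \<beta>) < snd \<beta>" by (auto simp: above_curve_def)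
  then have c: "(fst \<beta>, r (fst \<beta>)) \<in> curve_of r b1c" "\<beta> \<notin> curve_of r b1c" by (auto simp: curve_of_def)
  obtain t s where ts: "maximizers (fst \<beta>, r (fst \<beta>)) = {t, s}" "t \<le> \<theta>0" "\<theta>0 \<le> s" using curve_maximizers[OF c(1)] .
  have "s \<le> opt \<beta>"
    by (rule maximizers_compare[of "(fst \<beta>, r (fst \<beta>))" \<beta>]) (use b ts opt_maximizer in \<open>auto simp: prod_eq_iff\<close>)
  then show ?thesis using ts c(2) b r_ge[OF b(1)] b2c_pos by (auto simp: domain_def)
qed

lemma below_curve_opt: "\<beta> \<in> below_curve r b1c \<Longrightarrow> \<beta> \<notin> curve_of r b1c \<and> 0 \<le> snd \<beta> \<and> opt \<beta> \<le> \<theta>0"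
proof -
  assume "\<beta> \<in> below_curve r b1c"
  then have b: "fst \<beta> \<le> b1c" "snd \<beta> < r (fst \<beta>)" "0 \<le> snd \<beta>" by (auto simp: below_curve_def)
  then have c: "(fst \<beta>, r (fst \<beta>)) \<in> curve_of r b1c" "\<beta> \<notin> curve_of r b1c" by (auto simp: curve_of_def)
  obtain t s where ts: "maximizers (fst \<beta>, r (fst \<beta>)) = {t, s}" "t \<le> \<theta>0" "\<theta>0 \<le> s" using curve_maximizers[OF c(1)] .
  have "opt \<beta> \<le> t"
    by (rule maximizers_compare[of \<beta> "(fst \<beta>, r (fst \<beta>))"]) (use b ts opt_maximizer in \<open>auto simp: prod_eq_iff\<close>)
  then show ?thesis using ts c(2) b by auto
qed

lemma jumps:
  assumes b1: "b1 < b1c"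
  shows "jump_between (partial1 \<Psi>) (above_curve r b1c) (below_curve r b1c) (b1, r b1)"
    and "jump_between (partial2 \<Psi>) (above_curve r b1c) (below_curve r b1c) (b1, r b1)"
proof -
  obtain t s where ts: "maximizers (b1, r b1) = {t, s}" "t < \<theta>0" "\<theta>0 < s"
    using coexistD[OF coexist_r[OF b1]] .
  have r0: "0 < r b1" using r_ge[of b1] b1 b2c_pos by auto
  let ?B = "below_curve r b1c \<inter> {\<beta>. 0 < snd \<beta>}"
  have within: "at (b1, r b1) within below_curve r b1c = at (b1, r b1) within ?B"
    by (rule at_within_nhd[of _ "{\<beta>. 0 < snd \<beta>}"]) (use r0 in \<open>auto intro!: open_Collect_less continuous_intros\<close>)
  have ab: "(partial1 \<Psi> \<longlongrightarrow> K1 s) (at (b1, r b1) within above_curve r b1c)"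
    "(partial2 \<Psi> \<longlongrightarrow> K1 s ^ p) (at (b1, r b1) within above_curve r b1c)"
    by (rule partials_limit_side[where S = "{\<theta>0..}"]; use above_curve_opt ts in force)+
  have be: "(partial1 \<Psi> \<longlongrightarrow> K1 t) (at (b1, r b1) within below_curve r b1c)"
    "(partial2 \<Psi> \<longlongrightarrow> K1 t ^ p) (at (b1, r b1) within below_curve r b1c)"
    unfolding within
    by (rule partials_limit_side[where S = "{..\<theta>0}"]; use below_curve_opt ts in \<open>force simp: domain_def\<close>)+
  have "K1 t < K1 s" "K1 t ^ p < K1 s ^ p"
    using ts K1_pos[of t] p2 by (auto intro!: power_strict_mono)
  then show "jump_between (partial1 \<Psi>) (above_curve r b1c) (below_curve r b1c) (b1, r b1)"
    "jump_between (partial2 \<Psi>) (above_curve r b1c) (below_curve r b1c) (b1, r b1)"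
    using ab be unfolding jump_between_def by (metis less_irrefl)+
qed

lemma K_midpoint: "K (a + b) \<le> K (2 * a) / 2 + K (2 * b) / 2"
proof -
  have "convex_on UNIV K"
    by (rule f''_ge0_imp_convex[OF convex_UNIV K_deriv K1_deriv less_imp_le[OF K2_pos]])
  from convex_onD[OF this, of "1/2" "2 * a" "2 * b"] show ?thesis by simp
qed

lemma tangent_power:
  fixes u v :: real
  assumes "0 \<le> u" "0 \<le> v"
  shows "real (Suc m) * v ^ m * u - real m * v ^ Suc m \<le> u ^ Suc m"
proof (induction m)
  case (Suc m)
  have "0 \<le> real (Suc m) * v ^ m * (u - v)\<^sup>2" using assms by simp
  then have "real (Suc (Suc m)) * v ^ Suc m * u - real (Suc m) * v ^ Suc (Suc m)
      \<le> u * (real (Suc m) * v ^ m * u - real m * v ^ Suc m)"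
    by (simp add: power2_eq_square algebra_simps)
  also have "\<dots> \<le> u * u ^ Suc m" by (rule mult_left_mono[OF Suc assms(1)])
  finally show ?case by simp
qed simp

text \<open>
  The tangent of \<open>u ^ p\<close> at \<open>v\<close> makes the energy linear in \<open>u\<close>. The maximum of the linearised problem is the value
  of \<open>K\<close> on the left, attained at the tilt \<open>s\<close>, and linearising has only lowered the objective.
\<close>

lemma dual_le_Psi:
  assumes "0 \<le> b2" "0 \<le> v"
  shows "K (2 * (b1 + real p * b2 * v ^ (p - 1))) / 2 - b2 * (real p - 1) * v ^ p \<le> \<Psi> (b1, b2)"
proof -
  define s where "s = 2 * (b1 + real p * b2 * v ^ (p - 1))"
  obtain m where m: "p = Suc m" using p2 by (cases p) auto
  have "real p * v ^ (p - 1) * K1 s - (real p - 1) * v ^ p \<le> K1 s ^ p"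
    using tangent_power[OF less_imp_le[OF K1_pos[of s]] assms(2), of m] by (simp add: m)
  from mult_left_mono[OF this assms(1)]
  have "K s / 2 - b2 * (real p - 1) * v ^ p \<le> L (b1, b2) s"
    unfolding L_def rate_def by (simp add: s_def field_simps)
  then show ?thesis using L_le_Psi[of "(b1, b2)" s] by (simp add: s_def)
qed

end

section \<open>Double power series for implicitly defined functions\<close>

text \<open>
  The geometric series in \<open>u + v\<close> with each power expanded; absolute convergence holds because
  \<open>norm u + norm v < 1\<close>.
\<close>

lemma has_sum_binomial_sigma:
  fixes u v :: "'a :: {real_normed_field, banach}"
  assumes "norm u + norm v < 1"
  shows "((\<lambda>(m, j). of_nat (m choose j) * u ^ j * v ^ (m - j)) has_sum 1 / (1 - u - v)) (SIGMA m:UNIV. {..m})"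
proof -
  have lt: "norm (u + v) < 1" using assms norm_triangle_ineq[of u v] by linarith
  have inner: "((\<lambda>j. of_nat (m choose j) * x ^ j * y ^ (m - j)) has_sum (x + y) ^ m) {..m}" for m and x y :: "'b :: {real_normed_field}"
    unfolding binomial_ring by (rule has_sum_finite) simp
  have geo: "((\<lambda>m. x ^ m) has_sum 1 / (1 - x)) UNIV" if "norm x < 1" for x :: "'b :: {real_normed_field, banach}"
    by (rule norm_summable_imp_has_sum) (use that in \<open>auto simp: norm_power intro!: geometric_sums summable_geometric\<close>)
  have "(\<lambda>(m, j). of_nat (m choose j) * norm u ^ j * norm v ^ (m - j)) summable_on (SIGMA m:UNIV. {..m})"
  proof (rule summable_on_SigmaI)
    show "((\<lambda>j. case (m, j) of (m, j) \<Rightarrow> of_nat (m choose j) * norm u ^ j * norm v ^ (m - j)) has_sum (norm u + norm v) ^ m) {..m}" for m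
      using inner[of m "norm u" "norm v"] by simp
    show "(\<lambda>m. (norm u + norm v) ^ m) summable_on UNIV"
      using geo[of "norm u + norm v"] assms by (auto simp: summable_on_def)
  qed auto
  then have "(\<lambda>(m, j). of_nat (m choose j) * u ^ j * v ^ (m - j)) summable_on (SIGMA m:UNIV. {..m})"
    by - (rule abs_summable_summable, simp add: case_prod_unfold norm_mult norm_power)
  then show ?thesis
  proof (rule has_sum_SigmaI[where g = "\<lambda>m. (u + v) ^ m", rotated 2])
    show "((\<lambda>j. case (m, j) of (m, j) \<Rightarrow> of_nat (m choose j) * u ^ j * v ^ (m - j)) has_sum (u + v) ^ m) {..m}" for m
      using inner[of m u v] by simp
    show "((\<lambda>m. (u + v) ^ m) has_sum 1 / (1 - u - v)) UNIV" using geo[OF lt] by (simp add: diff_diff_eq)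
  qed
qed

lemma has_sum_binomial:
  fixes u v :: "'a :: {real_normed_field, banach}"
  assumes "norm u + norm v < 1"
  shows "((\<lambda>(j, k). of_nat (j + k choose j) * u ^ j * v ^ k) has_sum 1 / (1 - u - v)) UNIV"
proof -
  have bij: "bij_betw (\<lambda>(j, k). (j + k, j)) UNIV (SIGMA m:UNIV. {..m :: nat})"
    by (rule bij_betwI[of _ _ _ "\<lambda>(m, j). (j, m - j)"]) auto
  show ?thesis
    using has_sum_reindex_bij_betw[OF bij, of "\<lambda>(m, j). of_nat (m choose j) * u ^ j * v ^ (m - j)" "1 / (1 - u - v)"]
      has_sum_binomial_sigma[OF assms] by (simp add: case_prod_unfold)
qed

text \<open>
  Double power series at the origin in two real variables with complex values, since they arise from contour integrals.
\<close>

definition sums_double :: "(nat \<Rightarrow> nat \<Rightarrow> complex) \<Rightarrow> real \<Rightarrow> (real \<Rightarrow> real \<Rightarrow> complex) \<Rightarrow> bool" where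
  "sums_double a e f \<longleftrightarrow> 0 < e \<and> (\<forall>x y. \<bar>x\<bar> < e \<longrightarrow> \<bar>y\<bar> < e \<longrightarrow>
     ((\<lambda>(j, k). a j k * of_real x ^ j * of_real y ^ k) has_sum f x y) UNIV)"

definition double_series :: "(real \<Rightarrow> real \<Rightarrow> complex) \<Rightarrow> bool" where
  "double_series f \<longleftrightarrow> (\<exists>a e. sums_double a e f)"

lemma sums_doubleD: "sums_double a e f \<Longrightarrow> \<bar>x\<bar> < e \<Longrightarrow> \<bar>y\<bar> < e \<Longrightarrow>
     ((\<lambda>(j, k). a j k * of_real x ^ j * of_real y ^ k) has_sum f x y) UNIV"
  unfolding sums_double_def by blast

lemma double_seriesI:
  assumes "0 < e" "\<And>x y. \<bar>x\<bar> < e \<Longrightarrow> \<bar>y\<bar> < e \<Longrightarrow>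
     ((\<lambda>(j, k). a j k * of_real x ^ j * of_real y ^ k) has_sum f x y) UNIV"
  shows "double_series f"
  unfolding double_series_def sums_double_def using assms by (intro exI[of _ a] exI[of _ e]) simp

lemma double_series_add:
  assumes "double_series f" "double_series g" shows "double_series (\<lambda>x y. f x y + g x y)"
proof -
  obtain a e b d where *: "sums_double a e f" "sums_double b d g" using assms unfolding double_series_def by blast
  show ?thesis
  proof (rule double_seriesI[of "min e d" "\<lambda>j k. a j k + b j k"])
    show "0 < min e d" using * by (simp add: sums_double_def)
    fix x y assume "\<bar>x\<bar> < min e d" "\<bar>y\<bar> < min e d"
    then show "((\<lambda>(j, k). (a j k + b j k) * of_real x ^ j * of_real y ^ k) has_sum f x y + g x y) UNIV"
      using has_sum_add[OF sums_doubleD[OF *(1), of x y] sums_doubleD[OF *(2), of x y]] by (simp add: case_prod_unfold distrib_right)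
  qed
qed

lemma double_series_cmult:
  assumes "double_series f" shows "double_series (\<lambda>x y. c * f x y)"
proof -
  obtain a e where *: "sums_double a e f" using assms unfolding double_series_def by blast
  show ?thesis
  proof (rule double_seriesI[of e "\<lambda>j k. c * a j k"])
    show "0 < e" using * by (simp add: sums_double_def)
    fix x y assume "\<bar>x\<bar> < e" "\<bar>y\<bar> < e"
    then show "((\<lambda>(j, k). c * a j k * of_real x ^ j * of_real y ^ k) has_sum c * f x y) UNIV"
      using has_sum_cmult_right[OF sums_doubleD[OF *, of x y], of c] by (simp add: case_prod_unfold mult.assoc)
  qed
qed

lemma double_series_mult_y:
  assumes "double_series f" shows "double_series (\<lambda>x y. of_real y * f x y)"
proof -
  obtain a e where *: "sums_double a e f" using assms unfolding double_series_def by blast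
  define b where "b j k = (case k of 0 \<Rightarrow> 0 | Suc k \<Rightarrow> a j k)" for j k
  show ?thesis
  proof (rule double_seriesI[of e b])
    show "0 < e" using * by (simp add: sums_double_def)
    fix x y assume xy: "\<bar>x\<bar> < e" "\<bar>y\<bar> < e"
    have "((\<lambda>z. of_real y * (case z of (j, k) \<Rightarrow> a j k * of_real x ^ j * of_real y ^ k)) has_sum of_real y * f x y) UNIV"
      by (rule has_sum_cmult_right[OF sums_doubleD[OF * xy]])
    also have "(\<lambda>z. of_real y * (case z of (j, k) \<Rightarrow> a j k * of_real x ^ j * of_real y ^ k)) = (\<lambda>(j, k). b j k * of_real x ^ j * of_real y ^ k) \<circ> map_prod id Suc"
      by (auto simp: b_def fun_eq_iff)
    finally have "((\<lambda>(j, k). b j k * of_real x ^ j * of_real y ^ k) has_sum of_real y * f x y) (map_prod id Suc ` UNIV)"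
      by (subst has_sum_reindex) (auto simp: inj_on_def o_def)
    moreover have "b (fst z) (snd z) = 0" if "z \<notin> range (map_prod id Suc)" for z
    proof (cases "snd z")
      case (Suc k)
      then have "z = map_prod id Suc (fst z, k)" by (simp add: prod_eq_iff)
      then show ?thesis using that by blast
    qed (simp add: b_def)
    ultimately show "((\<lambda>(j, k). b j k * of_real x ^ j * of_real y ^ k) has_sum of_real y * f x y) UNIV"
      by (subst has_sum_cong_neutral[where T = "range (map_prod id Suc)"]) (auto simp: case_prod_unfold)
  qed
qed

text \<open>
  On the circle the integrand is \<open>c / A\<close> times a double geometric series in \<open>x / A\<close> and \<open>y C / A\<close>, dominated
  uniformly in \<open>z\<close>, so it may be integrated termwise.
\<close>

lemma double_series_contour:
  fixes t :: complex
  assumes r: "0 < r" and cont: "continuous_on (sphere t r) c" "continuous_on (sphere t r) C" "continuous_on (sphere t r) A"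
    and \<eta>: "0 < \<eta>" "\<And>z. z \<in> sphere t r \<Longrightarrow> \<eta> \<le> norm (A z)" and B: "\<And>z. z \<in> sphere t r \<Longrightarrow> norm (C z) \<le> B"
  shows "double_series (\<lambda>x y. contour_integral (circlepath t r) (\<lambda>z. c z / (A z + of_real x + of_real y * C z)))"
proof -
  let ?\<gamma> = "circlepath t r"
  have sph: "path_image ?\<gamma> = sphere t r" using r by simp
  have ne: "t + of_real r \<in> sphere t r" using r by (simp add: dist_norm)
  have B0: "0 \<le> B" using B[OF ne] norm_ge_zero order_trans by blast
  have Anz: "A z \<noteq> 0" if "z \<in> sphere t r" for z using \<eta>(2)[OF that] \<eta>(1) by auto
  have "bounded (c ` sphere t r)" by (intro compact_imp_bounded compact_continuous_image cont(1) compact_sphere)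
  then obtain D where D: "\<And>z. z \<in> sphere t r \<Longrightarrow> norm (c z) \<le> D"
    unfolding bounded_iff by blast
  have D0: "0 \<le> D" using D[OF ne] norm_ge_zero order_trans by blast
  \<comment> \<open>makes both ratios of the geometric series at most \<open>1 / 4\<close>\<close>
  define e where "e = \<eta> / (4 * (1 + B))"
  have e0: "0 < e" using \<eta>(1) B0 by (simp add: e_def)
  define q where "q j k z = of_nat (j + k choose j) * (- 1 / A z) ^ j * (- C z / A z) ^ k * (c z / A z)" for j k z
  define a where "a j k = contour_integral ?\<gamma> (q j k)" for j k
  have q_int: "q j k contour_integrable_on ?\<gamma>" for j k
    unfolding q_def using Anz sph
    by (intro contour_integrable_continuous_circlepath continuous_intros cont) (auto intro!: continuous_intros cont)
  have "((\<lambda>(j, k). a j k * of_real x ^ j * of_real y ^ k) has_sum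
      contour_integral ?\<gamma> (\<lambda>z. c z / (A z + of_real x + of_real y * C z))) UNIV" if x: "\<bar>x\<bar> < e" and y: "\<bar>y\<bar> < e" for x y
  proof -
    define T where "T = (\<lambda>(j, k) z. q j k z * of_real x ^ j * of_real y ^ k)"
    define M where "M = (\<lambda>(j, k). of_nat (j + k choose j) * (\<bar>x\<bar> / \<eta>) ^ j * (\<bar>y\<bar> * B / \<eta>) ^ k * (D / \<eta>))"
    have xe: "\<bar>x\<bar> / \<eta> \<le> 1 / 4" "\<bar>y\<bar> * B / \<eta> \<le> 1 / 4"
    proof -
      have "\<eta> / (4 * b) * b = \<eta> / 4" if "b \<noteq> 0" for b using that by simp
      from this[of "1 + B"] have e1: "e * (1 + B) = \<eta> / 4" using B0 by (simp only: e_def)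
      have "\<bar>x\<bar> * 1 \<le> e * (1 + B)" using x B0 by (intro mult_mono) auto
      then show "\<bar>x\<bar> / \<eta> \<le> 1 / 4" unfolding e1 using \<eta>(1) by (simp add: divide_le_eq)
      have "\<bar>y\<bar> * B \<le> e * (1 + B)" using y B0 by (intro mult_mono) auto
      then show "\<bar>y\<bar> * B / \<eta> \<le> 1 / 4" unfolding e1 using \<eta>(1) by (simp add: divide_le_eq)
    qed
    have "norm (\<bar>x\<bar> / \<eta>) = \<bar>x\<bar> / \<eta>" "norm (\<bar>y\<bar> * B / \<eta>) = \<bar>y\<bar> * B / \<eta>" using \<eta>(1) B0 by simp_all
    then have "norm (\<bar>x\<bar> / \<eta>) + norm (\<bar>y\<bar> * B / \<eta>) < 1" using xe by linarith
    from has_sum_cmult_left[OF has_sum_binomial[OF this], of "D / \<eta>"]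
    have Msum: "M summable_on UNIV" unfolding M_def summable_on_def by (auto simp: case_prod_unfold)
    have dom: "norm (T i z) \<le> M i" if z: "z \<in> sphere t r" for i z
    proof (cases i)
      case (Pair j k)
      have "norm (T i z) = of_nat (j + k choose j) * (\<bar>x\<bar> / norm (A z)) ^ j * (\<bar>y\<bar> * norm (C z) / norm (A z)) ^ k * (norm (c z) / norm (A z))"
        by (simp add: Pair T_def q_def norm_mult norm_power norm_divide power_divide power_mult_distrib)
      also have "\<dots> \<le> M i"
        unfolding M_def Pair prod.case
        using \<eta>(1) \<eta>(2)[OF z] B[OF z] D[OF z] B0 D0
        by (intro mult_mono power_mono frac_le mult_left_mono) auto
      finally show ?thesis .
    qed
    have val: "((\<lambda>i. T i z) has_sum c z / (A z + of_real x + of_real y * C z)) UNIV" if z: "z \<in> sphere t r" for z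
    proof -
      define u where "u = - of_real x / A z"
      define v where "v = - of_real y * C z / A z"
      have nu: "norm u \<le> \<bar>x\<bar> / \<eta>" unfolding u_def using \<eta>(1) \<eta>(2)[OF z] by (auto simp: norm_divide intro!: frac_le)
      have nv: "norm v \<le> \<bar>y\<bar> * B / \<eta>" unfolding v_def using \<eta>(1) \<eta>(2)[OF z] B[OF z] B0
        by (auto simp: norm_divide norm_mult intro!: frac_le mult_left_mono)
      have lt: "norm u + norm v < 1" using nu nv xe by linarith
      have "((\<lambda>i. (case i of (j, k) \<Rightarrow> of_nat (j + k choose j) * u ^ j * v ^ k) * (c z / A z)) has_sum 1 / (1 - u - v) * (c z / A z)) UNIV"
        by (rule has_sum_cmult_left[OF has_sum_binomial[OF lt]])
      also have "(\<lambda>i. (case i of (j, k) \<Rightarrow> of_nat (j + k choose j) * u ^ j * v ^ k) * (c z / A z)) = (\<lambda>i. T i z)"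
      proof
        fix i :: "nat \<times> nat"
        obtain j k where i: "i = (j, k)" by (cases i)
        have "u ^ j = (- 1 / A z) ^ j * of_real x ^ j" "v ^ k = (- C z / A z) ^ k * of_real y ^ k"
          unfolding u_def v_def power_mult_distrib[symmetric] by (simp_all add: mult.commute)
        then show "(case i of (j, k) \<Rightarrow> of_nat (j + k choose j) * u ^ j * v ^ k) * (c z / A z) = T i z"
          unfolding i T_def q_def prod.case by (simp only: mult_ac)
      qed
      also have "1 / (1 - u - v) * (c z / A z) = c z / (A z + of_real x + of_real y * C z)"
      proof -
        have "A z * (1 - u - v) = A z + of_real x + of_real y * C z"
          using Anz[OF z] by (simp add: u_def v_def field_simps)
        moreover have "1 / (1 - u - v) * (c z / A z) = c z / (A z * (1 - u - v))" by simp
        ultimately show ?thesis by (simp only:)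
      qed
      finally show ?thesis .
    qed
    have ul: "uniform_limit (sphere t r) (\<lambda>X z. \<Sum>i\<in>X. T i z) (\<lambda>z. \<Sum>\<^sub>\<infinity>i\<in>UNIV. T i z) (finite_subsets_at_top UNIV)"
      by (rule Weierstrass_m_test_general[OF dom Msum])
    have inf: "(\<Sum>\<^sub>\<infinity>i\<in>UNIV. T i z) = c z / (A z + of_real x + of_real y * C z)" if "z \<in> sphere t r" for z
      by (rule infsumI[OF val[OF that]])
    have ul': "uniform_limit (sphere t r) (\<lambda>X z. \<Sum>i\<in>X. T i z) (\<lambda>z. c z / (A z + of_real x + of_real y * C z)) (finite_subsets_at_top UNIV)"
      by (rule uniform_limit_cong'[THEN iffD1, OF _ _ ul]) (use inf in auto)
    have T_int: "T i contour_integrable_on ?\<gamma>" "contour_integral ?\<gamma> (T i) = (case i of (j, k) \<Rightarrow> a j k * of_real x ^ j * of_real y ^ k)" for i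
      unfolding T_def case_prod_unfold a_def using q_int[of "fst i" "snd i"]
      by (auto simp: mult.assoc contour_integral_rmul intro: contour_integrable_rmul)
    have "((\<lambda>X. contour_integral ?\<gamma> (\<lambda>z. \<Sum>i\<in>X. T i z)) \<longlongrightarrow> contour_integral ?\<gamma> (\<lambda>z. c z / (A z + of_real x + of_real y * C z))) (finite_subsets_at_top UNIV)"
    proof (rule contour_integral_uniform_limit_circlepath(2)[OF _ ul' _ r])
      show "\<forall>\<^sub>F X in finite_subsets_at_top UNIV. (\<lambda>z. \<Sum>i\<in>X. T i z) contour_integrable_on ?\<gamma>"
        by (rule eventually_finite_subsets_at_top_weakI) (auto intro!: contour_integrable_sum T_int)
    qed simp
    moreover have "\<forall>\<^sub>F X in finite_subsets_at_top UNIV. contour_integral ?\<gamma> (\<lambda>z. \<Sum>i\<in>X. T i z) = (\<Sum>i\<in>X. case i of (j, k) \<Rightarrow> a j k * of_real x ^ j * of_real y ^ k)"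
      by (rule eventually_finite_subsets_at_top_weakI) (simp add: contour_integral_sum T_int)
    ultimately show ?thesis
      unfolding has_sum_def by (rule Lim_transform_eventually)
  qed
  then show ?thesis by (rule double_seriesI[OF e0])
qed

text \<open>
  Along the segment from \<open>w\<close> to \<open>z\<close>, the real part of \<open>F * cnj (z - w)\<close> has a negative derivative.
\<close>

lemma injective_on_ball_of_Re_deriv:
  fixes F :: "complex \<Rightarrow> complex"
  assumes conv: "convex S" and d: "\<And>z. z \<in> S \<Longrightarrow> (F has_field_derivative F' z) (at z)" "\<And>z. z \<in> S \<Longrightarrow> Re (F' z) < 0"
    and zw: "z \<in> S" "w \<in> S" "z \<noteq> w"
  shows "F z \<noteq> F w"
proof
  assume eq: "F z = F w"
  have seg: "closed_segment w z \<subseteq> S" using conv zw by (simp add: closed_segment_subset)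
  obtain u where u: "u \<in> closed_segment w z" "Re (F z * cnj (z - w)) - Re (F w * cnj (z - w)) = Re (F' u * cnj (z - w) * (z - w))"
    using complex_mvt_line[of w z "\<lambda>x. F x * cnj (z - w)" "\<lambda>x. F' x * cnj (z - w)"] seg d(1)
    by (auto intro!: DERIV_cmult_right)
  have "cnj (z - w) * (z - w) = of_real ((norm (z - w))\<^sup>2)" by (subst complex_norm_square) (rule mult.commute)
  then have "Re (F' u * cnj (z - w) * (z - w)) = Re (F' u) * (norm (z - w))\<^sup>2" by (simp add: mult.assoc)
  then have "Re (F' u) * (norm (z - w))\<^sup>2 = 0" using u(2) eq by simp
  then show False using d(2)[of u] u(1) seg zw(3) by auto
qed

text \<open>
  \<open>s\<close> is the only zero of \<open>F\<close> in the disc and it is simple, so \<open>F z = (z - s) * q z\<close> with \<open>q\<close> free of zeros, and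
  Cauchy's formula for \<open>N * F' / q\<close> at \<open>s\<close> has the value \<open>N s\<close> because \<open>q s = F' s\<close>.
\<close>

lemma residue_at_simple_zero:
  fixes t :: complex
  assumes F: "\<And>z. z \<in> ball t R \<Longrightarrow> (F has_field_derivative F' z) (at z)" and rR: "0 < r" "r < R"
    and N: "N holomorphic_on ball t R" and F': "F' holomorphic_on ball t R"
    and neg: "\<And>z. z \<in> cball t r \<Longrightarrow> Re (F' z) < 0" and s: "s \<in> ball t r" "F s = 0"
  shows "contour_integral (circlepath t r) (\<lambda>z. N z * F' z / F z) = 2 * of_real pi * \<i> * N s"
proof -
  have sub: "cball t r \<subseteq> ball t R" using rR by auto
  have nz: "F z \<noteq> 0" if "z \<in> cball t r" "z \<noteq> s" for z
  proof -
    have "F z \<noteq> F s"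
      by (rule injective_on_ball_of_Re_deriv[OF convex_cball F neg, of t r]) (use sub that s in auto)
    then show ?thesis using s by simp
  qed
  have holF: "F holomorphic_on ball t R"
    unfolding holomorphic_on_open[OF open_ball] using F by blast
  define q where "q z = (if z = s then deriv F s else F z / (z - s))" for z
  have holq: "q holomorphic_on ball t R"
    by (rule pole_theorem_open_0[OF holF, of s]) (use s in \<open>auto simp: q_def\<close>)
  have dF: "deriv F s = F' s" using F[of s] s rR by (auto intro: DERIV_imp_deriv)
  have qnz: "q z \<noteq> 0" if "z \<in> cball t r" for z
    using nz[OF that] neg[of s] s dF by (auto simp: q_def)
  define g where "g z = N z * F' z / q z" for z
  have "((\<lambda>z. g z / (z - s)) has_contour_integral 2 * of_real pi * \<i> * g s) (circlepath t r)"
  proof (rule Cauchy_integral_circlepath)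
    show "continuous_on (cball t r) g" unfolding g_def
      using qnz by (intro continuous_intros holomorphic_on_imp_continuous_on holomorphic_on_subset[OF N sub] holomorphic_on_subset[OF F' sub] holomorphic_on_subset[OF holq sub]) auto
    have sub': "ball t r \<subseteq> ball t R" using rR by auto
    show "g holomorphic_on ball t r" unfolding g_def
      using qnz by (intro holomorphic_intros holomorphic_on_subset[OF N sub'] holomorphic_on_subset[OF F' sub'] holomorphic_on_subset[OF holq sub']) auto
    show "norm (s - t) < r" using s by (simp add: dist_norm norm_minus_commute)
  qed
  moreover have "g s = N s"
    using neg[of s] s dF by (auto simp: g_def q_def)
  moreover have "g z / (z - s) = N z * F' z / F z" if "z \<in> path_image (circlepath t r)" for z
  proof -
    have "z \<noteq> s" using that s rR by auto
    then show ?thesis by (simp add: g_def q_def)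
  qed
  ultimately have "((\<lambda>z. N z * F' z / F z) has_contour_integral 2 * of_real pi * \<i> * N s) (circlepath t r)"
    using has_contour_integral_eq by force
  then show ?thesis by (rule contour_integral_unique)
qed

text \<open>
  An implicit function theorem with analytic dependence. If \<open>s\<close> solves \<open>A s + x + y * C s = 0\<close> near the simple zero \<open>t\<close>
  of \<open>A\<close>, the residue formula expresses \<open>N0 s + y * N1 s\<close> by integrals over one circle around \<open>t\<close> which is the same
  for all small \<open>x\<close>, \<open>y\<close>; their integrands depend on \<open>x\<close> and \<open>y\<close> only through powers of \<open>y\<close> and the
  denominator \<open>A + x + y * C\<close>.
\<close>

lemma implicit_double_series:
  fixes t :: complex
  assumes A: "\<And>z. z \<in> ball t R \<Longrightarrow> (A has_field_derivative A' z) (at z)" "A' holomorphic_on ball t R"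
    and C: "\<And>z. z \<in> ball t R \<Longrightarrow> (C has_field_derivative C' z) (at z)" "C' holomorphic_on ball t R"
    and N: "N0 holomorphic_on ball t R" "N1 holomorphic_on ball t R"
    and R: "0 < R" and t: "A t = 0" "Re (A' t) < 0"
  shows "\<exists>f r. double_series f \<and> 0 < r \<and> (\<exists>e>0. \<forall>x y s. \<bar>x\<bar> < e \<longrightarrow> \<bar>y\<bar> < e \<longrightarrow> s \<in> ball t r \<longrightarrow>
     A s + of_real x + of_real y * C s = 0 \<longrightarrow> f x y = N0 s + of_real y * N1 s)"
proof -
  have "isCont A' t" using A(2) R by (metis centre_in_ball continuous_on_interior holomorphic_on_imp_continuous_on interior_open open_ball)
  then have "((\<lambda>z. Re (A' z)) \<longlongrightarrow> Re (A' t)) (at t)" by (auto simp: isCont_def intro: tendsto_Re)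
  then have "eventually (\<lambda>z. Re (A' z) < Re (A' t) / 2) (at t)" using t(2) by (intro order_tendstoD(2)) auto
  then obtain \<rho> where \<rho>: "0 < \<rho>" "\<And>z. z \<noteq> t \<Longrightarrow> dist z t < \<rho> \<Longrightarrow> Re (A' z) < Re (A' t) / 2"
    by (auto simp: eventually_at)
  define r where "r = min \<rho> R / 2"
  have r: "0 < r" "r < R" "r < \<rho>" using \<rho>(1) R by (auto simp: r_def)
  define d where "d = - Re (A' t) / 2"
  have d0: "0 < d" using t(2) by (simp add: d_def)
  have dA: "Re (A' z) \<le> - d" if "z \<in> cball t r" for z
    using \<rho>(2)[of z] that r t(2) by (cases "z = t") (auto simp: d_def dist_commute)
  have sub: "cball t r \<subseteq> ball t R" "sphere t r \<subseteq> cball t r" using r by auto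
  have contC: "continuous_on (cball t r) C" "continuous_on (cball t r) C'" "continuous_on (cball t r) A" "continuous_on (cball t r) A'"
    "continuous_on (cball t r) N0" "continuous_on (cball t r) N1"
  proof -
    have "A holomorphic_on ball t R" "C holomorphic_on ball t R" 
      unfolding holomorphic_on_open[OF open_ball] using A(1) C(1) by blast+
    then show "continuous_on (cball t r) C" "continuous_on (cball t r) C'" "continuous_on (cball t r) A" "continuous_on (cball t r) A'"
     "continuous_on (cball t r) N0" "continuous_on (cball t r) N1"
      using A(2) C(2) N sub(1) holomorphic_on_imp_continuous_on holomorphic_on_subset by blast+
  qed
  have bdd: "\<exists>B\<ge>0. \<forall>z\<in>cball t r. norm (h z) \<le> B" if "continuous_on (cball t r) h" for h :: "complex \<Rightarrow> complex"
  proof -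
    have "bounded (h ` cball t r)" by (intro compact_imp_bounded compact_continuous_image that compact_cball)
    then obtain B where "\<And>z. z \<in> cball t r \<Longrightarrow> norm (h z) \<le> B"
      unfolding bounded_iff by blast
    then show ?thesis by (intro exI[of _ "max B 0"]) (auto intro: order_trans max.coboundedI1)
  qed
  obtain B where B: "0 \<le> B" "\<And>z. z \<in> cball t r \<Longrightarrow> norm (C z) \<le> B" using bdd[OF contC(1)] by blast
  obtain B' where B': "0 \<le> B'" "\<And>z. z \<in> cball t r \<Longrightarrow> norm (C' z) \<le> B'" using bdd[OF contC(2)] by blast
  have Anz: "A z \<noteq> 0" if "z \<in> sphere t r" for z
  proof -
    have "Re (A' z) < 0" if "z \<in> cball t r" for z using dA[OF that] d0 by simp
    then have "A z \<noteq> A t"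
      by (intro injective_on_ball_of_Re_deriv[OF convex_cball A(1), of t r]) (use sub that r in auto)
    then show ?thesis using t(1) by simp
  qed
  have "\<exists>z\<in>sphere t r. \<forall>w\<in>sphere t r. norm (A z) \<le> norm (A w)"
  proof (rule continuous_attains_inf)
    show "sphere t r \<noteq> {}" using r by simp
    show "continuous_on (sphere t r) (\<lambda>z. norm (A z))"
      by (intro continuous_on_norm continuous_on_subset[OF contC(3) sub(2)])
  qed simp
  then obtain z0 where z0: "z0 \<in> sphere t r" "\<And>w. w \<in> sphere t r \<Longrightarrow> norm (A z0) \<le> norm (A w)" by blast
  define \<eta> where "\<eta> = norm (A z0)"
  have \<eta>: "0 < \<eta>" using Anz[OF z0(1)] by (simp add: \<eta>_def)
  define I where "I c x y = contour_integral (circlepath t r) (\<lambda>z. c z / (A z + of_real x + of_real y * C z))"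
    for c :: "complex \<Rightarrow> complex" and x y :: real
  have DS: "double_series (I c)" if "continuous_on (cball t r) c" for c
    unfolding I_def[abs_def]
    by (rule double_series_contour[OF r(1) _ _ _ \<eta>]) (use that contC sub z0(2) B(2) \<eta>_def in \<open>auto intro: continuous_on_subset\<close>)
  define f where "f x y = 1 / (2 * of_real pi * \<i>) * (I (\<lambda>z. N0 z * A' z) x y + of_real y * (I (\<lambda>z. N0 z * C' z + N1 z * A' z) x y + of_real y * I (\<lambda>z. N1 z * C' z) x y))"
    for x y
  have "double_series f" unfolding f_def[abs_def]
    by (intro double_series_cmult double_series_add double_series_mult_y DS continuous_intros contC)
  \<comment> \<open>the first bound keeps \<open>Re F' < 0\<close> on the disc, the second keeps \<open>F\<close> away from zero on the circle\<close>
  define e where "e = min (d / (B' + 1)) (\<eta> / (2 * (1 + B)))"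
  have e0: "0 < e" using d0 \<eta> B(1) B'(1) by (simp add: e_def)
  have "f x y = N0 s + of_real y * N1 s"
    if x: "\<bar>x\<bar> < e" and y: "\<bar>y\<bar> < e" and s: "s \<in> ball t r" and zero: "A s + of_real x + of_real y * C s = 0" for x y s
  proof -
    define F where "F z = A z + of_real x + of_real y * C z" for z
    define F' where "F' z = A' z + of_real y * C' z" for z
    define N where "N z = N0 z + of_real y * N1 z" for z
    have Fd: "(F has_field_derivative F' z) (at z)" if "z \<in> ball t R" for z
      unfolding F_def F'_def using A(1)[OF that] C(1)[OF that] by (auto intro!: derivative_eq_intros)
    have Fneg: "Re (F' z) < 0" if z: "z \<in> cball t r" for z
    proof -
      have "\<bar>Re (of_real y * C' z)\<bar> \<le> norm (of_real y * C' z)" by (rule abs_Re_le_cmod)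
      also have "\<dots> \<le> \<bar>y\<bar> * B'" using B'(2)[OF z] by (simp add: norm_mult mult_left_mono)
      also have "\<dots> < d"
      proof -
        have "\<bar>y\<bar> < d / (B' + 1)" using y by (simp add: e_def)
        then have "\<bar>y\<bar> * (B' + 1) < d" using B'(1) by (simp add: field_simps)
        then show ?thesis by (simp add: algebra_simps)
      qed
      finally show ?thesis using dA[OF z] by (simp add: F'_def)
    qed
    have res: "contour_integral (circlepath t r) (\<lambda>z. N z * F' z / F z) = 2 * of_real pi * \<i> * N s"
      by (rule residue_at_simple_zero[OF Fd r(1,2) _ _ Fneg s])
         (use zero A(2) C(2) N in \<open>auto simp: F_def N_def[abs_def] F'_def[abs_def] intro!: holomorphic_intros\<close>)
    have Fnz: "F z \<noteq> 0" if z: "z \<in> sphere t r" for z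
    proof
      assume "F z = 0"
      then have "A z = - (of_real x + of_real y * C z)" by (simp add: F_def algebra_simps eq_neg_iff_add_eq_0)
      then have "norm (A z) \<le> \<bar>x\<bar> + \<bar>y\<bar> * norm (C z)" by (metis norm_minus_cancel norm_mult norm_of_real norm_triangle_ineq)
      also have "\<dots> \<le> e + e * B" using x y B z sub e0 by (intro add_mono mult_mono) auto
      also have "\<dots> = e * (1 + B)" by (simp add: algebra_simps)
      also have "\<dots> \<le> \<eta> / (2 * (1 + B)) * (1 + B)" using B(1) by (intro mult_right_mono) (auto simp: e_def)
      also have "\<dots> = \<eta> / 2"
      proof -
        have "\<eta> / (2 * b) * b = \<eta> / 2" if "b \<noteq> 0" for b using that by simp
        moreover have "1 + B \<noteq> 0" using B(1) by simp
        ultimately show ?thesis by blast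
      qed
      finally show False using z0(2)[OF z] \<eta> unfolding \<eta>_def by linarith
    qed
    have ci: "(\<lambda>z. c z / F z) contour_integrable_on circlepath t r" if "continuous_on (cball t r) c" for c
    proof -
      have "continuous_on (sphere t r) (\<lambda>z. c z / F z)"
        unfolding F_def using Fnz
        by (intro continuous_intros continuous_on_subset[OF that sub(2)] continuous_on_subset[OF contC(1) sub(2)] continuous_on_subset[OF contC(3) sub(2)])
           (auto simp: F_def)
      then show ?thesis using r by (intro contour_integrable_continuous_circlepath) simp
    qed
    have I_F: "I c x y = contour_integral (circlepath t r) (\<lambda>z. c z / F z)" for c by (simp add: I_def F_def)
    have split: "N z * F' z / F z = N0 z * A' z / F z + of_real y * ((N0 z * C' z + N1 z * A' z) / F z + of_real y * (N1 z * C' z / F z))" for z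
      by (simp add: N_def F'_def add_divide_distrib[symmetric] algebra_simps)
    have "contour_integral (circlepath t r) (\<lambda>z. N z * F' z / F z)
      = I (\<lambda>z. N0 z * A' z) x y + of_real y * (I (\<lambda>z. N0 z * C' z + N1 z * A' z) x y + of_real y * I (\<lambda>z. N1 z * C' z) x y)"
      unfolding split I_F
      by (subst contour_integral_add contour_integral_lmul;
          (intro contour_integrable_add contour_integrable_lmul ci continuous_intros contC)?)+ simp
    then show ?thesis using res by (simp add: f_def N_def)
  qed
  then show ?thesis using \<open>double_series f\<close> r(1) e0 by blast
qed

section \<open>Analyticity and its failure\<close>

text \<open>
  For fixed \<open>y\<close>, summing over the powers of \<open>y\<close> first leaves an ordinary power series in \<open>x\<close>.
\<close>

lemma analytic_imp_differentiable:
  assumes "real_analytic_at_within f z S"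
  shows "\<exists>e>0. \<forall>x y. \<bar>x - fst z\<bar> < e \<longrightarrow> \<bar>y - snd z\<bar> < e \<longrightarrow> (\<forall>x. (x, y) \<in> S) \<longrightarrow> (\<lambda>x. f (x, y)) differentiable (at x)"
proof -
  obtain a e where e: "0 < e" and sum: "\<And>x y. (x, y) \<in> S \<Longrightarrow> \<bar>x - fst z\<bar> < e \<Longrightarrow> \<bar>y - snd z\<bar> < e \<Longrightarrow>
      ((\<lambda>(j, k). a j k * (x - fst z) ^ j * (y - snd z) ^ k) has_sum f (x, y)) UNIV"
    using assms unfolding real_analytic_at_within_def by blast
  have "(\<lambda>x. f (x, y)) differentiable (at x)" if x: "\<bar>x - fst z\<bar> < e" and y: "\<bar>y - snd z\<bar> < e" and S: "\<And>x. (x, y) \<in> S" for x y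
  proof -
    define Y where "Y = y - snd z"
    define b where "b j = (\<Sum>\<^sub>\<infinity>k. a j k * Y ^ k)" for j
    \<comment> \<open>as a sum over a dependent product, ready for iterated summation\<close>
    have s: "((\<lambda>(j, k). a j k * X ^ j * Y ^ k) has_sum f (fst z + X, y)) (SIGMA j:UNIV. UNIV)" if "\<bar>X\<bar> < e" for X
      using sum[OF S, of "fst z + X"] that y by (simp add: Y_def)
    have inner: "(\<lambda>k. a j k * Y ^ k) summable_on UNIV" for j
    proof -
      have "\<bar>e / 2\<bar> < e" using e by simp
      from s[OF this] have "(\<lambda>(j, k). a j k * (e / 2) ^ j * Y ^ k) summable_on (SIGMA j:UNIV. UNIV)" by (auto simp: summable_on_def)
      then have "(\<lambda>k. a j k * (e / 2) ^ j * Y ^ k) summable_on UNIV" by (rule summable_on_SigmaD1) simp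
      then have "(\<lambda>k. (2 / e) ^ j * (a j k * (e / 2) ^ j * Y ^ k)) summable_on UNIV" by (rule summable_on_cmult_right)
      moreover have "(2 / e) ^ j * (a j k * (e / 2) ^ j * Y ^ k) = a j k * Y ^ k" for k
        using e by (simp add: power_divide)
      ultimately show ?thesis by simp
    qed
    have sums: "(\<lambda>j. b j * X ^ j) sums f (fst z + X, y)" if X: "\<bar>X\<bar> < e" for X
    proof -
      have "((\<lambda>j. b j * X ^ j) has_sum f (fst z + X, y)) UNIV"
      proof (rule has_sum_SigmaD[OF s[OF X]])
        fix j
        have "((\<lambda>k. X ^ j * (a j k * Y ^ k)) has_sum X ^ j * b j) UNIV"
          unfolding b_def by (intro has_sum_cmult_right has_sum_infsum inner)
        then show "((\<lambda>k. case (j, k) of (j, k) \<Rightarrow> a j k * X ^ j * Y ^ k) has_sum b j * X ^ j) UNIV"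
          by (simp add: mult_ac)
      qed
      then show ?thesis by (rule has_sum_imp_sums)
    qed
    have "((\<lambda>X. \<Sum>j. b j * X ^ j) has_real_derivative (\<Sum>j. diffs b j * (x - fst z) ^ j)) (at (x - fst z))"
      by (rule termdiffs_strong') (use sums x in \<open>auto simp: sums_iff\<close>)
    then have "((\<lambda>x. \<Sum>j. b j * (x - fst z) ^ j) has_real_derivative (\<Sum>j. diffs b j * (x - fst z) ^ j)) (at x)"
      using DERIV_shift[of "\<lambda>X. \<Sum>j. b j * X ^ j" _ x "- fst z"] by simp
    moreover have "eventually (\<lambda>x'. (\<Sum>j. b j * (x' - fst z) ^ j) = f (x', y)) (nhds x)"
    proof -
      have "eventually (\<lambda>x'. x' \<in> {x'. \<bar>x' - fst z\<bar> < e}) (nhds x)"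
        using x by (intro eventually_nhds_in_open open_Collect_less continuous_intros) auto
      then show ?thesis
      proof eventually_elim
        fix x' assume "x' \<in> {x'. \<bar>x' - fst z\<bar> < e}"
        then show "(\<Sum>j. b j * (x' - fst z) ^ j) = f (x', y)"
          using sums[of "x' - fst z"] by (simp add: sums_iff)
      qed
    qed
    ultimately have "((\<lambda>x. f (x, y)) has_real_derivative (\<Sum>j. diffs b j * (x - fst z) ^ j)) (at x)"
      by (subst (asm) DERIV_cong_ev[OF refl _ refl])
    then show ?thesis using real_differentiable_def by blast
  qed
  then show ?thesis using e by blast
qed

context mean_field
begin

text \<open>
  The equation \<open>slope = 0\<close> removes \<open>\<beta>\<^sub>1\<close>. In this form the numerator of the contour integral involves only powers of
  the increment of \<open>\<beta>\<^sub>2\<close>.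
\<close>

lemma Psi_at_maximizer:
  assumes "s \<in> maximizers \<beta>" shows "\<Psi> \<beta> = K s / 2 - (real p - 1) * snd \<beta> * K1 s ^ p"
proof -
  have half: "s / 2 = fst \<beta> + real p * snd \<beta> * K1 s ^ (p - 1)"
    using maximizer_slope[OF assms] by (simp add: slope_def)
  have pow: "K1 s ^ p = K1 s ^ (p - 1) * K1 s" using p2 by (cases p) auto
  have "s * K1 s / 2 = s / 2 * K1 s" by simp
  also have "\<dots> = fst \<beta> * K1 s + real p * snd \<beta> * K1 s ^ p"
    unfolding half pow by (simp add: algebra_simps)
  finally have "s * K1 s / 2 = fst \<beta> * K1 s + real p * snd \<beta> * K1 s ^ p" .
  then show ?thesis unfolding Psi_eq[OF assms] L_def rate_def by (simp add: diff_divide_distrib algebra_simps)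
qed

lemma opt_near:
  assumes "maximizers \<beta> = {t}" "0 < \<epsilon>"
  shows "\<exists>d>0. \<forall>\<beta>'. \<bar>fst \<beta>' - fst \<beta>\<bar> < d \<longrightarrow> \<bar>snd \<beta>' - snd \<beta>\<bar> < d \<longrightarrow> \<bar>opt \<beta>' - t\<bar> < \<epsilon>"
proof -
  have "opt \<beta> = t" using opt_maximizer[of \<beta>] assms(1) by simp
  moreover obtain d where d: "0 < d" "\<And>\<beta>'. \<beta>' \<noteq> \<beta> \<Longrightarrow> dist \<beta>' \<beta> < d \<Longrightarrow> dist (opt \<beta>') t < \<epsilon>"
    using tendstoD[OF opt_tendsto[OF assms(1)] assms(2)] by (auto simp: eventually_at)
  moreover have "dist \<beta>' \<beta> < d" if "\<bar>fst \<beta>' - fst \<beta>\<bar> < d / 2" "\<bar>snd \<beta>' - snd \<beta>\<bar> < d / 2" for \<beta>'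
  proof -
    have "dist \<beta>' \<beta> \<le> dist (fst \<beta>') (fst \<beta>) + dist (snd \<beta>') (snd \<beta>)"
      unfolding dist_prod_def by (rule sqrt_sum_squares_le_sum) auto
    then show ?thesis using that by (simp add: dist_real_def)
  qed
  ultimately have "\<bar>opt \<beta>' - t\<bar> < \<epsilon>" if "\<bar>fst \<beta>' - fst \<beta>\<bar> < d / 2" "\<bar>snd \<beta>' - snd \<beta>\<bar> < d / 2" for \<beta>'
    using that assms(2) by (cases "\<beta>' = \<beta>") (auto simp: dist_real_def)
  then show ?thesis using d(1) by (intro exI[of _ "d / 2"]) auto
qed

text \<open>
  \<open>\<Psi>\<close> is not differentiable in \<open>\<beta>\<^sub>1\<close> at coexistence points, and these accumulate at the end of the curve.
\<close>

lemma Psi_not_analytic_on_curve: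
  assumes "\<beta> \<in> curve_of r b1c" shows "\<not> real_analytic_at_within \<Psi> \<beta> upper_half_plane"
proof
  assume "real_analytic_at_within \<Psi> \<beta> upper_half_plane"
  from analytic_imp_differentiable[OF this] obtain e where e: "0 < e" and
    diff: "\<And>x y. \<bar>x - fst \<beta>\<bar> < e \<Longrightarrow> \<bar>y - snd \<beta>\<bar> < e \<Longrightarrow> 0 \<le> y \<Longrightarrow> (\<lambda>x. \<Psi> (x, y)) differentiable (at x)"
    by (auto simp: upper_half_plane_def)
  have "\<exists>x y. coexist (x, y) \<and> \<bar>x - fst \<beta>\<bar> < e \<and> \<bar>y - snd \<beta>\<bar> < e"
  proof (cases "coexist \<beta>")
    case True
    then show ?thesis using e by (intro exI[of _ "fst \<beta>"] exI[of _ "snd \<beta>"]) auto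
  next
    case False
    then have \<beta>: "\<beta> = (b1c, b2c)" using assms by (simp add: curve_iff)
    obtain d where d: "0 < d" "\<And>x. x \<le> b1c \<Longrightarrow> \<bar>x - b1c\<bar> < d \<Longrightarrow> \<bar>r x - b2c\<bar> < e"
      using r_cont e unfolding continuous_on_iff by (force simp: dist_real_def)
    define x where "x = b1c - min d e / 2"
    have x: "x < b1c" "\<bar>x - b1c\<bar> < d" "\<bar>x - b1c\<bar> < e" using d(1) e by (auto simp: x_def)
    then show ?thesis using coexist_r[OF x(1)] d(2)[of x] by (intro exI[of _ x] exI[of _ "r x"]) (auto simp: \<beta>)
  qed
  then obtain x y where xy: "coexist (x, y)" "\<bar>x - fst \<beta>\<bar> < e" "\<bar>y - snd \<beta>\<bar> < e" by blast
  have "0 \<le> y" using coexist_bounds(2)[OF xy(1)] b2c_pos by simp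
  then show False using Psi_not_differentiable[OF xy(1)] diff[OF xy(2,3)] by blast
qed

end

context unit_law
begin

lemma mean_field_law:
  assumes p: "2 \<le> p"
    and ex: "\<And>\<theta>. (deriv ^^ 3) (cgf \<mu>) \<theta> * deriv (cgf \<mu>) \<theta> = - (real p - 2) * ((deriv ^^ 2) (cgf \<mu>) \<theta>)\<^sup>2 \<longleftrightarrow> \<theta> = \<theta>0"
  shows "mean_field (cgf \<mu>) K1 K2 K3 p \<theta>0"
proof
  have nz: "mgf 0 \<theta> \<noteq> 0" for \<theta> :: real using mgf0_pos[of \<theta>] by simp
  show "(K1 has_real_derivative K2 \<theta>) (at \<theta>)" for \<theta> by (rule K1_field_deriv[OF nz])
  have "continuous_on UNIV (K1 :: real \<Rightarrow> real)"
    by (intro continuous_at_imp_continuous_on ballI DERIV_isCont[OF K1_field_deriv[OF nz]])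
  moreover have "continuous_on UNIV (K2 :: real \<Rightarrow> real)"
    by (intro continuous_at_imp_continuous_on ballI DERIV_isCont[OF K2_deriv])
  ultimately show "continuous_on UNIV K3"
    unfolding K3_def by (intro continuous_intros cont_mgf) (use nz in auto)
  show "cgf \<mu> 0 = 0" by (simp add: cgf_def prob_space)
  show "0 < K1 \<theta>" "K1 \<theta> \<le> 1" for \<theta> :: real
    using mgf0_pos[of \<theta>] mgf1_pos[of \<theta>] mgf1_le[of \<theta>] by (auto simp: K1_def)
  show "K3 \<theta> * K1 \<theta> = - (real p - 2) * (K2 \<theta>)\<^sup>2 \<longleftrightarrow> \<theta> = \<theta>0" for \<theta>
    using ex[of \<theta>] by (simp only: cgf_derivs)
qed (use p cgf_deriv K2_deriv K2_pos in auto)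

text \<open>
  With \<open>A\<close> the holomorphic extension of the slope at \<open>\<beta>\<close>, the slope at \<open>\<beta> + (x, y)\<close> is \<open>A + x + y * C\<close>. The
  maximizer at \<open>\<beta>\<close> is a simple zero of \<open>A\<close>, and by continuity the maximizers of nearby parameters are the zeros
  in the same disc.
\<close>

lemma Psi_analytic_off_curve:
  assumes mf: "mean_field (cgf \<mu>) K1 K2 K3 p \<theta>0"
    and \<beta>: "0 \<le> snd \<beta>" "\<beta> \<notin> curve_of (mean_field.r (cgf \<mu>) K1 K2 p \<theta>0) (mean_field.b1c K1 K2 p \<theta>0)"
  shows "real_analytic_at_within (mean_field.\<Psi> (cgf \<mu>) K1 p) \<beta> upper_half_plane"
proof -
  interpret mf: mean_field "cgf \<mu>" K1 K2 K3 p \<theta>0 by (rule mf)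
  define t where "t = mf.opt \<beta>"
  have m: "mf.maximizers \<beta> = {t}" and neg: "mf.slope' (snd \<beta>) t < 0"
    using mf.off_curve[OF \<beta>] by (auto simp: t_def)
  have "isCont (mgf 0 :: complex \<Rightarrow> complex) (of_real t)" using mgf_deriv DERIV_isCont by blast
  then have "((\<lambda>z :: complex. Re (mgf 0 z)) \<longlongrightarrow> Re (mgf 0 (of_real t))) (at (of_real t))"
    by (auto simp: isCont_def intro: tendsto_Re)
  moreover have pos: "0 < Re (mgf 0 (of_real t))" using mgf0_pos by (simp add: mgf_of_real)
  ultimately have "eventually (\<lambda>z :: complex. 0 < Re (mgf 0 z)) (at (of_real t))" by (rule order_tendstoD(1))
  then obtain R where R: "0 < R" "\<And>z :: complex. z \<noteq> of_real t \<Longrightarrow> dist z (of_real t) < R \<Longrightarrow> 0 < Re (mgf 0 z)"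
    by (auto simp: eventually_at)
  have Re_pos: "0 < Re (mgf 0 z)" if "z \<in> ball (of_real t) R" for z :: complex
    using R(2)[of z] pos that by (cases "z = of_real t") (auto simp: dist_commute)
  then have nz: "mgf 0 z \<noteq> 0" if "z \<in> ball (of_real t) R" for z :: complex
    using that by fastforce
  have K1d: "(K1 has_field_derivative K2 z) (at z)" if "z \<in> ball (of_real t) R" for z :: complex
    by (rule K1_field_deriv[OF nz[OF that]])
  have mgf_hol: "mgf k holomorphic_on S" for k and S :: "complex set"
    using mgf_deriv holomorphic_on_def field_differentiable_def field_differentiable_at_within by metis
  have K1h: "K1 holomorphic_on ball (complex_of_real t) R"
    unfolding K1_def using nz by (intro holomorphic_intros mgf_hol) auto
  have K2h: "K2 holomorphic_on ball (complex_of_real t) R"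
    unfolding K2_def using nz by (intro holomorphic_intros mgf_hol K1h) auto
  have Kh: "(\<lambda>z. Ln (mgf 0 z)) holomorphic_on ball (complex_of_real t) R"
    using Re_pos by (intro holomorphic_intros mgf_hol) (auto simp: complex_nonpos_Reals_iff not_le)
  have powd: "((\<lambda>z. K1 z ^ (p - 1)) has_field_derivative (of_nat p - 1) * K1 z ^ (p - 2) * K2 z) (at z)"
    if "z \<in> ball (of_real t) R" for z :: complex
  proof -
    have "of_nat (p - 1) = (of_nat p - 1 :: complex)" "p - 1 - Suc 0 = p - 2" using mf.p2 by (auto simp: of_nat_diff)
    then show ?thesis using DERIV_power[OF K1d[OF that], of "p - 1"] by (simp add: mult_ac)
  qed
  define A where "A z = of_real (fst \<beta>) + of_nat p * of_real (snd \<beta>) * K1 z ^ (p - 1) - z / 2" for z :: complex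
  define A' where "A' z = of_nat p * of_real (snd \<beta>) * ((of_nat p - 1) * K1 z ^ (p - 2) * K2 z) - 1 / 2" for z :: complex
  define C where "C z = of_nat p * K1 z ^ (p - 1)" for z :: complex
  define C' where "C' z = of_nat p * ((of_nat p - 1) * K1 z ^ (p - 2) * K2 z)" for z :: complex
  define N0 where "N0 z = Ln (mgf 0 z) / 2 - (of_nat p - 1) * of_real (snd \<beta>) * K1 z ^ p" for z :: complex
  define N1 where "N1 z = - (of_nat p - 1) * K1 z ^ p" for z :: complex
  have slope_eq: "A (of_real s) + of_real x + of_real y * C (of_real s) = of_real (mf.slope (fst \<beta> + x, snd \<beta> + y) s)" for s x y
    by (simp add: A_def C_def mf.slope_def K1_of_real algebra_simps)
  have Psi_eq: "N0 (of_real s) + of_real y * N1 (of_real s) = of_real (mf.\<Psi> \<beta>')"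
    if "s \<in> mf.maximizers \<beta>'" "snd \<beta>' = snd \<beta> + y" for s y \<beta>'
  proof -
    have "Ln (mgf 0 (of_real s :: complex)) = of_real (cgf \<mu> s)"
      using mgf0_pos[of s] by (simp add: mgf_of_real Ln_of_real cgf_eq)
    then show ?thesis
      unfolding mf.Psi_at_maximizer[OF that(1)] N0_def N1_def that(2) by (simp add: K1_of_real algebra_simps)
  qed
  have "\<exists>f \<rho>. double_series f \<and> 0 < \<rho> \<and> (\<exists>e>0. \<forall>x y s. \<bar>x\<bar> < e \<longrightarrow> \<bar>y\<bar> < e \<longrightarrow> s \<in> ball (of_real t) \<rho> \<longrightarrow>
     A s + of_real x + of_real y * C s = 0 \<longrightarrow> f x y = N0 s + of_real y * N1 s)"
  proof (rule implicit_double_series[where R = R])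
    show "(A has_field_derivative A' z) (at z)" if "z \<in> ball (of_real t) R" for z
    proof -
      have "((\<lambda>z. of_real (fst \<beta>) + of_nat p * of_real (snd \<beta>) * K1 z ^ (p - 1) - z / 2) has_field_derivative
         0 + of_nat p * of_real (snd \<beta>) * ((of_nat p - 1) * K1 z ^ (p - 2) * K2 z) - 1 / 2) (at z)"
        by (intro DERIV_add DERIV_diff DERIV_cmult powd[OF that] DERIV_cdivide DERIV_const DERIV_ident)
      then show ?thesis by (simp add: A_def[abs_def] A'_def)
    qed
    show "(C has_field_derivative C' z) (at z)" if "z \<in> ball (of_real t) R" for z
      unfolding C_def[abs_def] C'_def by (intro DERIV_cmult powd[OF that])
    show "A' holomorphic_on ball (of_real t) R" "C' holomorphic_on ball (of_real t) R"
      "N0 holomorphic_on ball (of_real t) R" "N1 holomorphic_on ball (of_real t) R"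
      unfolding A'_def[abs_def] C'_def[abs_def] N0_def[abs_def] N1_def[abs_def]
      by (intro holomorphic_intros K1h K2h Kh; simp)+
    show "A (of_real t) = 0"
      using slope_eq[of t 0 0] mf.maximizer_slope[of t \<beta>] m by simp
    have "A' (of_real t) = of_real (mf.slope' (snd \<beta>) t)"
      by (simp add: A'_def mf.slope'_def mf.gain_def K1_of_real K2_of_real mult_ac)
    then show "Re (A' (of_real t)) < 0" using neg by simp
  qed (rule R(1))
  then obtain f \<rho> e1 where f: "double_series f" "0 < \<rho>" "0 < e1" and
    f_eq: "\<And>x y s. \<bar>x\<bar> < e1 \<Longrightarrow> \<bar>y\<bar> < e1 \<Longrightarrow> s \<in> ball (of_real t) \<rho> \<Longrightarrow>
     A s + of_real x + of_real y * C s = 0 \<Longrightarrow> f x y = N0 s + of_real y * N1 s" by blast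
  obtain a e2 where a: "sums_double a e2 f" using f(1) by (auto simp: double_series_def)
  obtain e3 where e3: "0 < e3" "\<And>\<beta>'. \<bar>fst \<beta>' - fst \<beta>\<bar> < e3 \<Longrightarrow> \<bar>snd \<beta>' - snd \<beta>\<bar> < e3 \<Longrightarrow> \<bar>mf.opt \<beta>' - t\<bar> < \<rho>"
    using mf.opt_near[OF m f(2)] by blast
  define e where "e = min e1 (min e2 e3)"
  have "0 < e" using f(3) a e3(1) by (simp add: e_def sums_double_def)
  moreover have "((\<lambda>(j, k). Re (a j k) * (x - fst \<beta>) ^ j * (y - snd \<beta>) ^ k) has_sum mf.\<Psi> (x, y)) UNIV"
    if xy: "\<bar>x - fst \<beta>\<bar> < e" "\<bar>y - snd \<beta>\<bar> < e" for x y
  proof -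
    define s where "s = mf.opt (x, y)"
    have s: "s \<in> mf.maximizers (x, y)" unfolding s_def by (rule mf.opt_maximizer)
    have "\<bar>s - t\<bar> < \<rho>" using e3(2)[of "(x, y)"] xy by (simp add: s_def e_def)
    then have ball: "of_real s \<in> ball (complex_of_real t) \<rho>"
      by (simp add: dist_of_real dist_real_def abs_minus_commute)
    have "f (x - fst \<beta>) (y - snd \<beta>) = N0 (of_real s) + of_real (y - snd \<beta>) * N1 (of_real s)"
    proof (rule f_eq[OF _ _ ball])
      show "A (of_real s) + of_real (x - fst \<beta>) + of_real (y - snd \<beta>) * C (of_real s) = 0"
        unfolding slope_eq using mf.maximizer_slope[OF s] by simp
    qed (use xy in \<open>auto simp: e_def\<close>)
    also have "\<dots> = of_real (mf.\<Psi> (x, y))" by (rule Psi_eq[OF s]) simp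
    finally have "((\<lambda>(j, k). a j k * of_real (x - fst \<beta>) ^ j * of_real (y - snd \<beta>) ^ k) has_sum of_real (mf.\<Psi> (x, y))) UNIV"
      using sums_doubleD[OF a, of "x - fst \<beta>" "y - snd \<beta>"] xy by (simp add: e_def)
    from has_sum_Re[OF this] show ?thesis
      by (simp add: case_prod_unfold of_real_power[symmetric] del: of_real_power of_real_diff)
  qed
  ultimately show ?thesis
    unfolding real_analytic_at_within_def by (intro exI[of _ "\<lambda>j k. Re (a j k)"] exI[of _ e]) simp
qed

end

text \<open>
  The normalization constant and \<open>\<Psi>\<close> agree for \<open>\<beta>\<^sub>2 \<ge> 0\<close> only, so their derivatives are compared where
  \<open>\<beta>\<^sub>2 > 0\<close>; the curve lies in that region.
\<close>

lemma partials_cong: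
  assumes "\<And>\<beta>. 0 < snd \<beta> \<Longrightarrow> f \<beta> = g \<beta>" "0 < snd z"
  shows "partial1 f z = partial1 g z" "partial2 f z = partial2 g z"
proof -
  show "partial1 f z = partial1 g z" unfolding partial1_def using assms by simp
  have "eventually (\<lambda>y. y \<in> {0<..}) (nhds (snd z))" using assms(2) by (intro eventually_nhds_in_open) auto
  then have "eventually (\<lambda>y. f (fst z, y) = g (fst z, y)) (nhds (snd z))"
    by eventually_elim (use assms(1) in simp)
  then show "partial2 f z = partial2 g z" unfolding partial2_def by (rule deriv_cong_ev) simp
qed

lemma filterlim_upper_cong:
  fixes z :: "real \<times> real"
  assumes "\<And>\<beta>. 0 < snd \<beta> \<Longrightarrow> f \<beta> = g \<beta>" "0 < snd z" "filterlim g G (at z within A)"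
  shows "filterlim f G (at z within A)"
proof -
  have "eventually (\<lambda>\<beta>. \<beta> \<in> {\<beta>. 0 < snd \<beta>}) (at z within A)"
    using assms(2) by (intro topological_tendstoD[OF tendsto_ident_at] open_Collect_less continuous_intros) auto
  then have "eventually (\<lambda>\<beta>. f \<beta> = g \<beta>) (at z within A)" by eventually_elim (use assms(1) in simp)
  then show ?thesis using assms(3) by (simp cong: filterlim_cong)
qed

lemma jump_between_cong:
  assumes "\<And>\<beta>. 0 < snd \<beta> \<Longrightarrow> f \<beta> = g \<beta>" "0 < snd z" "jump_between g A B z"
  shows "jump_between f A B z"
  using assms(3) filterlim_upper_cong[where f = f and g = g, OF assms(1,2)] unfolding jump_between_def by blast

theorem theorem3:
  fixes \<mu> :: "real measure" and H2 :: graph and p :: nat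
  assumes "prob_space \<mu>" and "sets \<mu> = sets borel"
    and "AE x in \<mu>. x \<in> {0..1}"
    and "nondegenerate \<mu>"
    and "simple_graph H2" and "card (snd H2) = p" and "2 \<le> p"
    and "\<exists>!\<theta>. (deriv ^^ 3) (cgf \<mu>) \<theta> * deriv (cgf \<mu>) \<theta>
              = - (real p - 2) * ((deriv ^^ 2) (cgf \<mu>) \<theta>)\<^sup>2"
  defines "\<psi> \<equiv> psi_inf \<mu> single_edge H2"
  shows "\<exists>b1c b2c r. 0 < b2c \<and> r b1c = b2c
    \<and> continuous_on {..b1c} r \<and> strict_antimono_on {..b1c} r
    \<and> (\<forall>\<beta>\<in>upper_half_plane.
          real_analytic_at_within \<psi> \<beta> upper_half_plane \<longleftrightarrow> \<beta> \<notin> curve_of r b1c)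
    \<and> (\<forall>b1<b1c.
          jump_between (partial1 \<psi>) (above_curve r b1c) (below_curve r b1c) (b1, r b1)
        \<and> jump_between (partial2 \<psi>) (above_curve r b1c) (below_curve r b1c) (b1, r b1))
    \<and> (\<exists>l. (partial1 \<psi> \<longlongrightarrow> l) (at (b1c, b2c) within - curve_of r b1c))
    \<and> (\<exists>l. (partial2 \<psi> \<longlongrightarrow> l) (at (b1c, b2c) within - curve_of r b1c))
    \<and> filterlim (partial1 (partial1 \<psi>)) at_infinity (at (b1c, b2c) within - curve_of r b1c)
    \<and> filterlim (partial1 (partial2 \<psi>)) at_infinity (at (b1c, b2c) within - curve_of r b1c)
    \<and> filterlim (partial2 (partial2 \<psi>)) at_infinity (at (b1c, b2c) within - curve_of r b1c)"
proof -
  interpret law: unit_law \<mu>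
    using assms(1-4) by (simp add: unit_law_def unit_law_axioms_def)
  \<comment> \<open>\<open>\<theta>0\<close> is the tilt at the end of the phase curve\<close>
  obtain \<theta>0 where crit: "\<And>\<theta>. (deriv ^^ 3) (cgf \<mu>) \<theta> * deriv (cgf \<mu>) \<theta>
      = - (real p - 2) * ((deriv ^^ 2) (cgf \<mu>) \<theta>)\<^sup>2 \<longleftrightarrow> \<theta> = \<theta>0"
    using assms(8) by (elim ex1E) blast
  have mfl: "mean_field (cgf \<mu>) law.K1 law.K2 law.K3 p \<theta>0"
    by (rule law.mean_field_law[OF assms(7) crit])
  then interpret mf: mean_field "cgf \<mu>" law.K1 law.K2 law.K3 p \<theta>0 .
  have psi: "\<psi> \<beta> = mf.\<Psi> \<beta>" if b2: "0 \<le> snd \<beta>" for \<beta>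
  proof -
    have "(\<lambda>n. psi_n \<mu> single_edge H2 n \<beta>) \<longlonglongrightarrow> mf.\<Psi> \<beta>"
    proof (rule law.psi_n_tendsto[OF assms(5,6,7) b2])
      show "cgf \<mu> (2 * (fst \<beta> + real p * snd \<beta> * v ^ (p - 1))) / 2 - snd \<beta> * (real p - 1) * v ^ p \<le> mf.\<Psi> \<beta>"
        if "v \<in> {0..1}" for v
        using mf.dual_le_Psi[OF b2, of v "fst \<beta>"] that by simp
      show "mf.\<Psi> \<beta> = fst \<beta> * law.K1 (mf.opt \<beta>) + snd \<beta> * law.K1 (mf.opt \<beta>) ^ p - (mf.opt \<beta> * law.K1 (mf.opt \<beta>) - cgf \<mu> (mf.opt \<beta>)) / 2"
        using mf.Psi_eq[OF mf.opt_maximizer, of \<beta>] by (simp add: mf.L_def mf.rate_def)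
    qed (rule mf.K_midpoint)
    then show ?thesis unfolding \<psi>_def psi_inf_def by (rule limI)
  qed
  have psi': "\<psi> \<beta> = mf.\<Psi> \<beta>" if "0 < snd \<beta>" for \<beta> using psi that by simp
  have p1: "partial1 \<psi> \<beta> = partial1 mf.\<Psi> \<beta>" and p2: "partial2 \<psi> \<beta> = partial2 mf.\<Psi> \<beta>" if "0 < snd \<beta>" for \<beta>
    using partials_cong[where f = \<psi> and g = mf.\<Psi>, OF psi' that] by auto
  have p11: "partial1 (partial1 \<psi>) \<beta> = partial1 (partial1 mf.\<Psi>) \<beta>"
    and p12: "partial1 (partial2 \<psi>) \<beta> = partial1 (partial2 mf.\<Psi>) \<beta>"
    and p22: "partial2 (partial2 \<psi>) \<beta> = partial2 (partial2 mf.\<Psi>) \<beta>" if "0 < snd \<beta>" for \<beta>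
    using partials_cong[where f = "partial1 \<psi>" and g = "partial1 mf.\<Psi>", OF p1 that]
      partials_cong[where f = "partial2 \<psi>" and g = "partial2 mf.\<Psi>", OF p2 that] by auto
  have bc: "0 < snd (mf.b1c, mf.b2c)" using mf.b2c_pos by simp
  have analytic: "real_analytic_at_within \<psi> \<beta> upper_half_plane \<longleftrightarrow> \<beta> \<notin> curve_of mf.r mf.b1c"
    if "\<beta> \<in> upper_half_plane" for \<beta>
  proof -
    have "real_analytic_at_within \<psi> \<beta> upper_half_plane \<longleftrightarrow> real_analytic_at_within mf.\<Psi> \<beta> upper_half_plane"
      unfolding real_analytic_at_within_def upper_half_plane_def using psi by auto
    then show ?thesis
      using law.Psi_analytic_off_curve[OF mfl, of \<beta>] mf.Psi_not_analytic_on_curve[of \<beta>] that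
      by (auto simp: upper_half_plane_def)
  qed
  have jumps: "jump_between (partial1 \<psi>) (above_curve mf.r mf.b1c) (below_curve mf.r mf.b1c) (b1, mf.r b1)
        \<and> jump_between (partial2 \<psi>) (above_curve mf.r mf.b1c) (below_curve mf.r mf.b1c) (b1, mf.r b1)"
    if "b1 < mf.b1c" for b1
  proof -
    have pos: "0 < snd (b1, mf.r b1)" using mf.r_ge[of b1] mf.b2c_pos that by simp
    show ?thesis
      using jump_between_cong[where f = "partial1 \<psi>" and g = "partial1 mf.\<Psi>", OF p1 pos mf.jumps(1)[OF that]] jump_between_cong[where f = "partial2 \<psi>" and g = "partial2 mf.\<Psi>", OF p2 pos mf.jumps(2)[OF that]] by blast
  qed
  let ?F = "at (mf.b1c, mf.b2c) within - curve_of mf.r mf.b1c"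
  have limits: "(partial1 \<psi> \<longlongrightarrow> law.K1 \<theta>0) ?F" "(partial2 \<psi> \<longlongrightarrow> law.K1 \<theta>0 ^ p) ?F"
    by (rule filterlim_upper_cong[where f = "partial1 \<psi>" and g = "partial1 mf.\<Psi>", OF p1 bc mf.first_partials_limit(1)], assumption)
       (rule filterlim_upper_cong[where f = "partial2 \<psi>" and g = "partial2 mf.\<Psi>", OF p2 bc mf.first_partials_limit(2)], assumption)
  have divergence: "filterlim (partial1 (partial1 \<psi>)) at_infinity ?F"
    "filterlim (partial1 (partial2 \<psi>)) at_infinity ?F" "filterlim (partial2 (partial2 \<psi>)) at_infinity ?F"
    by (rule filterlim_upper_cong[where f = "partial1 (partial1 \<psi>)" and g = "partial1 (partial1 mf.\<Psi>)", OF p11 bc mf.second_partials_diverge(1)], assumption)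
       (rule filterlim_upper_cong[where f = "partial1 (partial2 \<psi>)" and g = "partial1 (partial2 mf.\<Psi>)", OF p12 bc mf.second_partials_diverge(2)], assumption,
        rule filterlim_upper_cong[where f = "partial2 (partial2 \<psi>)" and g = "partial2 (partial2 mf.\<Psi>)", OF p22 bc mf.second_partials_diverge(3)], assumption)
  show ?thesis
  proof (rule exI[of _ mf.b1c], rule exI[of _ mf.b2c], rule exI[of _ mf.r], intro conjI)
    show "\<forall>\<beta>\<in>upper_half_plane. real_analytic_at_within \<psi> \<beta> upper_half_plane \<longleftrightarrow> \<beta> \<notin> curve_of mf.r mf.b1c"
      using analytic by blast
    show "\<forall>b1<mf.b1c. jump_between (partial1 \<psi>) (above_curve mf.r mf.b1c) (below_curve mf.r mf.b1c) (b1, mf.r b1)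
        \<and> jump_between (partial2 \<psi>) (above_curve mf.r mf.b1c) (below_curve mf.r mf.b1c) (b1, mf.r b1)"
      using jumps by blast
    show "\<exists>l. (partial1 \<psi> \<longlongrightarrow> l) ?F" "\<exists>l. (partial2 \<psi> \<longlongrightarrow> l) ?F"
      by (rule exI, rule limits)+
  qed (rule mf.b2c_pos mf.r_end mf.r_cont mf.r_strict_antimono divergence)+
qed

end
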